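(* Let $\theta\in\mathbb R$ and let $\nabla_0=d+\omega$, $\omega=\Psi^\dagger d\Psi$, be the basic instanton on $S^4_\theta$. For $i=0,\dots,4$ let $\nabla_{t,i}=\nabla_0+t\,\delta_i\omega+O(t^2)$ with $$\delta_0\omega=-z_0\omega-\tfrac12 dz_0\,\mathbb I_2+\Psi^\dagger\gamma_0\,d\Psi,\quad \delta_1\omega=-z_1\omega-\tfrac12 dz_1\,\mathbb I_2+\Psi^\dagger\gamma_1\,d\Psi,\quad \delta_2\omega=-z_2\omega-\tfrac12 dz_2\,\mathbb I_2+\Psi^\dagger\gamma_2\,d\Psi,$$ $$\delta_3\omega=-\omega z_1^*-\tfrac12 dz_1^*\,\mathbb I_2+\Psi^\dagger\gamma_1^*\,d\Psi,\quad \delta_4\omega=-\omega z_2^*-\tfrac12 dz_2^*\,\mathbb I_2+\Psi^\dagger\gamma_2^*\,d\Psi .$$ Then the connections $\nabla_{t,i}$ are (infinitesimal) instantons: their curvatures $F_{t,i}=\nabla_{t,i}^2$ satisfy $\ast_\theta F_{t,i}=F_{t,i}$ modulo $t^2$. Moreover, the connections $\nabla_{t,i}$ are not (infinitesimally) gauge equivalent to $\nabla_0$: for each $i$ there is no $X\in\Gamma^\infty(\mathrm{ad}(S^7_{\theta'}))$ with $\delta_i\omega=[\nabla_0,X]$.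
   Context: Fix $\theta\in\mathbb R$, $\lambda=e^{2\pi i\theta}$, $\mu=e^{\pi i\theta}$. Let $S^7\subset\mathbb C^4$ be the unit sphere with coordinate functions $\psi_1,\dots,\psi_4$. The torus $\widetilde{\mathbb T}^2=(\mathbb R/\mathbb Z)^2$ acts by $\tilde\sigma_s(\psi_1,\psi_2,\psi_3,\psi_4)=(e^{2\pi i s_1}\psi_1,e^{-2\pi i s_1}\psi_2,e^{-2\pi i s_2}\psi_3,e^{2\pi i s_2}\psi_4)$; a complex smooth differential form $\eta$ on $S^7$ has degree $r\in\mathbb Z^2$ if $\tilde\sigma_s\eta=e^{2\pi i r\cdot s}\eta$, and every form is a rapidly convergent sum of homogeneous ones. $\Omega(S^7_{\theta'})$ is the vector space of complex smooth forms on $S^7$ with the product determined on homogeneous elements of degrees $r,r'$ by $\eta\,\eta' := e^{\frac{\pi i\theta}{2}(r_1r_2'-r_2r_1')}\,\eta\wedge\eta'$; the differential $d$ and the involution $*$ (complex conjugation) are the classical ones. $C^\infty(S^7_{\theta'})$ is its degree-zero part. All products below and in the claim are deformed products. Put $\Psi=\begin{pmatrix}\psi_1&-\psi_2^*\\ \psi_2&\psi_1^*\\ \psi_3&-\psi_4^*\\ \psi_4&\psi_3^*\end{pmatrix}$. The group $\mathrm{SU}(2)$ acts by automorphisms $\alpha_w(\Psi)=\Psi w$; classically $S^7/\mathrm{SU}(2)=S^4$, and $\Omega(S^4_\theta)\subset\Omega(S^7_{\theta'})$ is the subalgebra of forms pulled back from $S^4$. It contains $z_0=2(\psi_1^*\psi_1+\psi_2^*\psi_2)-1$,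 $z_1=2(\psi_1\psi_3^*+\psi_2^*\psi_4)$, $z_2=2(-\psi_1^*\psi_4+\psi_2\psi_3^* )$. With $e_{ab}$ the $4\times4$ matrix units, the twisted Dirac matrices are $\gamma_0=\mathrm{diag}(1,1,-1,-1)$, $\gamma_1=2(e_{24}+\mu e_{31})$, $\gamma_2=2(-e_{14}+\bar\mu e_{32})$, and $\gamma_j^*$ denotes the conjugate transpose. $\Gamma^\infty(\mathrm{ad}(S^7_{\theta'}))$ is the set of $X\in C^\infty(S^7_{\theta'})\otimes(su(2)\otimes\mathbb C)$ with $(\alpha_w\otimes\mathrm{id})(X)=w^{-1}Xw$ for all $w\in\mathrm{SU}(2)$. The connection $\nabla_0 f=df+\omega f$ acts on the module $\{f\in C^\infty(S^7_{\theta'})\otimes\mathbb C^2:(\alpha_w\otimes\mathrm{id})f=w^{-1}f\}$; $[\nabla_0,X]=dX+\omega X-X\omega$. An infinitesimal gauge transformation is $\nabla_0\mapsto\nabla_0+t[\nabla_0,X]$. The Hodge operator $\ast_\theta$ on $\Omega(S^4_\theta)$ is, on the underlying vector space, the classical Hodge operator of the round metric on $S^4$, with the orientation for which $F_0=d\omega+\omega^2$ satisfies $\ast_\theta F_0=F_0$; it is extended to adjoint-bundle-valued forms $\Omega(S^4_\theta)\otimes_{C^\infty(S^4_\theta)}\Gamma^\infty(\mathrm{ad}(S^7_{\theta'}))$ by acting on the first factor. *)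

theory Defs
  imports "HOL-Analysis.Analysis" "HOL-Library.Function_Algebras"
begin

section \<open>Smooth complex differential forms on unit spheres\<close>

text \<open>
  A (mixed-degree) complex form \<open>\<eta>\<close> assigns to a point \<open>x\<close> and a list \<open>vs\<close> of tangent vectors the
  value of its component of degree \<open>length vs\<close> on \<open>vs\<close>. Forms on the unit sphere of a Euclidean
  space are extended by zero to all other points and vectors. Sums and differences of forms are
  the pointwise ones of \<^theory>\<open>HOL-Library.Function_Algebras\<close>; its pointwise multiplication is
  never used.
\<close>

type_synonym 'a form = "'a \<Rightarrow> 'a list \<Rightarrow> complex"

primrec Ck_on :: "nat \<Rightarrow> 'a::real_normed_vector set \<Rightarrow> ('a \<Rightarrow> 'b::real_normed_vector) \<Rightarrow> bool" where
  "Ck_on 0 S f \<longleftrightarrow> continuous_on S f"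
| "Ck_on (Suc k) S f \<longleftrightarrow> (\<forall>x\<in>S. f differentiable (at x)) \<and>
     (\<forall>v. Ck_on k S (\<lambda>x. frechet_derivative f (at x) v))"

text \<open>Only used for open \<open>S\<close> in a finite-dimensional space.\<close>

definition smooth_on :: "'a::real_normed_vector set \<Rightarrow> ('a \<Rightarrow> 'b::real_normed_vector) \<Rightarrow> bool" where
  "smooth_on S f \<longleftrightarrow> (\<forall>k. Ck_on k S f)"

definition sphere_tangent :: "'a::real_inner \<Rightarrow> 'a list \<Rightarrow> bool" where
  "sphere_tangent x vs \<longleftrightarrow> norm x = 1 \<and> (\<forall>v\<in>set vs. x \<bullet> v = 0)"

definition on_sphere :: "'a::real_inner form \<Rightarrow> 'a form" where
  "on_sphere \<eta> = (\<lambda>x vs. if sphere_tangent x vs then \<eta> x vs else 0)"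

definition pullback :: "('a::real_normed_vector \<Rightarrow> 'b::real_normed_vector) \<Rightarrow> 'b form \<Rightarrow> 'a form" where
  "pullback f \<eta> = (\<lambda>x vs. \<eta> (f x) (map (frechet_derivative f (at x)) vs))"

text \<open>Pullback along a map that is differentiable near the sphere and maps spheres to spheres.\<close>

definition sphere_pullback :: "('a::real_inner \<Rightarrow> 'b::real_inner) \<Rightarrow> 'b form \<Rightarrow> 'a form" where
  "sphere_pullback f \<eta> = on_sphere (pullback f \<eta>)"

text \<open>
  Smoothness is smoothness of the coefficients of the pullback to the complement of the origin
  along the radial retraction \<^const>\<open>sgn\<close>.
\<close>

definition sphere_forms :: "'a::euclidean_space form set" where
  "sphere_forms = {\<eta>. on_sphere \<eta> = \<eta> \<and>
     (\<forall>x us ws v w a b. sphere_tangent x (us @ v # w # ws) \<longrightarrow>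
        \<eta> x (us @ (a *\<^sub>R v + b *\<^sub>R w) # ws)
          = of_real a * \<eta> x (us @ v # ws) + of_real b * \<eta> x (us @ w # ws)) \<and>
     (\<forall>x vs. \<not> distinct vs \<longrightarrow> \<eta> x vs = 0) \<and>
     (\<forall>vs. smooth_on (- {0}) (\<lambda>x. pullback sgn \<eta> x vs))}"

definition sphere_functions :: "'a::euclidean_space form set" where
  "sphere_functions = {\<eta> \<in> sphere_forms. \<forall>x vs. vs \<noteq> [] \<longrightarrow> \<eta> x vs = 0}"

definition fn_form :: "('a::real_inner \<Rightarrow> complex) \<Rightarrow> 'a form" where
  "fn_form f = on_sphere (\<lambda>x vs. if vs = [] then f x else 0)"

definition cscale :: "complex \<Rightarrow> 'a form \<Rightarrow> 'a form" where
  "cscale c \<eta> = (\<lambda>x vs. c * \<eta> x vs)"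

definition form_cnj :: "'a form \<Rightarrow> 'a form" where
  "form_cnj \<eta> = (\<lambda>x vs. cnj (\<eta> x vs))"

text \<open>
  Sum over all shuffles: \<open>S\<close> is the set of positions of the arguments passed to \<open>\<eta>\<close>, and the
  exponent counts the inversions of the corresponding shuffle.
\<close>

definition wedge :: "'a form \<Rightarrow> 'a form \<Rightarrow> 'a form" where
  "wedge \<eta> \<zeta> = (\<lambda>x vs. \<Sum>S\<in>Pow {..<length vs}.
     (-1) ^ card {(i, j). i \<in> S \<and> j \<in> {..<length vs} - S \<and> j < i}
       * \<eta> x (nths vs S) * \<zeta> x (nths vs (- S)))"

text \<open>The flat exterior derivative (constant vector fields as arguments, so no bracket terms).\<close>

definition ext_deriv_flat :: "'a::real_normed_vector form \<Rightarrow> 'a form" where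
  "ext_deriv_flat \<eta> = (\<lambda>x vs. \<Sum>i<length vs.
     (-1) ^ i * frechet_derivative (\<lambda>y. \<eta> y (take i vs @ drop (Suc i) vs)) (at x) (vs ! i))"

text \<open>
  With \<open>\<iota>\<close> the inclusion of the sphere and \<open>\<rho>\<close> the radial retraction, \<open>\<rho> \<circ> \<iota> = id\<close> gives
  \<open>d\<eta> = \<iota>\<^sup>* d (\<rho>\<^sup>* \<eta>)\<close>.
\<close>

definition ext_deriv :: "'a::real_inner form \<Rightarrow> 'a form" where
  "ext_deriv \<eta> = on_sphere (ext_deriv_flat (pullback sgn \<eta>))"


section \<open>The deformed algebra of forms on the 7-sphere\<close>

text \<open>Indices in the type \<^typ>\<open>4\<close> are \<open>1, 2, 3, 4\<close>, where \<open>4 = 0\<close>; similarly for \<^typ>\<open>2\<close> and \<^typ>\<open>5\<close>.\<close>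

type_synonym s7_form = "(complex^4) form"

definition torus_act :: "real \<times> real \<Rightarrow> complex^4 \<Rightarrow> complex^4" where
  "torus_act s x = vector
     [cis (2 * pi * fst s) * x $ 1, cis (- 2 * pi * fst s) * x $ 2,
      cis (- 2 * pi * snd s) * x $ 3, cis (2 * pi * snd s) * x $ 4]"

text \<open>The homogeneous component of degree \<open>r\<close>, as a Fourier coefficient along the torus orbits.\<close>

definition homog_comp :: "int \<times> int \<Rightarrow> s7_form \<Rightarrow> s7_form" where
  "homog_comp r \<eta> = (\<lambda>x vs. integral (cbox (0, 0) (1, 1))
     (\<lambda>s. cis (- 2 * pi * (of_int (fst r) * fst s + of_int (snd r) * snd s))
            * sphere_pullback (torus_act s) \<eta> x vs))"

text \<open>
  The bilinear extension, through the decomposition of both factors into homogeneous components,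
  of \<open>\<eta> \<zeta> = exp (\<pi>\<i>\<theta>/2 (r\<^sub>1 q\<^sub>2 - r\<^sub>2 q\<^sub>1)) \<eta> \<and> \<zeta>\<close> for \<open>\<eta>\<close>, \<open>\<zeta>\<close> homogeneous of degrees \<open>r\<close>, \<open>q\<close>.
\<close>

definition dprod :: "real \<Rightarrow> s7_form \<Rightarrow> s7_form \<Rightarrow> s7_form" where
  "dprod \<theta> \<eta> \<zeta> = (\<lambda>x vs. infsum (\<lambda>(r, q).
     cis (pi * \<theta> / 2 * of_int (fst r * snd q - snd r * fst q))
       * wedge (homog_comp r \<eta>) (homog_comp q \<zeta>) x vs) UNIV)"

definition mat_prod :: "real \<Rightarrow> s7_form^'k^'m \<Rightarrow> s7_form^'n^'k \<Rightarrow> s7_form^'n^'m" where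
  "mat_prod \<theta> M N = (\<chi> i j. \<Sum>k\<in>UNIV. dprod \<theta> (M $ i $ k) (N $ k $ j))"

definition left_mult :: "real \<Rightarrow> s7_form \<Rightarrow> s7_form^'n^'m \<Rightarrow> s7_form^'n^'m" where
  "left_mult \<theta> \<eta> M = map_matrix (\<lambda>\<zeta>. dprod \<theta> \<eta> \<zeta>) M"

definition right_mult :: "real \<Rightarrow> s7_form^'n^'m \<Rightarrow> s7_form \<Rightarrow> s7_form^'n^'m" where
  "right_mult \<theta> M \<eta> = map_matrix (\<lambda>\<zeta>. dprod \<theta> \<zeta> \<eta>) M"

definition mat_deriv :: "s7_form^'n^'m \<Rightarrow> s7_form^'n^'m" where
  "mat_deriv M = map_matrix ext_deriv M"

definition mat_dagger :: "s7_form^'n^'m \<Rightarrow> s7_form^'m^'n" where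
  "mat_dagger M = (\<chi> i j. form_cnj (M $ j $ i))"

definition const_mult_left :: "complex^'k^'m \<Rightarrow> s7_form^'n^'k \<Rightarrow> s7_form^'n^'m" where
  "const_mult_left C M = (\<chi> i j. \<Sum>k\<in>UNIV. cscale (C $ i $ k) (M $ k $ j))"

definition const_mult_right :: "s7_form^'k^'m \<Rightarrow> complex^'n^'k \<Rightarrow> s7_form^'n^'m" where
  "const_mult_right M C = (\<chi> i j. \<Sum>k\<in>UNIV. cscale (C $ k $ j) (M $ i $ k))"

definition scalar_mat :: "s7_form \<Rightarrow> s7_form^'n^'n" where
  "scalar_mat \<eta> = (\<chi> i j. if i = j then \<eta> else 0)"


section \<open>The Hopf fibration over the 4-sphere\<close>

definition Psi_at :: "complex^4 \<Rightarrow> complex^2^4" where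
  "Psi_at x = vector [vector [x $ 1, - cnj (x $ 2)], vector [x $ 2, cnj (x $ 1)],
                      vector [x $ 3, - cnj (x $ 4)], vector [x $ 4, cnj (x $ 3)]]"

definition conj_transpose :: "complex^'n^'m \<Rightarrow> complex^'m^'n" where
  "conj_transpose C = (\<chi> i j. cnj (C $ j $ i))"

definition SU2 :: "(complex^2^2) set" where
  "SU2 = {w. conj_transpose w ** w = mat 1 \<and> det w = 1}"

text \<open>
  The point whose matrix is \<^term>\<open>Psi_at x ** w\<close>: a point of \<open>\<complex>\<^sup>4\<close> is the first column of its
  matrix. The automorphism \<open>\<alpha>\<^sub>w\<close> of the function algebra is the pullback along this map, which
  commutes with \<^const>\<open>torus_act\<close>.
\<close>

definition SU2_act :: "complex^2^2 \<Rightarrow> complex^4 \<Rightarrow> complex^4" where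
  "SU2_act w x = (\<chi> i. (Psi_at x ** w) $ i $ 1)"

text \<open>The quotient map by \<^const>\<open>SU2\<close>, onto the unit sphere of \<open>\<real> \<times> \<complex> \<times> \<complex> = \<real>\<^sup>5\<close>.\<close>

definition hopf :: "complex^4 \<Rightarrow> real^5" where
  "hopf x = (let w1 = 2 * (x $ 1 * cnj (x $ 3) + cnj (x $ 2) * x $ 4);
                 w2 = 2 * (- cnj (x $ 1) * x $ 4 + x $ 2 * cnj (x $ 3))
             in vector [2 * ((cmod (x $ 1))\<^sup>2 + (cmod (x $ 2))\<^sup>2) - 1, Re w1, Im w1, Re w2, Im w2])"

text \<open>
  Volume form of the round metric. The sign is the orientation for which the curvature of the
  basic instanton is self-dual: a tangent frame \<open>v\<^sub>1, \<dots>, v\<^sub>4\<close> at \<open>p\<close> is positive iff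
  \<open>det (p, v\<^sub>1, \<dots>, v\<^sub>4) < 0\<close> in the coordinates of \<^const>\<open>hopf\<close>.
\<close>

definition vol4 :: "real^5 \<Rightarrow> (real^5) list \<Rightarrow> real" where
  "vol4 p vs = - det (vector (p # vs) :: real^5^5)"

text \<open>
  Classical Hodge operator: for a positive orthonormal frame \<open>e\<close> of the tangent space at \<open>p\<close>,
  \<open>(\<ast>\<eta>)(vs) = \<Sum>\<^sub>I \<eta>(e\<^sub>I) vol(e\<^sub>I, vs)\<close>, the sum being over increasing multi-indices \<open>I\<close> of length
  \<open>k = 4 - length vs\<close>, or \<open>1 / k!\<close> times the sum over all of them. The latter is written with the
  tangential projections of the standard basis of \<open>\<real>\<^sup>5\<close> in place of a frame: both
  \<open>\<Sum>\<^sub>i e\<^sub>i \<otimes> e\<^sub>i\<close> and \<open>\<Sum>\<^sub>b Pb \<otimes> Pb\<close> are the inverse metric on the tangent space.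
\<close>

definition tangent_proj :: "'a::real_inner \<Rightarrow> 'a \<Rightarrow> 'a" where
  "tangent_proj p b = b - (p \<bullet> b) *\<^sub>R p"

definition hodge4 :: "(real^5) form \<Rightarrow> (real^5) form" where
  "hodge4 \<eta> = on_sphere (\<lambda>p vs. if length vs \<le> 4
     then (\<Sum>bs\<in>{bs. set bs \<subseteq> Basis \<and> length bs = 4 - length vs}.
             \<eta> p (map (tangent_proj p) bs)
               * of_real (vol4 p (map (tangent_proj p) bs @ vs))) / fact (4 - length vs)
     else 0)"


section \<open>Sections and forms with values in the adjoint bundle\<close>

text \<open>\<open>su(2) \<otimes> \<complex>\<close> is the space of trace-free complex matrices.\<close>

definition Gamma_ad :: "(s7_form^2^2) set" where
  "Gamma_ad = {X. (\<forall>i j. X $ i $ j \<in> sphere_functions) \<and> X $ 1 $ 1 + X $ 2 $ 2 = 0 \<and>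
     (\<forall>w\<in>SU2. map_matrix (sphere_pullback (SU2_act w)) X
        = const_mult_left (matrix_inv w) (const_mult_right X w))}"

text \<open>
  \<open>(F, G)\<close> belongs to \<open>ad_hodge_graph \<theta>\<close> iff \<open>F = \<Sum>\<^sub>k \<eta>\<^sub>k X\<^sub>k\<close> and \<open>G = \<Sum>\<^sub>k (\<ast>\<eta>\<^sub>k) X\<^sub>k\<close> for finitely many
  \<open>\<eta>\<^sub>k\<close> pulled back from the 4-sphere and \<open>X\<^sub>k\<close> in \<^const>\<open>Gamma_ad\<close>. Adjoint-bundle-valued forms,
  i.e. elements of the tensor product over the functions on the 4-sphere, are identified with
  their images \<open>F\<close> under the (injective) multiplication map.
\<close>

definition ad_hodge_graph :: "real \<Rightarrow> ((s7_form^2^2) \<times> (s7_form^2^2)) set" where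
  "ad_hodge_graph \<theta> = {(F, G). \<exists>(n::nat) \<zeta> X.
     (\<forall>k<n. \<zeta> k \<in> sphere_forms \<and> X k \<in> Gamma_ad) \<and>
     F = (\<Sum>k<n. left_mult \<theta> (sphere_pullback hopf (\<zeta> k)) (X k)) \<and>
     G = (\<Sum>k<n. left_mult \<theta> (sphere_pullback hopf (hodge4 (\<zeta> k))) (X k))}"

definition ad_forms :: "real \<Rightarrow> (s7_form^2^2) set" where
  "ad_forms \<theta> = Domain (ad_hodge_graph \<theta>)"

definition ad_hodge :: "real \<Rightarrow> s7_form^2^2 \<Rightarrow> s7_form^2^2" where
  "ad_hodge \<theta> F = (THE G. (F, G) \<in> ad_hodge_graph \<theta>)"


section \<open>The basic instanton and its infinitesimal deformations\<close>

definition psi :: "4 \<Rightarrow> s7_form" where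
  "psi i = fn_form (\<lambda>x. x $ i)"

definition Psi :: "s7_form^2^4" where
  "Psi = (\<chi> i j. fn_form (\<lambda>x. Psi_at x $ i $ j))"

definition omega :: "real \<Rightarrow> s7_form^2^2" where
  "omega \<theta> = mat_prod \<theta> (mat_dagger Psi) (mat_deriv Psi)"

definition z0 :: "real \<Rightarrow> s7_form" where
  "z0 \<theta> = cscale 2 (dprod \<theta> (form_cnj (psi 1)) (psi 1) + dprod \<theta> (form_cnj (psi 2)) (psi 2))
            - fn_form (\<lambda>_. 1)"

definition z1 :: "real \<Rightarrow> s7_form" where
  "z1 \<theta> = cscale 2 (dprod \<theta> (psi 1) (form_cnj (psi 3)) + dprod \<theta> (form_cnj (psi 2)) (psi 4))"

definition z2 :: "real \<Rightarrow> s7_form" where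
  "z2 \<theta> = cscale 2 (- dprod \<theta> (form_cnj (psi 1)) (psi 4) + dprod \<theta> (psi 2) (form_cnj (psi 3)))"

definition mat_unit :: "4 \<Rightarrow> 4 \<Rightarrow> complex^4^4" where
  "mat_unit a b = (\<chi> i j. if i = a \<and> j = b then 1 else 0)"

definition gamma0 :: "complex^4^4" where
  "gamma0 = mat_unit 1 1 + mat_unit 2 2 - mat_unit 3 3 - mat_unit 4 4"

definition gamma1 :: "real \<Rightarrow> complex^4^4" where
  "gamma1 \<theta> = (\<chi> i j. 2 * (mat_unit 2 4 $ i $ j + cis (pi * \<theta>) * mat_unit 3 1 $ i $ j))"

definition gamma2 :: "real \<Rightarrow> complex^4^4" where
  "gamma2 \<theta> = (\<chi> i j. 2 * (- mat_unit 1 4 $ i $ j + cnj (cis (pi * \<theta>)) * mat_unit 3 2 $ i $ j))"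

definition Psi_gamma_dPsi :: "real \<Rightarrow> complex^4^4 \<Rightarrow> s7_form^2^2" where
  "Psi_gamma_dPsi \<theta> C = mat_prod \<theta> (mat_dagger Psi) (const_mult_left C (mat_deriv Psi))"

definition delta_left :: "real \<Rightarrow> s7_form \<Rightarrow> complex^4^4 \<Rightarrow> s7_form^2^2" where
  "delta_left \<theta> z C = - left_mult \<theta> z (omega \<theta>) - scalar_mat (cscale (1/2) (ext_deriv z))
                        + Psi_gamma_dPsi \<theta> C"

definition delta_right :: "real \<Rightarrow> s7_form \<Rightarrow> complex^4^4 \<Rightarrow> s7_form^2^2" where
  "delta_right \<theta> z C = - right_mult \<theta> (omega \<theta>) z - scalar_mat (cscale (1/2) (ext_deriv z))
                         + Psi_gamma_dPsi \<theta> C"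

definition delta_omega :: "real \<Rightarrow> nat \<Rightarrow> s7_form^2^2" where
  "delta_omega \<theta> i =
     [delta_left \<theta> (z0 \<theta>) gamma0,
      delta_left \<theta> (z1 \<theta>) (gamma1 \<theta>),
      delta_left \<theta> (z2 \<theta>) (gamma2 \<theta>),
      delta_right \<theta> (form_cnj (z1 \<theta>)) (conj_transpose (gamma1 \<theta>)),
      delta_right \<theta> (form_cnj (z2 \<theta>)) (conj_transpose (gamma2 \<theta>))] ! i"

text \<open>
  \<open>A\<close> is the sequence of coefficients of a formal power series \<open>\<Sum>\<^sub>n t\<^sup>n A\<^sub>n\<close> of connection forms; the
  result is the coefficient of \<open>t\<^sup>n\<close> in the curvature \<open>(d + A)\<^sup>2 = dA + A A\<close>.
\<close>

definition curvature_coeff :: "real \<Rightarrow> (nat \<Rightarrow> s7_form^2^2) \<Rightarrow> nat \<Rightarrow> s7_form^2^2" where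
  "curvature_coeff \<theta> A n = mat_deriv (A n) + (\<Sum>k\<le>n. mat_prod \<theta> (A k) (A (n - k)))"

definition nabla0_bracket :: "real \<Rightarrow> s7_form^2^2 \<Rightarrow> s7_form^2^2" where
  "nabla0_bracket \<theta> X = mat_deriv X + mat_prod \<theta> (omega \<theta>) X - mat_prod \<theta> X (omega \<theta>)"

end

theory Submission
  imports Defs
begin

text \<open>The deformation acts only through phases. The forms in the curvature computation are
  homogeneous under the torus, and a deformed product of homogeneous forms is the wedge product
  times a phase (\<open>dprod_homogeneous\<close>). The potential \<open>omega \<theta>\<close> has
  degree 0, so products with it carry no phase. Write Psi^H for the adjoint of Psi. The powers of
  \<mu> in a twisted Dirac matrix C make Psi^H C dPsi equal to c Psi^H g dPsi, where g is the
  untwisted matrix and c a constant of modulus 1, and the coordinate z carries the same constant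
  (\<open>gamma_phase\<close>, \<open>z_eq\<close>). So each deformation is c times a classical
  1-form, whether z stands to the left or to the right of the potential
  (\<open>delta_forms\<close>). The locale \<open>conformal_direction\<close> treats all five at
  once.

  Curvature: let P = Psi Psi^H and let h be the scalar with Psi^H g Psi = h 1. Then P = (1 + Gam p)
  / 2 at the image point p on the 4-sphere, where \<open>Gam\<close> is the Clifford map of R^5, and
  the Clifford relations give P g + g P = g + h. This removes g from the linearized curvature, which
  becomes -2 c h F_0 (\<open>curvature_coeff_1\<close>). It remains to see that function multiples
  of F_0 are self-dual. Now F_0 = Psi^H P [dP, dP] Psi with dP = Gam(dp) / 2; dualizing a commutator
  of Clifford matrices multiplies it by \<open>Gam p\<close> (\<open>sum_Gam_comm_vol4\<close>), and
  P absorbs that factor (\<open>spin_curv_self_dual\<close>).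

  Hodge operator: \<open>ad_hodge\<close> is a definite description over all presentations of a form
  as a sum of products eta_k X_k, so its value must not depend on the presentation. The classical
  Hodge operator commutes with the rotations of the 4-sphere induced by the torus. Hence it commutes
  with taking Fourier components, and its value can be read off from the product alone, by lifting
  tangent vectors to the 7-sphere (\<open>ad_hodge_graph_hodge7\<close>). As the X_k are arbitrary
  smooth sections, interchanging its finite sums with the infinite sums in \<open>dprod\<close>
  needs absolutely summable Fourier coefficients (\<open>fourier_coeff_abs_summable\<close>). An
  explicit presentation of the multiples of F_0 by self-dual 2-forms is given in
  \<open>basic_curv_self_dual\<close>.

  Gauge inequivalence: on a horizontal great circle on which h vanishes, the potential is zero on
  the velocity, so [nabla_0, X] is there the derivative of a periodic function and cannot be a
  nonzero constant. The deformation is such a constant (\<open>not_gauge\<close>).\<close>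

section \<open>Calculus of smooth functions on open sets\<close>

lemma Ck_on_imp_continuous_on: "Ck_on k S f \<Longrightarrow> continuous_on S f"
proof (cases k)
  case (Suc j)
  assume "Ck_on k S f"
  then have "f differentiable (at x)" if "x \<in> S" for x using that Suc by simp
  then have "isCont f x" if "x \<in> S" for x
    using that differentiable_imp_continuous_within by blast
  then show ?thesis by (simp add: continuous_at_imp_continuous_on)
qed simp

lemma Ck_on_SucD: "Ck_on (Suc k) S f \<Longrightarrow> Ck_on k S f"
proof (induction k arbitrary: f)
  case 0
  from Ck_on_imp_continuous_on[OF this] show ?case by simp
next
  case (Suc k)
  then show ?case by (subst Ck_on.simps) (use Suc in \<open>auto simp del: Ck_on.simps simp: Ck_on.simps(2)[of "Suc k"]\<close>)
qed

lemma Ck_on_cong: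
  assumes "open S" "\<And>x. x \<in> S \<Longrightarrow> f x = g x" "Ck_on k S f"
  shows "Ck_on k S g"
  using assms(2,3)
proof (induction k arbitrary: f g)
  case 0
  then show ?case using continuous_on_cong[of S S f g] by simp
next
  case (Suc k)
  have D: "f differentiable at x" if "x \<in> S" for x
    using Suc.prems that by simp
  have eq: "frechet_derivative f (at x) = frechet_derivative g (at x)" if "x \<in> S" for x
    using frechet_derivative_transform_within_open[OF D[OF that] assms(1) that Suc.prems(1)] .
  have "g differentiable at x" if "x \<in> S" for x
    using has_derivative_transform_within_open[OF D[OF that, unfolded frechet_derivative_works] assms(1) that Suc.prems(1)]
    unfolding differentiable_def by blast
  moreover have "Ck_on k S (\<lambda>x. frechet_derivative g (at x) v)" for v
    by (rule Suc.IH[of "\<lambda>x. frechet_derivative f (at x) v"]) (use eq Suc.prems(2) in auto)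
  ultimately show ?case by simp
qed

text \<open>Lets inductions on the order work with any explicit derivative formula instead of
  \<open>frechet_derivative\<close>.\<close>

lemma Ck_on_SucI:
  assumes "open S" "\<And>x. x \<in> S \<Longrightarrow> (f has_derivative f' x) (at x)"
    and "\<And>v. Ck_on k S (\<lambda>x. f' x v)"
  shows "Ck_on (Suc k) S f"
proof -
  have "f' x = frechet_derivative f (at x)" if "x \<in> S" for x
    using frechet_derivative_at[OF assms(2)[OF that]] .
  then have "Ck_on k S (\<lambda>x. frechet_derivative f (at x) v)" for v
    by (intro Ck_on_cong[OF assms(1) _ assms(3)[of v]]) auto
  moreover have "f differentiable at x" if "x \<in> S" for x
    using assms(2)[OF that] unfolding differentiable_def by blast
  ultimately show ?thesis by simp
qed

lemma Ck_on_SucE: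
  assumes "Ck_on (Suc k) S f" "x \<in> S"
  shows "(f has_derivative frechet_derivative f (at x)) (at x)"
  using assms by (simp add: frechet_derivative_works[symmetric])

lemma Ck_on_const: "Ck_on k S (\<lambda>x. c)"
  by (induction k arbitrary: c) (auto simp: frechet_derivative_const)

lemma Ck_on_bounded_linear:
  assumes "bounded_linear h" "open S" "Ck_on k S f"
  shows "Ck_on k S (\<lambda>x. h (f x))"
  using assms(3)
proof (induction k arbitrary: f)
  case 0
  then show ?case using bounded_linear.continuous_on[OF assms(1)] by simp
next
  case (Suc k)
  show ?case
    by (rule Ck_on_SucI[OF assms(2) bounded_linear.has_derivative[OF assms(1) Ck_on_SucE[OF Suc.prems]]])
       (use Suc in auto)
qed

lemma Ck_on_linear:
  assumes "bounded_linear h" "open S" shows "Ck_on k S h"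
proof (cases k)
  case 0
  then show ?thesis using bounded_linear.continuous_on[OF assms(1) continuous_on_id] by simp
next
  case (Suc j)
  show ?thesis unfolding Suc
    by (rule Ck_on_SucI[OF assms(2) bounded_linear_imp_has_derivative[OF assms(1)] Ck_on_const])
qed

lemma Ck_on_add:
  assumes "open S" "Ck_on k S f" "Ck_on k S g"
  shows "Ck_on k S (\<lambda>x. f x + g x)"
  using assms(2,3)
proof (induction k arbitrary: f g)
  case 0
  then show ?case by (simp add: continuous_on_add)
next
  case (Suc k)
  show ?case
    by (rule Ck_on_SucI[OF assms(1) has_derivative_add[OF Ck_on_SucE[OF Suc.prems(1)] Ck_on_SucE[OF Suc.prems(2)]]])
       (use Suc in auto)
qed

lemma Ck_on_bilinear:
  assumes "bounded_bilinear h" "open S" "Ck_on k S f" "Ck_on k S g"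
  shows "Ck_on k S (\<lambda>x. h (f x) (g x))"
  using assms(3,4)
proof (induction k arbitrary: f g)
  case 0
  then show ?case using bounded_bilinear.continuous_on[OF assms(1)] by simp
next
  case (Suc k)
  show ?case
    by (rule Ck_on_SucI[OF assms(2) bounded_bilinear.FDERIV[OF assms(1) Ck_on_SucE[OF Suc.prems(1)] Ck_on_SucE[OF Suc.prems(2)]]])
       (use Suc Ck_on_SucD[OF Suc.prems(1)] Ck_on_SucD[OF Suc.prems(2)] in
         \<open>auto intro!: Ck_on_add assms(2)\<close>)
qed

lemma Ck_on_sum:
  assumes "open S" "\<And>i. i \<in> I \<Longrightarrow> Ck_on k S (f i)"
  shows "Ck_on k S (\<lambda>x. \<Sum>i\<in>I. f i x)"
  using assms(2)
  by (induction I rule: infinite_finite_induct) (auto intro: Ck_on_const Ck_on_add assms(1))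

text \<open>\<open>Ck_on\<close> controls derivatives in fixed directions only, while the chain rule
  applies f' to the moving direction g'(x) v. Expanding that direction in the basis of the middle
  space reduces to fixed directions, whence its finite dimension.\<close>

lemma Ck_on_compose:
  fixes g :: "'a::real_normed_vector \<Rightarrow> 'b::euclidean_space" and f :: "'b \<Rightarrow> 'c::real_normed_vector"
  assumes "open S" "open T" "\<And>x. x \<in> S \<Longrightarrow> g x \<in> T" "Ck_on k S g" "Ck_on k T f"
  shows "Ck_on k S (\<lambda>x. f (g x))"
  using assms(4,5)
proof (induction k arbitrary: f)
  case 0
  then show ?case using continuous_on_compose2[of T f S g] assms(3) by auto
next
  case (Suc k)
  let ?g' = "\<lambda>x. frechet_derivative g (at x)" and ?f' = "\<lambda>y. frechet_derivative f (at y)"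
  show ?case
  proof (rule Ck_on_SucI[OF assms(1)])
    show "((\<lambda>x. f (g x)) has_derivative (\<lambda>v. ?f' (g x) (?g' x v))) (at x)" if "x \<in> S" for x
      by (rule has_derivative_compose[OF Ck_on_SucE[OF Suc.prems(1) that]
            Ck_on_SucE[OF Suc.prems(2) assms(3)[OF that]]])
    show "Ck_on k S (\<lambda>x. ?f' (g x) (?g' x v))" for v
    proof (rule Ck_on_cong[OF assms(1)])
      show "(\<Sum>b\<in>Basis. (?g' x v \<bullet> b) *\<^sub>R ?f' (g x) b) = ?f' (g x) (?g' x v)" if "x \<in> S" for x
      proof -
        have "linear (?f' (g x))"
          using Ck_on_SucE[OF Suc.prems(2) assms(3)[OF that]] has_derivative_linear by blast
        then have "?f' (g x) (\<Sum>b\<in>Basis. (?g' x v \<bullet> b) *\<^sub>R b) = (\<Sum>b\<in>Basis. (?g' x v \<bullet> b) *\<^sub>R ?f' (g x) b)"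
          by (simp add: linear_sum linear_cmul)
        then show ?thesis by (simp add: euclidean_representation)
      qed
      have "Ck_on k S (\<lambda>x. ?f' (g x) b)" for b
        using Suc.IH[OF Ck_on_SucD[OF Suc.prems(1)], of "\<lambda>y. ?f' y b"] Suc.prems(2) by simp
      then show "Ck_on k S (\<lambda>x. \<Sum>b\<in>Basis. (?g' x v \<bullet> b) *\<^sub>R ?f' (g x) b)"
        using Suc.prems(1)
        by (intro Ck_on_sum Ck_on_bilinear[OF bounded_bilinear_scaleR] assms(1)
              Ck_on_bounded_linear[OF bounded_linear_inner_left]) auto
    qed
  qed
qed

lemma smooth_on_const: "smooth_on S (\<lambda>x. c)"
  by (simp add: smooth_on_def Ck_on_const)

lemma smooth_on_linear: "bounded_linear h \<Longrightarrow> open S \<Longrightarrow> smooth_on S h"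
  by (simp add: smooth_on_def Ck_on_linear)

lemma smooth_on_bounded_linear:
  "bounded_linear h \<Longrightarrow> open S \<Longrightarrow> smooth_on S f \<Longrightarrow> smooth_on S (\<lambda>x. h (f x))"
  by (simp add: smooth_on_def Ck_on_bounded_linear)

lemma smooth_on_add:
  "open S \<Longrightarrow> smooth_on S f \<Longrightarrow> smooth_on S g \<Longrightarrow> smooth_on S (\<lambda>x. f x + g x)"
  by (simp add: smooth_on_def Ck_on_add)

lemma smooth_on_bilinear:
  "bounded_bilinear h \<Longrightarrow> open S \<Longrightarrow> smooth_on S f \<Longrightarrow> smooth_on S g \<Longrightarrow> smooth_on S (\<lambda>x. h (f x) (g x))"
  by (simp add: smooth_on_def Ck_on_bilinear)

lemmas smooth_on_scaleR = smooth_on_bilinear[OF bounded_bilinear_scaleR]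
lemmas smooth_on_mult = smooth_on_bilinear[OF bounded_bilinear_mult]
lemmas smooth_on_inner = smooth_on_bilinear[OF bounded_bilinear_inner]
lemma smooth_on_minus: "open S \<Longrightarrow> smooth_on S f \<Longrightarrow> smooth_on S (\<lambda>x. - f x)"
  using smooth_on_bounded_linear[OF bounded_linear_minus[OF bounded_linear_ident]] .

lemma smooth_on_diff:
  "open S \<Longrightarrow> smooth_on S f \<Longrightarrow> smooth_on S g \<Longrightarrow> smooth_on S (\<lambda>x. f x - g x)"
  using smooth_on_add[of S f "\<lambda>x. - g x"] smooth_on_minus[of S g] by simp

lemma smooth_on_sum:
  "open S \<Longrightarrow> (\<And>i. i \<in> I \<Longrightarrow> smooth_on S (f i)) \<Longrightarrow> smooth_on S (\<lambda>x. \<Sum>i\<in>I. f i x)"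
  by (simp add: smooth_on_def Ck_on_sum)

lemma smooth_on_compose:
  fixes g :: "'a::real_normed_vector \<Rightarrow> 'b::euclidean_space"
  shows "open S \<Longrightarrow> open T \<Longrightarrow> (\<And>x. x \<in> S \<Longrightarrow> g x \<in> T) \<Longrightarrow> smooth_on S g \<Longrightarrow> smooth_on T f \<Longrightarrow>
    smooth_on S (\<lambda>x. f (g x))"
  by (simp add: smooth_on_def Ck_on_compose)

lemma smooth_on_cong:
  "open S \<Longrightarrow> (\<And>x. x \<in> S \<Longrightarrow> f x = g x) \<Longrightarrow> smooth_on S f \<Longrightarrow> smooth_on S g"
  unfolding smooth_on_def by (blast intro: Ck_on_cong)

lemma smooth_on_imp_continuous_on: "smooth_on S f \<Longrightarrow> continuous_on S f"
  unfolding smooth_on_def using Ck_on_imp_continuous_on by blast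

lemma smooth_on_has_derivative:
  "smooth_on S f \<Longrightarrow> x \<in> S \<Longrightarrow> (f has_derivative frechet_derivative f (at x)) (at x)"
  unfolding smooth_on_def using Ck_on_SucE by blast

lemma smooth_on_frechet_derivative:
  "smooth_on S f \<Longrightarrow> smooth_on S (\<lambda>x. frechet_derivative f (at x) v)"
  unfolding smooth_on_def using Ck_on.simps(2) by blast

text \<open>The derivative of 1/|x| is a polynomial in 1/|x| and linear functions, so order k for
  the function gives order k for its derivative.\<close>

lemma smooth_on_inverse_norm:
  "smooth_on (- {0}) (\<lambda>x::'a::real_inner. inverse (norm x))"
proof -
  have "Ck_on k (- {0}) (\<lambda>x::'a. inverse (norm x))" for k
  proof (induction k)
    case 0
    then show ?case by (auto intro!: continuous_intros)
  next
    case (Suc k)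
    note mult = Ck_on_bilinear[OF bounded_bilinear_mult]
    show ?case
    proof (rule Ck_on_SucI)
      show "((\<lambda>x::'a. inverse (norm x)) has_derivative
          (\<lambda>v. - (inverse (norm x) * (inverse (norm x) * inverse (norm x)) * (x \<bullet> v)))) (at x)"
        if "x \<in> - {0}" for x
      proof -
        have x: "x \<noteq> 0" using that by simp
        show ?thesis
          by (rule has_derivative_eq_rhs[OF Deriv.has_derivative_inverse[OF _ has_derivative_norm[OF x]]])
             (use x in \<open>simp_all add: sgn_div_norm fun_eq_iff inner_commute\<close>)
      qed
      show "Ck_on k (- {0}) (\<lambda>x::'a. - (inverse (norm x) * (inverse (norm x) * inverse (norm x)) * (x \<bullet> v)))" for v
        by (intro Ck_on_bounded_linear[OF bounded_linear_minus[OF bounded_linear_ident]] mult Suc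
              Ck_on_linear bounded_linear_inner_left) auto
    qed auto
  qed
  then show ?thesis by (simp add: smooth_on_def)
qed

lemma smooth_on_sgn: "smooth_on (- {0}) (sgn :: 'a::real_inner \<Rightarrow> 'a)"
  unfolding sgn_div_norm[abs_def]
  by (intro smooth_on_scaleR smooth_on_inverse_norm smooth_on_linear bounded_linear_ident) auto

text \<open>Again the induction closes because the derivative is a constant multiple of the
  function.\<close>

lemma smooth_on_cis:
  assumes "bounded_linear h"
  shows "smooth_on UNIV (\<lambda>x. cis (h x))"
proof -
  have "Ck_on k UNIV (\<lambda>x. cis (h x))" for k
  proof (induction k)
    case 0
    then show ?case
      using bounded_linear.continuous_on[OF assms continuous_on_id] by (auto intro!: continuous_intros)
  next
    case (Suc k)
    show ?case
    proof (rule Ck_on_SucI)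
      show "((\<lambda>x. cis (h x)) has_derivative (\<lambda>v. h v *\<^sub>R (\<i> * cis (h x)))) (at x)" for x
        using has_derivative_compose[OF bounded_linear_imp_has_derivative[OF assms],
              of cis "\<lambda>t. t *\<^sub>R (\<i> * cis (h x))" x UNIV]
          has_vector_derivative_def[of cis "\<i> * cis (h x)" "at (h x)"]
        by (auto simp: cis_conv_exp intro!: derivative_eq_intros)
      show "Ck_on k UNIV (\<lambda>x. h v *\<^sub>R (\<i> * cis (h x)))" for v
        by (intro Ck_on_bilinear[OF bounded_bilinear_scaleR] Ck_on_bilinear[OF bounded_bilinear_mult]
              Ck_on_const Suc) auto
    qed auto
  qed
  then show ?thesis by (simp add: smooth_on_def)
qed

section \<open>Fourier coefficients on the 2-torus and their decay\<close>

definition fourier_coeff :: "(real \<times> real \<Rightarrow> complex) \<Rightarrow> int \<times> int \<Rightarrow> complex" where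
  "fourier_coeff f r = integral (cbox (0, 0) (1, 1))
     (\<lambda>s. cis (- 2 * pi * (of_int (fst r) * fst s + of_int (snd r) * snd s)) * f s)"

lemma has_vector_derivative_cis_affine:
  "((\<lambda>t. cis (a * t + b)) has_vector_derivative (\<i> * of_real a * cis (a * t + b))) (at t within S)"
proof -
  have "((\<lambda>z. exp (\<i> * (of_real a * z + of_real b))) has_field_derivative
      (\<i> * of_real a * exp (\<i> * (of_real a * of_real t + of_real b)))) (at (of_real t))"
    by (auto intro!: derivative_eq_intros)
  from has_vector_derivative_real_field[OF this, of S] show ?thesis
    by (simp add: cis_conv_exp)
qed

lemma cis_minus_2pi_int: "cis (- (2 * pi * of_int n)) = 1"
  using cis_multiple_2pi[of "- of_int n"] by simp

text \<open>Integration by parts over one period; the boundary terms cancel. The offset c holds the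
  contribution of the other, frozen torus variable.\<close>

lemma integral_cis_parts:
  fixes h h' :: "real \<Rightarrow> complex"
  assumes h: "\<And>t. (h has_vector_derivative h' t) (at t)" and cont: "continuous_on UNIV h'"
    and per: "h 1 = h 0"
  shows "integral {0..1} (\<lambda>t. cis (- 2 * pi * (of_int n * t + c)) * h' t)
    = 2 * pi * \<i> * of_int n * integral {0..1} (\<lambda>t. cis (- 2 * pi * (of_int n * t + c)) * h t)"
proof -
  define e where "e = (\<lambda>t. cis ((- 2 * pi * of_int n) * t + (- 2 * pi * c)))"
  have e: "e = (\<lambda>t. cis (- 2 * pi * (of_int n * t + c)))"
    unfolding e_def by (simp only: distrib_left mult.assoc)
  have de: "(e has_vector_derivative (\<i> * of_real (- 2 * pi * of_int n) * e t)) (at t within S)" for t S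
    unfolding e_def by (rule has_vector_derivative_cis_affine)
  have conte: "continuous_on S e" for S
    unfolding e_def by (intro continuous_intros)
  have conth: "continuous_on S h" for S
    by (intro continuous_at_imp_continuous_on ballI has_vector_derivative_continuous[OF h])
  have conth': "continuous_on S h'" for S
    using cont continuous_on_subset by blast
  have "((\<lambda>t. e t * h' t + (\<i> * of_real (- 2 * pi * of_int n) * e t) * h t) has_integral e 1 * h 1 - e 0 * h 0) {0..1}"
    by (rule fundamental_theorem_of_calculus)
       (simp, rule has_vector_derivative_mult[OF de has_vector_derivative_at_within[OF h]])
  moreover have "e 1 = e 0"
  proof -
    have "e 1 = cis (- (2 * pi * of_int n)) * cis (- 2 * pi * c)"
      by (simp add: e_def cis_mult)
    then show ?thesis by (simp only: cis_minus_2pi_int) (simp add: e_def)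
  qed
  ultimately have 0: "((\<lambda>t. e t * h' t + (\<i> * of_real (- 2 * pi * of_int n) * e t) * h t) has_integral 0) {0..1}"
    using per by simp
  have "(\<lambda>t. e t * h' t + (\<i> * of_real (- 2 * pi * of_int n) * e t) * h t)
      = (\<lambda>t. e t * h' t - 2 * pi * \<i> * of_int n * (e t * h t))"
    by (rule ext) (simp add: mult_ac)
  with 0 have 1: "((\<lambda>t. e t * h' t - 2 * pi * \<i> * of_int n * (e t * h t)) has_integral 0) {0..1}"
    by simp
  have i: "(\<lambda>t. e t * h' t) integrable_on {0..1}" "(\<lambda>t. e t * h t) integrable_on {0..1}"
    by (intro integrable_continuous_interval continuous_intros conte conth conth')+
  have "((\<lambda>t. e t * h' t - 2 * pi * \<i> * of_int n * (e t * h t)) has_integral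
      (integral {0..1} (\<lambda>t. e t * h' t) - 2 * pi * \<i> * of_int n * integral {0..1} (\<lambda>t. e t * h t))) {0..1}"
    by (intro has_integral_diff has_integral_mult_right integrable_integral i)
  from has_integral_unique[OF this 1] show ?thesis unfolding e by simp
qed

lemma smooth_on_vderiv_line:
  fixes f :: "'a::real_normed_vector \<Rightarrow> complex"
  assumes "smooth_on UNIV f" "\<And>t. (\<gamma> has_vector_derivative v) (at t)"
  shows "((\<lambda>t. f (\<gamma> t)) has_vector_derivative frechet_derivative f (at (\<gamma> t)) v) (at t)"
  using vector_derivative_diff_chain_within[OF assms(2)[of t], of f "frechet_derivative f (at (\<gamma> t))"]
    has_derivative_at_withinI[OF smooth_on_has_derivative[OF assms(1), of "\<gamma> t"]]
  by (simp add: o_def)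

lemma fourier_coeff_integrand_continuous:
  assumes "smooth_on UNIV f"
  shows "continuous_on S (\<lambda>s::real\<times>real. cis (- 2 * pi * (of_int (fst r) * fst s + of_int (snd r) * snd s)) * f s)"
  using continuous_on_subset[OF smooth_on_imp_continuous_on[OF assms], of S] 
  by (auto intro!: continuous_intros)

lemma fourier_coeff_deriv_fst:
  assumes f: "smooth_on UNIV f" and per: "\<And>s. f (s + (1, 0)) = f s"
  shows "fourier_coeff (\<lambda>s. frechet_derivative f (at s) (1, 0)) r = 2 * pi * \<i> * of_int (fst r) * fourier_coeff f r"
proof -
  let ?e = "\<lambda>s. cis (- 2 * pi * (of_int (fst r) * fst s + of_int (snd r) * snd s))"
  \<comment> \<open>Fubini, with the differentiated variable innermost.\<close>
  have swap: "fourier_coeff g r = integral {0..1} (\<lambda>y. integral {0..1} (\<lambda>x. ?e (x, y) * g (x, y)))"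
    if "smooth_on UNIV g" for g
    using integral_prod_continuous[OF fourier_coeff_integrand_continuous[OF that], of 0 0 1 1 r]
      integral_swap_continuous[of 0 0 1 1 "\<lambda>x y. ?e (x, y) * g (x, y)"]
      fourier_coeff_integrand_continuous[OF that, of "cbox (0,0) (1,1)" r]
    by (simp add: fourier_coeff_def case_prod_unfold)
  note f' = smooth_on_frechet_derivative[OF f, of "(1, 0)"]
  have "integral {0..1} (\<lambda>x. ?e (x, y) * frechet_derivative f (at (x, y)) (1, 0))
    = 2 * pi * \<i> * of_int (fst r) * integral {0..1} (\<lambda>x. ?e (x, y) * f (x, y))" for y
  proof -
    have "((\<lambda>x. (x, y)) has_vector_derivative (1, 0)) (at x)" for x
      unfolding has_vector_derivative_def by (auto intro!: derivative_eq_intros)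
    from smooth_on_vderiv_line[OF f this]
    show ?thesis
      using integral_cis_parts[of "\<lambda>x. f (x, y)" "\<lambda>x. frechet_derivative f (at (x, y)) (1, 0)" "fst r" "of_int (snd r) * y"]
        per[of "(0, y)"] continuous_on_compose2[OF smooth_on_imp_continuous_on[OF f'], of UNIV "\<lambda>x. (x, y)"]
      by (auto simp: continuous_on_Pair continuous_on_const)
  qed
  then show ?thesis by (simp add: swap f f')
qed

lemma fourier_coeff_deriv_snd:
  assumes f: "smooth_on UNIV f" and per: "\<And>s. f (s + (0, 1)) = f s"
  shows "fourier_coeff (\<lambda>s. frechet_derivative f (at s) (0, 1)) r = 2 * pi * \<i> * of_int (snd r) * fourier_coeff f r"
proof -
  let ?e = "\<lambda>s. cis (- 2 * pi * (of_int (fst r) * fst s + of_int (snd r) * snd s))"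
  have swap: "fourier_coeff g r = integral {0..1} (\<lambda>x. integral {0..1} (\<lambda>y. ?e (x, y) * g (x, y)))"
    if "smooth_on UNIV g" for g
    using integral_prod_continuous[OF fourier_coeff_integrand_continuous[OF that], of 0 0 1 1 r]
    by (simp add: fourier_coeff_def)
  note f' = smooth_on_frechet_derivative[OF f, of "(0, 1)"]
  have "integral {0..1} (\<lambda>y. ?e (x, y) * frechet_derivative f (at (x, y)) (0, 1))
    = 2 * pi * \<i> * of_int (snd r) * integral {0..1} (\<lambda>y. ?e (x, y) * f (x, y))" for x
  proof -
    have "((\<lambda>y. (x, y)) has_vector_derivative (0, 1)) (at y)" for y
      unfolding has_vector_derivative_def by (auto intro!: derivative_eq_intros)
    from smooth_on_vderiv_line[OF f this]
    show ?thesis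
      using integral_cis_parts[of "\<lambda>y. f (x, y)" "\<lambda>y. frechet_derivative f (at (x, y)) (0, 1)" "snd r" "of_int (fst r) * x"]
        per[of "(x, 0)"] continuous_on_compose2[OF smooth_on_imp_continuous_on[OF f'], of UNIV "\<lambda>y. (x, y)"]
      by (auto simp: continuous_on_Pair continuous_on_const add.commute)
  qed
  then show ?thesis by (simp add: swap f f')
qed

lemma frechet_derivative_periodic:
  fixes f :: "'a::real_normed_vector \<Rightarrow> 'b::real_normed_vector"
  assumes f: "\<And>s. f differentiable (at s)" and per: "\<And>s. f (s + p) = f s"
  shows "frechet_derivative f (at (s + p)) = frechet_derivative f (at s)"
proof -
  have "((\<lambda>s. s + p) has_derivative (\<lambda>v. v)) (at s)"
    by (auto intro!: derivative_eq_intros)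
  then have "((\<lambda>s. f (s + p)) has_derivative frechet_derivative f (at (s + p))) (at s)"
    using has_derivative_compose f[of "s + p"] unfolding frechet_derivative_works by blast
  then show ?thesis unfolding per by (rule frechet_derivative_at)
qed

lemma fourier_coeff_diff:
  assumes "smooth_on UNIV f" "smooth_on UNIV g"
  shows "fourier_coeff (\<lambda>s. f s - g s) r = fourier_coeff f r - fourier_coeff g r"
  unfolding fourier_coeff_def right_diff_distrib
  by (intro integral_diff integrable_continuous fourier_coeff_integrand_continuous assms)

text \<open>The operator 1 - D_b^2 multiplies the coefficient at r by 1 + (2 pi r_b)^2, which is
  never zero. It preserves smoothness and periodicity, so it can be applied once for each torus
  direction.\<close>

lemma fourier_coeff_second_deriv:
  assumes f: "smooth_on UNIV f" and per: "\<And>s. f (s + (1, 0)) = f s" "\<And>s. f (s + (0, 1)) = f s"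
    and b: "b = (1, 0) \<or> b = (0, 1)"
    and g_def: "g = (\<lambda>s. f s - frechet_derivative (\<lambda>s. frechet_derivative f (at s) b) (at s) b)"
  shows "smooth_on UNIV g" "\<And>s. g (s + (1, 0)) = g s" "\<And>s. g (s + (0, 1)) = g s"
    "fourier_coeff g r = (1 + (2 * pi * (if b = (1, 0) then of_int (fst r) else of_int (snd r)))\<^sup>2) * fourier_coeff f r"
proof -
  let ?f1 = "\<lambda>s. frechet_derivative f (at s) b"
  let ?f2 = "\<lambda>s. frechet_derivative ?f1 (at s) b"
  have f1: "smooth_on UNIV ?f1" and f2: "smooth_on UNIV ?f2"
    using f by (auto intro: smooth_on_frechet_derivative)
  then show "smooth_on UNIV g" unfolding g_def by (intro smooth_on_diff f) auto
  have diff: "h differentiable (at s)" if "smooth_on UNIV h" for h :: "real \<times> real \<Rightarrow> complex" and s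
    using smooth_on_has_derivative[OF that] differentiableI by blast
  have p1: "?f1 (s + p) = ?f1 s" "?f2 (s + p) = ?f2 s" if "\<And>s. f (s + p) = f s" for p s
  proof -
    have 1: "?f1 (s + p) = ?f1 s" for s
      using frechet_derivative_periodic[OF diff[OF f] that] by simp
    show "?f1 (s + p) = ?f1 s" by (rule 1)
    show "?f2 (s + p) = ?f2 s"
      using frechet_derivative_periodic[OF diff[OF f1] 1] by simp
  qed
  show "g (s + (1, 0)) = g s" "g (s + (0, 1)) = g s" for s
    unfolding g_def by (simp_all only: per p1[OF per(1)] p1[OF per(2)])
  from b show "fourier_coeff g r = (1 + (2 * pi * (if b = (1, 0) then of_int (fst r) else of_int (snd r)))\<^sup>2) * fourier_coeff f r"
  proof
    assume b: "b = (1, 0)"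
    show ?thesis unfolding g_def fourier_coeff_diff[OF f f2]
      using fourier_coeff_deriv_fst[OF f1[unfolded b] p1(1)[OF per(1), unfolded b]] fourier_coeff_deriv_fst[OF f per(1)]
      by (simp add: b algebra_simps power2_eq_square)
  next
    assume b: "b = (0, 1)"
    show ?thesis unfolding g_def fourier_coeff_diff[OF f f2]
      using fourier_coeff_deriv_snd[OF f1[unfolded b] p1(1)[OF per(2), unfolded b]] fourier_coeff_deriv_snd[OF f per(2)]
      by (simp add: b algebra_simps power2_eq_square)
  qed
qed

lemma summable_on_inverse_square_int: "(\<lambda>n::int. 1 / (1 + (of_int n)\<^sup>2) :: real) summable_on UNIV"
proof -
  let ?f = "\<lambda>n::int. 1 / (1 + (of_int n)\<^sup>2) :: real"
  have "summable (\<lambda>n. norm (1 / (1 + (real n)\<^sup>2)))"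
  proof (rule summable_comparison_test')
    show "summable (\<lambda>n. inverse ((real n)\<^sup>2))" by (rule inverse_power_summable) simp
    show "norm (norm (1 / (1 + (real n)\<^sup>2))) \<le> inverse ((real n)\<^sup>2)" if "1 \<le> n" for n
      using that by (simp add: inverse_eq_divide frac_le)
  qed
  then have nat: "(\<lambda>n::nat. 1 / (1 + (real n)\<^sup>2)) summable_on UNIV"
    by (rule norm_summable_imp_summable_on)
  have 1: "?f summable_on range int"
    using nat by (subst summable_on_reindex) (auto simp: o_def)
  have 2: "?f summable_on range (\<lambda>n. - int n)"
    using nat by (subst summable_on_reindex) (auto simp: o_def inj_on_def)
  have "?f summable_on (range (\<lambda>n. - int n) - range int)"
    by (rule summable_on_subset_banach[OF 2]) auto
  with 1 have "?f summable_on (range int \<union> (range (\<lambda>n. - int n) - range int))"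
    by (intro summable_on_Un_disjoint) auto
  moreover have "range int \<union> (range (\<lambda>n. - int n) - range int) = UNIV"
    using int_cases2 by blast
  ultimately show ?thesis by simp
qed

lemma abs_summable_on_product:
  fixes f :: "'a \<Rightarrow> 'c::{real_normed_div_algebra, banach}" and g :: "'b \<Rightarrow> 'c"
  assumes "(\<lambda>x. norm (f x)) summable_on A" "(\<lambda>x. norm (g x)) summable_on B"
  shows "(\<lambda>p. norm (f (fst p) * g (snd p))) summable_on A \<times> B"
proof -
  have "infsum (\<lambda>y. norm (f x * g y)) B = norm (f x) * infsum (\<lambda>y. norm (g y)) B" for x
    by (simp add: norm_mult infsum_cmult_right')
  moreover have "0 \<le> infsum (\<lambda>y. norm (g y)) B" by (rule infsum_nonneg) simp
  moreover have "(\<lambda>y. norm (f x * g y)) summable_on B" for x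
    using assms(2) by (simp add: norm_mult summable_on_cmult_right)
  ultimately show ?thesis
    using assms(1)
    by (intro iffD2[OF Infinite_Sum.abs_summable_on_Sigma_iff])
       (simp add: abs_mult abs_of_nonneg summable_on_cmult_left)
qed

text \<open>The function (1 - D_2^2)(1 - D_1^2) f has bounded coefficients, so those of f are
  dominated by M / ((1 + r_1^2)(1 + r_2^2)), a product of two summable sequences.\<close>

lemma fourier_coeff_abs_summable:
  assumes f: "smooth_on UNIV f" and per: "\<And>s. f (s + (1, 0)) = f s" "\<And>s. f (s + (0, 1)) = f s"
  shows "(\<lambda>r. norm (fourier_coeff f r)) summable_on UNIV"
proof -
  define g where "g = (\<lambda>s. f s - frechet_derivative (\<lambda>s. frechet_derivative f (at s) (1, 0)) (at s) (1, 0))"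
  define k where "k = (\<lambda>s. g s - frechet_derivative (\<lambda>s. frechet_derivative g (at s) (0, 1)) (at s) (0, 1))"
  note G = fourier_coeff_second_deriv[OF f per disjI1[OF refl] g_def]
  note K = fourier_coeff_second_deriv[OF G(1-3) disjI2[OF refl] k_def]
  have "bounded (k ` cbox (0, 0) (1, 1))"
    by (intro compact_imp_bounded compact_continuous_image compact_cbox
          continuous_on_subset[OF smooth_on_imp_continuous_on[OF K(1)]]) auto
  then obtain M where M: "\<And>s. s \<in> cbox (0, 0) (1, 1) \<Longrightarrow> norm (k s) \<le> M"
    unfolding bounded_iff by auto
  have M0: "0 \<le> M" using M[of "(0, 0)"] norm_ge_zero[of "k (0,0)"] by (simp add: cbox_Pair_eq del: norm_ge_zero)
  have k: "norm (fourier_coeff k r) \<le> M" for r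
  proof -
    let ?h = "\<lambda>s::real\<times>real. cis (- 2 * pi * (of_int (fst r) * fst s + of_int (snd r) * snd s)) * k s"
    have "norm (integral (cbox (0, 0) (1, 1)) ?h) \<le> M * Henstock_Kurzweil_Integration.content (cbox (0, 0) (1, 1) :: (real \<times> real) set)"
      by (rule integrable_bound[OF M0 integrable_continuous[OF fourier_coeff_integrand_continuous[OF K(1)]]])
         (use M in \<open>simp only: norm_mult norm_cis mult_1\<close>)
    moreover have "Henstock_Kurzweil_Integration.content (cbox (0, 0) (1, 1) :: (real \<times> real) set) = 1"
      unfolding content_Pair by simp
    ultimately show ?thesis unfolding fourier_coeff_def by simp
  qed
  have bound: "norm (fourier_coeff f r) \<le> M * (1 / (1 + (of_int (fst r))\<^sup>2) * (1 / (1 + (of_int (snd r))\<^sup>2)))" for r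
  proof -
    define a where "a = 1 + (2 * pi * of_int (fst r) :: real)\<^sup>2"
    define b where "b = 1 + (2 * pi * of_int (snd r) :: real)\<^sup>2"
    have le: "1 + x\<^sup>2 \<le> 1 + (2 * pi * x)\<^sup>2" for x :: real
    proof -
      have "1 \<le> 2 * pi" using pi_gt3 by simp
      then have "1 \<le> (2 * pi)\<^sup>2" by (rule one_le_power)
      then show ?thesis using mult_right_mono[of 1 "(2 * pi)\<^sup>2" "x\<^sup>2"] by (simp add: power_mult_distrib)
    qed
    have ab: "1 + (of_int (fst r))\<^sup>2 \<le> a" "1 + (of_int (snd r))\<^sup>2 \<le> b"
      unfolding a_def b_def by (rule le)+
    have pos: "0 < 1 + (of_int m :: real)\<^sup>2" for m by (simp add: add_pos_nonneg)
    have "fourier_coeff k r = of_real (b * a) * fourier_coeff f r"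
      using K(4)[of r] G(4)[of r] by (simp add: a_def b_def)
    then have "norm (fourier_coeff k r) = (b * a) * norm (fourier_coeff f r)"
      using ab pos[of "fst r"] pos[of "snd r"] by (simp add: norm_mult)
    then have le: "(b * a) * norm (fourier_coeff f r) \<le> M" using k[of r] by simp
    have "(1 + (of_int (snd r))\<^sup>2) * (1 + (of_int (fst r))\<^sup>2) \<le> b * a"
      using ab pos[of "fst r"] pos[of "snd r"] by (intro mult_mono) auto
    from order.trans[OF mult_right_mono[OF this norm_ge_zero] le]
    have "((1 + (of_int (snd r))\<^sup>2) * (1 + (of_int (fst r))\<^sup>2)) * norm (fourier_coeff f r) \<le> M" .
    then have "norm (fourier_coeff f r) \<le> M / ((1 + (of_int (snd r))\<^sup>2) * (1 + (of_int (fst r))\<^sup>2))"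
      using pos[of "fst r"] pos[of "snd r"]
      by (subst pos_le_divide_eq) (simp_all only: mult_pos_pos mult.commute)
    then show ?thesis by (simp only: divide_inverse inverse_mult_distrib mult_1_left mult_ac)
  qed
  have "(\<lambda>n::int. norm (1 / (1 + (of_int n)\<^sup>2) :: real)) summable_on UNIV"
    by (rule summable_on_iff_abs_summable_on_real[THEN iffD1, OF summable_on_inverse_square_int])
  from abs_summable_on_product[OF this this]
  have "(\<lambda>r::int\<times>int. norm (1 / (1 + (of_int (fst r))\<^sup>2) * (1 / (1 + (of_int (snd r))\<^sup>2)) :: real)) summable_on UNIV"
    by (simp add: case_prod_unfold)
  from summable_on_cmult_right[OF this, of "norm M"]
  have "(\<lambda>r::int\<times>int. norm (M * (1 / (1 + (of_int (fst r))\<^sup>2) * (1 / (1 + (of_int (snd r))\<^sup>2))) :: real)) summable_on UNIV"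
    by (simp only: norm_mult)
  then show ?thesis
    by (rule Infinite_Sum.abs_summable_on_comparison_test) (unfold real_norm_def, rule order.trans[OF bound abs_ge_self])
qed

section \<open>Differential forms on unit spheres in degrees 0, 1 and 2\<close>

lemma sphere_tangent_Nil: "sphere_tangent x [] \<longleftrightarrow> norm x = 1"
  by (simp add: sphere_tangent_def)

lemma sphere_tangent_Cons: "sphere_tangent x (v # vs) \<longleftrightarrow> x \<bullet> v = 0 \<and> sphere_tangent x vs"
  by (auto simp: sphere_tangent_def)

lemmas sphere_tangent_simps = sphere_tangent_Nil sphere_tangent_Cons

lemma frechet_derivative_linear:
  assumes "bounded_linear f" shows "frechet_derivative f (at x) = f"
  using frechet_derivative_at[OF bounded_linear_imp_has_derivative[OF assms]] by (rule sym)

lemma sphere_pullback_linear: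
  assumes "bounded_linear R"
  shows "sphere_pullback R \<eta> = on_sphere (\<lambda>x vs. \<eta> (R x) (map R vs))"
  by (simp add: sphere_pullback_def pullback_def[abs_def] frechet_derivative_linear[OF assms])

subsection \<open>Forms of low degree\<close>

text \<open>The potentials and curvatures have degree at most 2, so they can be given by explicit
  coefficient functions. Cutting off outside the tangent bundle means that identities need checking
  only at unit points and on tangent vectors.\<close>

definition form1 :: "('a::real_inner \<Rightarrow> 'a \<Rightarrow> complex) \<Rightarrow> 'a form" where
  "form1 \<alpha> = on_sphere (\<lambda>x vs. case vs of [v] \<Rightarrow> \<alpha> x v | _ \<Rightarrow> 0)"

definition form2 :: "('a::real_inner \<Rightarrow> 'a \<Rightarrow> 'a \<Rightarrow> complex) \<Rightarrow> 'a form" where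
  "form2 \<beta> = on_sphere (\<lambda>x vs. case vs of [v, w] \<Rightarrow> \<beta> x v w | _ \<Rightarrow> 0)"

lemma form1_length: "length vs \<noteq> 1 \<Longrightarrow> form1 \<alpha> x vs = 0"
  by (auto simp: form1_def on_sphere_def split: list.splits)

lemma form2_length: "length vs \<noteq> 2 \<Longrightarrow> form2 \<beta> x vs = 0"
  by (auto simp: form2_def on_sphere_def split: list.splits)

lemma fn_form_length: "vs \<noteq> [] \<Longrightarrow> fn_form f x vs = 0"
  by (auto simp: fn_form_def on_sphere_def)

lemma fn_form_Nil: "norm x = 1 \<Longrightarrow> fn_form f x [] = f x"
  by (auto simp: fn_form_def on_sphere_def sphere_tangent_simps)

lemma form1_singleton: "norm x = 1 \<Longrightarrow> x \<bullet> v = 0 \<Longrightarrow> form1 \<alpha> x [v] = \<alpha> x v"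
  by (auto simp: form1_def on_sphere_def sphere_tangent_simps)

lemma form2_pair: "norm x = 1 \<Longrightarrow> x \<bullet> v = 0 \<Longrightarrow> x \<bullet> w = 0 \<Longrightarrow> form2 \<beta> x [v, w] = \<beta> x v w"
  by (auto simp: form2_def on_sphere_def sphere_tangent_simps)

lemma form_not_tangent:
  assumes "\<not> sphere_tangent x vs"
  shows "fn_form f x vs = 0" "form1 \<alpha> x vs = 0" "form2 \<beta> x vs = 0"
  using assms by (simp_all add: fn_form_def form1_def form2_def on_sphere_def)

lemma on_sphere_idem: "on_sphere (on_sphere \<eta>) = on_sphere \<eta>"
  by (auto simp: on_sphere_def fun_eq_iff)

lemma on_sphere_forms [simp]:
  "on_sphere (fn_form f) = fn_form f" "on_sphere (form1 \<alpha>) = form1 \<alpha>" "on_sphere (form2 \<beta>) = form2 \<beta>"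
  by (simp_all add: fn_form_def form1_def form2_def on_sphere_idem)

lemma fn_form_cong: "(\<And>x. norm x = 1 \<Longrightarrow> f x = g x) \<Longrightarrow> fn_form f = fn_form g"
  by (auto simp: fn_form_def on_sphere_def fun_eq_iff sphere_tangent_def)

lemma form2_cong:
  "(\<And>x v w. norm x = 1 \<Longrightarrow> x \<bullet> v = 0 \<Longrightarrow> x \<bullet> w = 0 \<Longrightarrow> \<alpha> x v w = \<beta> x v w) \<Longrightarrow> form2 \<alpha> = form2 \<beta>"
  by (auto simp: form2_def on_sphere_def fun_eq_iff sphere_tangent_def split: list.splits)

lemma form_arith:
  "fn_form f + fn_form g = fn_form (\<lambda>x. f x + g x)"
  "fn_form f - fn_form g = fn_form (\<lambda>x. f x - g x)"
  "- fn_form f = fn_form (\<lambda>x. - f x)"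
  "cscale c (fn_form f) = fn_form (\<lambda>x. c * f x)"
  "form_cnj (fn_form f) = fn_form (\<lambda>x. cnj (f x))"
  "form1 \<alpha> + form1 \<beta> = form1 (\<lambda>x v. \<alpha> x v + \<beta> x v)"
  "form1 \<alpha> - form1 \<beta> = form1 (\<lambda>x v. \<alpha> x v - \<beta> x v)"
  "- form1 \<alpha> = form1 (\<lambda>x v. - \<alpha> x v)"
  "cscale c (form1 \<alpha>) = form1 (\<lambda>x v. c * \<alpha> x v)"
  "form2 \<gamma> + form2 \<delta> = form2 (\<lambda>x v w. \<gamma> x v w + \<delta> x v w)"
  "form2 \<gamma> - form2 \<delta> = form2 (\<lambda>x v w. \<gamma> x v w - \<delta> x v w)"
  "- form2 \<gamma> = form2 (\<lambda>x v w. - \<gamma> x v w)"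
  "cscale c (form2 \<gamma>) = form2 (\<lambda>x v w. c * \<gamma> x v w)"
  by (auto simp: fn_form_def form1_def form2_def on_sphere_def cscale_def form_cnj_def fun_eq_iff
        split: list.splits)

lemma zero_form: "0 = fn_form (\<lambda>x. 0)" "0 = form1 (\<lambda>x v. 0)" "0 = form2 (\<lambda>x v w. 0)"
  by (auto simp: fn_form_def form1_def form2_def on_sphere_def fun_eq_iff split: list.splits)

lemma sum_form:
  "(\<Sum>i\<in>I. fn_form (f i)) = fn_form (\<lambda>x. \<Sum>i\<in>I. f i x)"
  "(\<Sum>i\<in>I. form1 (\<alpha> i)) = form1 (\<lambda>x v. \<Sum>i\<in>I. \<alpha> i x v)"
  "(\<Sum>i\<in>I. form2 (\<beta> i)) = form2 (\<lambda>x v w. \<Sum>i\<in>I. \<beta> i x v w)"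
  by (induction I rule: infinite_finite_induct)
     (simp_all add: form_arith zero_form(1)[symmetric] zero_form(2)[symmetric] zero_form(3)[symmetric])

subsection \<open>Wedge products\<close>

lemma wedge_zero [simp]: "wedge 0 \<eta> = 0" "wedge \<eta> 0 = 0"
  by (simp_all add: wedge_def fun_eq_iff)

lemma nths_lessThan_length: "{..<length vs} \<subseteq> S \<Longrightarrow> nths vs S = vs"
  by (rule nths_all) auto

lemma nths_disjoint: "S \<inter> {..<length vs} = {} \<Longrightarrow> nths vs S = []"
proof -
  assume "S \<inter> {..<length vs} = {}"
  then have "{i. i < length vs \<and> i \<in> S} = {}" by auto
  then have "length (nths vs S) = 0" by (simp only: length_nths card.empty)
  then show ?thesis by simp
qed

text \<open>In the shuffle sum only the empty set of positions survives, since a function vanishes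
  on every nonempty list.\<close>

lemma wedge_function_left:
  assumes "\<And>vs. vs \<noteq> [] \<Longrightarrow> f x vs = 0"
  shows "wedge f \<eta> x vs = f x [] * \<eta> x vs"
proof -
  let ?t = "\<lambda>S. (-1) ^ card {(i, j). i \<in> S \<and> j \<in> {..<length vs} - S \<and> j < i}
       * f x (nths vs S) * \<eta> x (nths vs (- S))"
  have "wedge f \<eta> x vs = (\<Sum>S\<in>Pow {..<length vs}. if S = {} then ?t {} else 0)"
    unfolding wedge_def
  proof (rule sum.cong[OF refl])
    fix S assume S: "S \<in> Pow {..<length vs}"
    have "nths vs S \<noteq> []" if "S \<noteq> {}"
    proof -
      have "length (nths vs S) = card S"
        using S by (auto simp: length_nths intro!: arg_cong[of _ _ card])
      moreover have "card S \<noteq> 0" using S that finite_subset[of S "{..<length vs}"] by auto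
      ultimately show ?thesis by auto
    qed
    then show "?t S = (if S = {} then ?t {} else 0)" using assms by auto
  qed
  also have "\<dots> = f x [] * \<eta> x vs"
    by (subst sum.delta) (auto simp: nths_lessThan_length)
  finally show ?thesis .
qed

lemma wedge_function_right:
  assumes "\<And>vs. vs \<noteq> [] \<Longrightarrow> f x vs = 0"
  shows "wedge \<eta> f x vs = f x [] * \<eta> x vs"
proof -
  let ?t = "\<lambda>S. (-1) ^ card {(i, j). i \<in> S \<and> j \<in> {..<length vs} - S \<and> j < i}
       * \<eta> x (nths vs S) * f x (nths vs (- S))"
  let ?U = "{..<length vs}"
  have "wedge \<eta> f x vs = (\<Sum>S\<in>Pow ?U. if S = ?U then ?t ?U else 0)"
    unfolding wedge_def
  proof (rule sum.cong[OF refl])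
    fix S assume S: "S \<in> Pow ?U"
    have "nths vs (- S) \<noteq> []" if "S \<noteq> ?U"
    proof -
      have "length (nths vs (- S)) = card (?U - S)"
        by (auto simp: length_nths intro!: arg_cong[of _ _ card])
      moreover have "card (?U - S) \<noteq> 0" using S that by auto
      ultimately show ?thesis by auto
    qed
    then show "?t S = (if S = ?U then ?t ?U else 0)"
      using assms[of "nths vs (- S)"] by (cases "S = ?U") simp_all
  qed
  also have "\<dots> = ?t ?U"
    by (simp only: sum.delta finite_Pow_iff finite_lessThan Pow_top if_True)
  also have "\<dots> = f x [] * \<eta> x vs"
  proof -
    have 1: "{(i, j). i \<in> ?U \<and> j \<in> ?U - ?U \<and> j < i} = {}" by auto
    have 2: "nths vs ?U = vs" "nths vs (- ?U) = []"
      by (rule nths_lessThan_length nths_disjoint, auto)+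
    show ?thesis unfolding 1 2 by simp
  qed
  finally show ?thesis .
qed

lemma wedge_fn_left: "wedge (fn_form f) \<eta> x vs = fn_form f x [] * \<eta> x vs"
  by (rule wedge_function_left) (rule fn_form_length)

lemma wedge_fn_right: "wedge \<eta> (fn_form f) x vs = fn_form f x [] * \<eta> x vs"
  by (rule wedge_function_right) (rule fn_form_length)

lemma wedge_form1_form1:
  "wedge (form1 \<alpha>) (form1 \<beta>) = form2 (\<lambda>x v w. \<alpha> x v * \<beta> x w - \<alpha> x w * \<beta> x v)"
proof (intro ext)
  fix x and vs :: "'a list"
  show "wedge (form1 \<alpha>) (form1 \<beta>) x vs = form2 (\<lambda>x v w. \<alpha> x v * \<beta> x w - \<alpha> x w * \<beta> x v) x vs"
  proof (cases "length vs = 2")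
    case False
    have "form1 \<alpha> x (nths vs S) = 0 \<or> form1 \<beta> x (nths vs (- S)) = 0" for S
    proof (rule ccontr)
      assume "\<not> ?thesis"
      then have "length (nths vs S) = 1" "length (nths vs (- S)) = 1"
        using form1_length by blast+
      moreover have "length (nths vs S) + length (nths vs (- S)) = length vs"
      proof -
        have "length vs = card ({i. i < length vs \<and> i \<in> S} \<union> {i. i < length vs \<and> i \<in> - S})"
          by (subst card_lessThan[of "length vs", symmetric]) (rule arg_cong[of _ _ card], auto)
        then show ?thesis by (subst (asm) card_Un_disjoint) (auto simp: length_nths)
      qed
      ultimately show False using False by simp
    qed
    then have "wedge (form1 \<alpha>) (form1 \<beta>) x vs = 0"
      unfolding wedge_def by (intro sum.neutral ballI) auto
    then show ?thesis using form2_length[OF False] by simp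
  next
    case True
    then obtain v w where vs: "vs = [v, w]"
      by (auto simp: numeral_2_eq_2 length_Suc_conv)
    \<comment> \<open>Of the four sets of positions only the singletons pass exactly one vector to
      each factor; {1} has one inversion, hence the minus sign.\<close>
    have P: "Pow {..<2::nat} = {{}, {0}, {1}, {0, 1}}"
      by (auto simp: lessThan_nat_numeral lessThan_Suc numeral_2_eq_2 Pow_insert)
    have i: "{(i, j). i \<in> {0::nat} \<and> j \<in> {..<2} - {0::nat} \<and> j < i} = {}"
      "{(i, j). i \<in> {1::nat} \<and> j \<in> {..<2} - {1::nat} \<and> j < i} = {(1, 0)}"
      "{(i, j). i = (0::nat) \<and> j < 2 \<and> 0 < j \<and> j < i} = {}" by auto
    have "wedge (form1 \<alpha>) (form1 \<beta>) x vs
        = form1 \<alpha> x [v] * form1 \<beta> x [w] - form1 \<alpha> x [w] * form1 \<beta> x [v]"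
      unfolding wedge_def vs
      by (simp add: P numeral_2_eq_2[symmetric] i(1,2)[simplified] i(3) nths_Cons form1_length)
    then show ?thesis unfolding vs
      by (simp add: form1_def form2_def on_sphere_def sphere_tangent_simps)
  qed
qed

lemma wedge_low:
  "wedge (fn_form f) (fn_form g) = fn_form (\<lambda>x. f x * g x)"
  "wedge (fn_form f) (form1 \<alpha>) = form1 (\<lambda>x v. f x * \<alpha> x v)"
  "wedge (form1 \<alpha>) (fn_form f) = form1 (\<lambda>x v. f x * \<alpha> x v)"
  "wedge (fn_form f) (form2 \<beta>) = form2 (\<lambda>x v w. f x * \<beta> x v w)"
  "wedge (form2 \<beta>) (fn_form f) = form2 (\<lambda>x v w. f x * \<beta> x v w)"
  by (rule ext, rule ext, simp only: wedge_fn_left wedge_fn_right,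
      (auto simp: fn_form_def form1_def form2_def on_sphere_def sphere_tangent_simps split: list.splits)[1])+

subsection \<open>Exterior derivatives\<close>

definition sgn_deriv :: "'a::real_inner \<Rightarrow> 'a \<Rightarrow> 'a" where
  "sgn_deriv x v = inverse (norm x) *\<^sub>R (v - (sgn x \<bullet> v) *\<^sub>R sgn x)"

lemma has_derivative_sgn:
  fixes x :: "'a::real_inner"
  assumes "x \<noteq> 0" shows "(sgn has_derivative sgn_deriv x) (at x)"
proof -
  have "((\<lambda>y. inverse (norm y) *\<^sub>R y) has_derivative
      (\<lambda>v. inverse (norm x) *\<^sub>R v + (- (inverse (norm x) * (v \<bullet> sgn x) * inverse (norm x))) *\<^sub>R x)) (at x)"
    by (rule has_derivative_scaleR[OF Deriv.has_derivative_inverse[OF _ has_derivative_norm[OF assms]] has_derivative_ident])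
       (use assms in simp)
  then show ?thesis
    unfolding sgn_div_norm[abs_def]
    by (rule has_derivative_eq_rhs) (auto simp: fun_eq_iff sgn_deriv_def sgn_div_norm algebra_simps inner_commute)
qed

lemma frechet_derivative_sgn: "x \<noteq> 0 \<Longrightarrow> frechet_derivative sgn (at x) = sgn_deriv x"
  using frechet_derivative_at[OF has_derivative_sgn] by metis

lemma sgn_deriv_tangent: "x \<noteq> 0 \<Longrightarrow> sgn x \<bullet> sgn_deriv x v = 0"
  using norm_sgn[of x] by (simp add: sgn_deriv_def inner_diff_right norm_eq_1)

lemma sgn_unit: "norm x = 1 \<Longrightarrow> sgn x = x"
  by (simp add: sgn_div_norm)

lemma sgn_deriv_unit: "norm x = 1 \<Longrightarrow> x \<bullet> v = 0 \<Longrightarrow> sgn_deriv x v = v"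
  by (simp add: sgn_deriv_def sgn_unit)

lemma sphere_tangent_sgn: "x \<noteq> 0 \<Longrightarrow> sphere_tangent (sgn x) (map (sgn_deriv x) vs)"
  by (auto simp: sphere_tangent_def sgn_deriv_tangent norm_sgn)

lemma pullback_sgn: "x \<noteq> 0 \<Longrightarrow> pullback sgn \<eta> x vs = \<eta> (sgn x) (map (sgn_deriv x) vs)"
  by (simp add: pullback_def frechet_derivative_sgn)

lemma ext_deriv_fn:
  assumes "\<And>x. norm x = 1 \<Longrightarrow> (f has_derivative f' x) (at x)"
  shows "ext_deriv (fn_form f) = form1 f'"
proof (intro ext)
  fix x :: 'a and vs :: "'a list"
  show "ext_deriv (fn_form f) x vs = form1 f' x vs"
  proof (cases "sphere_tangent x vs")
    case False
    then show ?thesis by (simp add: ext_deriv_def on_sphere_def form_not_tangent)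
  next
    case t: True
    then have x: "norm x = 1" "x \<noteq> 0" by (auto simp: sphere_tangent_def)
    show ?thesis
    proof (cases "length vs = 1")
      case True
      then obtain v where vs: "vs = [v]" by (auto simp: length_Suc_conv)
      have "((\<lambda>y. f (sgn y)) has_derivative (\<lambda>v. f' x (sgn_deriv x v))) (at x)"
      proof -
        have "(f has_derivative f' x) (at (sgn x))"
          using assms[OF x(1)] by (simp add: sgn_unit[OF x(1)])
        from has_derivative_compose[OF has_derivative_sgn[OF x(2)] this] show ?thesis .
      qed
      then have "((\<lambda>y. pullback sgn (fn_form f) y []) has_derivative (\<lambda>v. f' x (sgn_deriv x v))) (at x)"
        by (rule has_derivative_transform_within_open[of _ _ _ _ "- {0}"])
           (use x in \<open>auto simp: pullback_sgn fn_form_Nil norm_sgn\<close>)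
      from fun_cong[OF frechet_derivative_at[OF this], of v, symmetric]
      show ?thesis using t x
        by (simp add: vs ext_deriv_def on_sphere_def ext_deriv_flat_def form1_singleton sphere_tangent_simps
            sgn_deriv_unit)
    next
      case False
      have "(\<lambda>y. pullback sgn (fn_form f) y (take i vs @ drop (Suc i) vs)) = (\<lambda>y. 0)" if "i < length vs" for i
      proof -
        have "length (take i vs @ drop (Suc i) vs) \<noteq> 0" using that False by simp
        then have "take i vs @ drop (Suc i) vs \<noteq> []" by (metis list.size(3))
        then show ?thesis by (simp only: pullback_def fn_form_length map_is_Nil_conv not_False_eq_True)
      qed
      then show ?thesis using t form1_length[of vs f' x] False
        by (simp add: ext_deriv_def on_sphere_def ext_deriv_flat_def)
    qed
  qed
qed

text \<open>Pulling back along the radial retraction adds to the derivative of the coefficients only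
  a term symmetric in v and w, which antisymmetrization removes.\<close>

lemma ext_deriv_form1:
  fixes \<alpha> :: "'a::euclidean_space \<Rightarrow> 'a \<Rightarrow> complex"
  assumes lin: "\<And>x. linear (\<alpha> x)"
    and der: "\<And>x w. norm x = 1 \<Longrightarrow> ((\<lambda>y. \<alpha> y w) has_derivative (\<lambda>v. D x v w)) (at x)"
  shows "ext_deriv (form1 \<alpha>) = form2 (\<lambda>x v w. D x v w - D x w v)"
proof (intro ext)
  fix x :: 'a and vs :: "'a list"
  show "ext_deriv (form1 \<alpha>) x vs = form2 (\<lambda>x v w. D x v w - D x w v) x vs"
  proof (cases "sphere_tangent x vs")
    case False
    then show ?thesis by (simp add: ext_deriv_def on_sphere_def form_not_tangent)
  next
    case t: True
    then have x: "norm x = 1" "x \<noteq> 0" by (auto simp: sphere_tangent_def)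
    show ?thesis
    proof (cases "length vs = 2")
      case False
      have "(\<lambda>y. pullback sgn (form1 \<alpha>) y (take i vs @ drop (Suc i) vs)) = (\<lambda>y. 0)" if "i < length vs" for i
        using False that by (auto simp: pullback_def form1_length fun_eq_iff)
      then show ?thesis using t form2_length[OF False, of "\<lambda>x v w. D x v w - D x w v" x]
        by (simp add: ext_deriv_def on_sphere_def ext_deriv_flat_def)
    next
      case True
      then obtain v w where vs: "vs = [v, w]" by (auto simp: numeral_2_eq_2 length_Suc_conv)
      have tan: "x \<bullet> v = 0" "x \<bullet> w = 0" using t by (auto simp: vs sphere_tangent_simps)
      have comp: "((\<lambda>y. \<alpha> (sgn y) u) has_derivative (\<lambda>v. D x (sgn_deriv x v) u)) (at x)" for u
      proof -
        have "((\<lambda>y. \<alpha> y u) has_derivative (\<lambda>v. D x v u)) (at (sgn x))"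
          using der[OF x(1)] by (simp add: sgn_unit[OF x(1)])
        from has_derivative_compose[OF has_derivative_sgn[OF x(2)] this] show ?thesis .
      qed
      have diag: "\<alpha> y y = (\<Sum>b\<in>Basis. (y \<bullet> b) *\<^sub>R \<alpha> y b)" for y
        using linear_sum[OF lin[of y], of "\<lambda>b. (y \<bullet> b) *\<^sub>R b" Basis] 
        by (simp add: euclidean_representation linear_cmul[OF lin])
      \<comment> \<open>Only the existence of this derivative matters: in \<open>key\<close> it is
        multiplied by the inner product of x and w, which is zero.\<close>
      obtain E where E: "((\<lambda>y. \<alpha> (sgn y) (sgn y)) has_derivative E) (at x)"
      proof -
        have "((\<lambda>y. \<Sum>b\<in>Basis. (sgn y \<bullet> b) *\<^sub>R \<alpha> (sgn y) b) has_derivative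
            (\<lambda>v. \<Sum>b\<in>Basis. (sgn x \<bullet> b) *\<^sub>R D x (sgn_deriv x v) b + (sgn_deriv x v \<bullet> b) *\<^sub>R \<alpha> (sgn x) b)) (at x)"
          by (intro has_derivative_sum has_derivative_scaleR comp has_derivative_inner_left has_derivative_sgn x(2))
        also have "(\<lambda>y. \<Sum>b\<in>Basis. (sgn y \<bullet> b) *\<^sub>R \<alpha> (sgn y) b) = (\<lambda>y. \<alpha> (sgn y) (sgn y))"
          by (rule ext, rule diag[symmetric])
        finally show ?thesis by (rule that)
      qed
      \<comment> \<open>The second term on the right is symmetric in v and w and is the whole effect
        of the retraction.\<close>
      have key: "frechet_derivative (\<lambda>y. pullback sgn (form1 \<alpha>) y [w]) (at x) v = D x v w - (v \<bullet> w) *\<^sub>R \<alpha> x x"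
        if tan: "x \<bullet> v = 0" "x \<bullet> w = 0" for v w
      proof -
        let ?G = "\<lambda>y. inverse (norm y) *\<^sub>R (\<alpha> (sgn y) w - (sgn y \<bullet> w) *\<^sub>R \<alpha> (sgn y) (sgn y))"
        have "(?G has_derivative (\<lambda>v. inverse (norm x) *\<^sub>R (D x (sgn_deriv x v) w
              - ((sgn x \<bullet> w) *\<^sub>R E v + (sgn_deriv x v \<bullet> w) *\<^sub>R \<alpha> (sgn x) (sgn x)))
            + (- (inverse (norm x) * (v \<bullet> sgn x) * inverse (norm x))) *\<^sub>R
                (\<alpha> (sgn x) w - (sgn x \<bullet> w) *\<^sub>R \<alpha> (sgn x) (sgn x)))) (at x)"
          by (intro has_derivative_scaleR has_derivative_diff comp E has_derivative_inner_left
                has_derivative_sgn Deriv.has_derivative_inverse has_derivative_norm) (use x in auto)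
        then have "((\<lambda>y. pullback sgn (form1 \<alpha>) y [w]) has_derivative (\<lambda>v. inverse (norm x) *\<^sub>R (D x (sgn_deriv x v) w
              - ((sgn x \<bullet> w) *\<^sub>R E v + (sgn_deriv x v \<bullet> w) *\<^sub>R \<alpha> (sgn x) (sgn x)))
            + (- (inverse (norm x) * (v \<bullet> sgn x) * inverse (norm x))) *\<^sub>R
                (\<alpha> (sgn x) w - (sgn x \<bullet> w) *\<^sub>R \<alpha> (sgn x) (sgn x)))) (at x)"
        proof (rule has_derivative_transform_within_open[of _ _ _ _ "- {0}"])
          show "?G y = pullback sgn (form1 \<alpha>) y [w]" if "y \<in> - {0}" for y
            using that
            by (simp add: pullback_sgn form1_singleton norm_sgn sgn_deriv_tangent)
               (simp add: sgn_deriv_def linear_cmul[OF lin] linear_diff[OF lin])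
        qed (use x in auto)
        from fun_cong[OF frechet_derivative_at[OF this], of v, symmetric] show ?thesis
          using x tan sgn_deriv_unit[OF x(1) tan(1)] by (simp add: sgn_unit inner_commute)
      qed
      show ?thesis using t x tan key[OF tan] key[OF tan(2,1)]
        by (simp add: vs ext_deriv_def on_sphere_def ext_deriv_flat_def form2_pair inner_commute numeral_2_eq_2)
    qed
  qed
qed

subsection \<open>Smoothness\<close>

lemma sgn_deriv_smooth: "smooth_on (- {0}) (\<lambda>x::'a::euclidean_space. sgn_deriv x v)"
  by (rule smooth_on_cong[OF _ _ smooth_on_frechet_derivative[OF smooth_on_sgn, of v]])
     (auto simp: frechet_derivative_sgn)

lemma smooth_on_compose_sgn:
  fixes f :: "'a::euclidean_space \<Rightarrow> 'b::real_normed_vector"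
  assumes "smooth_on UNIV f" shows "smooth_on (- {0}) (\<lambda>x. f (sgn x))"
  by (rule smooth_on_compose[OF _ _ _ smooth_on_sgn assms]) auto

lemma fn_form_sphere_function:
  fixes f :: "'a::euclidean_space \<Rightarrow> complex"
  assumes "smooth_on UNIV f" shows "fn_form f \<in> sphere_functions"
proof -
  have "smooth_on (- {0}) (\<lambda>x. pullback sgn (fn_form f) x vs)" for vs
  proof (cases "vs = []")
    case True
    show ?thesis
      by (rule smooth_on_cong[OF _ _ smooth_on_compose_sgn[OF assms]])
         (auto simp: True pullback_sgn fn_form_Nil norm_sgn)
  next
    case False
    then have "(\<lambda>x. pullback sgn (fn_form f) x vs) = (\<lambda>x. 0)"
      by (auto simp: pullback_def fn_form_length fun_eq_iff)
    then show ?thesis by (simp add: smooth_on_const)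
  qed
  moreover have "fn_form f x vs = 0" if "\<not> distinct vs" for x vs
    using that by (intro fn_form_length) auto
  ultimately show ?thesis
    by (auto simp: sphere_functions_def sphere_forms_def fn_form_length)
qed

text \<open>The arguments of the retracted form move with the base point, so they are expanded in
  the standard basis; there the coefficients are smooth by hypothesis.\<close>

lemma form2_sphere_form:
  fixes \<beta> :: "'a::euclidean_space \<Rightarrow> 'a \<Rightarrow> 'a \<Rightarrow> complex"
  assumes lin: "\<And>x w. linear (\<lambda>v. \<beta> x v w)" and alt: "\<And>x v w. \<beta> x v w = - \<beta> x w v"
    and smooth: "\<And>v w. smooth_on UNIV (\<lambda>x. \<beta> x v w)"
  shows "form2 \<beta> \<in> sphere_forms"
proof -
  have lin2: "linear (\<beta> x v)" for x v
  proof -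
    have "\<beta> x v = (\<lambda>w. - \<beta> x w v)" by (rule ext, rule alt)
    then show ?thesis using linear_compose_neg[OF lin[of x v]] by simp
  qed
  have alt0: "\<beta> x v v = 0" for x v using alt[of x v v] by simp
  have lincomb: "\<beta> x (a *\<^sub>R v + b *\<^sub>R w) u = of_real a * \<beta> x v u + of_real b * \<beta> x w u"
    "\<beta> x u (a *\<^sub>R v + b *\<^sub>R w) = of_real a * \<beta> x u v + of_real b * \<beta> x u w" for x a b u v w
    by (simp_all add: linear_add[OF lin] linear_add[OF lin2] linear_cmul[OF lin] linear_cmul[OF lin2] scaleR_conv_of_real)
  have "form2 \<beta> x (us @ (a *\<^sub>R v + b *\<^sub>R w) # ws)
          = of_real a * form2 \<beta> x (us @ v # ws) + of_real b * form2 \<beta> x (us @ w # ws)"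
    if t: "sphere_tangent x (us @ v # w # ws)" for x us ws v w a b
  proof (cases "length (us @ v # ws) = 2")
    case False
    then show ?thesis by (simp add: form2_length)
  next
    case True
    then consider u where "us = []" "ws = [u]" | u where "us = [u]" "ws = []"
      by (cases us) (auto simp: length_Suc_conv)
    then show ?thesis using t
      by cases (auto simp: sphere_tangent_simps form2_pair lincomb inner_add_right)
  qed
  moreover have "form2 \<beta> x vs = 0" if "\<not> distinct vs" for x vs
    using that alt0 by (auto simp: form2_def on_sphere_def split: list.splits)
  moreover have "smooth_on (- {0}) (\<lambda>x. pullback sgn (form2 \<beta>) x vs)" for vs
  proof (cases "length vs = 2")
    case False
    then have "(\<lambda>x. pullback sgn (form2 \<beta>) x vs) = (\<lambda>x. 0)"
      by (auto simp: pullback_def form2_length fun_eq_iff)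
    then show ?thesis by (simp add: smooth_on_const)
  next
    case True
    then obtain v w where vs: "vs = [v, w]" by (auto simp: numeral_2_eq_2 length_Suc_conv)
    have exp: "\<beta> x u u' = (\<Sum>b\<in>Basis. \<Sum>c\<in>Basis. ((u \<bullet> b) * (u' \<bullet> c)) *\<^sub>R \<beta> x b c)" for x u u'
    proof -
      have 1: "\<beta> x u u' = (\<Sum>b\<in>Basis. (u \<bullet> b) *\<^sub>R \<beta> x b u')"
        using linear_sum[OF lin[of x u'], of "\<lambda>b. (u \<bullet> b) *\<^sub>R b" Basis]
        by (simp add: euclidean_representation linear_cmul[OF lin])
      have 2: "\<beta> x b u' = (\<Sum>c\<in>Basis. (u' \<bullet> c) *\<^sub>R \<beta> x b c)" for b
        using linear_sum[OF lin2[of x b], of "\<lambda>b. (u' \<bullet> b) *\<^sub>R b" Basis]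
        by (simp add: euclidean_representation linear_cmul[OF lin2])
      show ?thesis unfolding 1 by (simp only: 2 scaleR_sum_right scaleR_scaleR)
    qed
    have "smooth_on (- {0}) (\<lambda>x. \<Sum>b\<in>Basis. \<Sum>c\<in>Basis. ((sgn_deriv x v \<bullet> b) * (sgn_deriv x w \<bullet> c)) *\<^sub>R \<beta> (sgn x) b c)"
      by (intro smooth_on_sum smooth_on_scaleR smooth_on_mult smooth_on_inner sgn_deriv_smooth smooth_on_const
            smooth_on_compose_sgn smooth) auto
    then show ?thesis
      by (rule smooth_on_cong[rotated -1])
         (auto simp: vs pullback_sgn form2_pair norm_sgn sgn_deriv_tangent exp[symmetric])
  qed
  ultimately show ?thesis by (auto simp: sphere_forms_def)
qed

section \<open>The torus action, degrees and the deformed product\<close>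

subsection \<open>The torus action\<close>

lemma vector_4 [simp]:
  "(vector [a, b, c, d] :: 'a::zero ^ 4) $ 1 = a" "(vector [a, b, c, d] :: 'a::zero ^ 4) $ 2 = b"
  "(vector [a, b, c, d] :: 'a::zero ^ 4) $ 3 = c" "(vector [a, b, c, d] :: 'a::zero ^ 4) $ 4 = d"
  unfolding vector_def by simp_all

lemma vector_5 [simp]:
  "(vector [a, b, c, d, e] :: 'a::zero ^ 5) $ 1 = a" "(vector [a, b, c, d, e] :: 'a::zero ^ 5) $ 2 = b"
  "(vector [a, b, c, d, e] :: 'a::zero ^ 5) $ 3 = c" "(vector [a, b, c, d, e] :: 'a::zero ^ 5) $ 4 = d"
  "(vector [a, b, c, d, e] :: 'a::zero ^ 5) $ 5 = e"
  unfolding vector_def by simp_all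

lemma exhaust_5:
  fixes x :: 5
  shows "x = 1 \<or> x = 2 \<or> x = 3 \<or> x = 4 \<or> x = 5"
proof (induct x)
  case (of_int z)
  then have "0 \<le> z" and "z < 5" by simp_all
  then have "z = 0 \<or> z = 1 \<or> z = 2 \<or> z = 3 \<or> z = 4" by arith
  then show ?case by auto
qed

lemma forall_5: "(\<forall>i::5. P i) \<longleftrightarrow> P 1 \<and> P 2 \<and> P 3 \<and> P 4 \<and> P 5"
  by (metis exhaust_5)

lemma UNIV_5: "UNIV = {1::5, 2, 3, 4, 5}"
  using exhaust_5 by auto

lemma sum_5: "sum f (UNIV :: 5 set) = f 1 + f 2 + f 3 + f 4 + f 5"
  unfolding UNIV_5 by (simp add: ac_simps)

definition torus_char :: "int \<times> int \<Rightarrow> real \<times> real \<Rightarrow> complex" where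
  "torus_char r s = cis (2 * pi * (of_int (fst r) * fst s + of_int (snd r) * snd s))"

definition coord_degree :: "4 \<Rightarrow> int \<times> int" where
  "coord_degree i = (if i = 1 then (1, 0) else if i = 2 then (- 1, 0) else if i = 3 then (0, - 1) else (0, 1))"

lemma coord_degree_simps [simp]:
  "coord_degree 1 = (1, 0)" "coord_degree 2 = (- 1, 0)" "coord_degree 3 = (0, - 1)" "coord_degree 4 = (0, 1)"
  by (simp_all add: coord_degree_def)

lemma torus_char_add: "torus_char (r + q) s = torus_char r s * torus_char q s"
  by (simp add: torus_char_def cis_mult algebra_simps)

lemma torus_char_uminus: "torus_char (- r) s = cnj (torus_char r s)"
  by (simp add: torus_char_def cis_cnj algebra_simps)

lemma torus_char_zero [simp]: "torus_char 0 s = 1"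
  by (simp add: torus_char_def)

lemma norm_torus_char [simp]: "norm (torus_char r s) = 1"
  by (simp add: torus_char_def)

lemma torus_char_cnj_mult [simp]: "cnj (torus_char r s) * torus_char r s = 1"
  by (simp add: torus_char_def cis_cnj cis_mult)

lemma torus_char_smooth: "smooth_on UNIV (torus_char r)"
  unfolding torus_char_def[abs_def]
  by (rule smooth_on_cis)
     (intro bounded_linear_const_mult bounded_linear_add bounded_linear_fst bounded_linear_snd)

lemma torus_char_periodic: "torus_char r (s + (1, 0)) = torus_char r s" "torus_char r (s + (0, 1)) = torus_char r s"
proof -
  have "cis (2 * pi * (of_int (fst r) * (fst s + 1) + of_int (snd r) * snd s))
     = cis (2 * pi * (of_int (fst r) * fst s + of_int (snd r) * snd s)) * cis (2 * pi * of_int (fst r))"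
    by (simp add: cis_mult algebra_simps)
  moreover have "cis (2 * pi * (of_int (fst r) * fst s + of_int (snd r) * (snd s + 1)))
     = cis (2 * pi * (of_int (fst r) * fst s + of_int (snd r) * snd s)) * cis (2 * pi * of_int (snd r))"
    by (simp add: cis_mult algebra_simps)
  ultimately show "torus_char r (s + (1, 0)) = torus_char r s" "torus_char r (s + (0, 1)) = torus_char r s"
    by (simp_all add: torus_char_def cis_multiple_2pi)
qed

lemma torus_act_nth: "torus_act s x $ i = torus_char (coord_degree i) s * x $ i"
proof -
  have "\<forall>i. torus_act s x $ i = torus_char (coord_degree i) s * x $ i"
    unfolding forall_4 by (simp add: torus_act_def torus_char_def)
  then show ?thesis by blast
qed

lemma linear_torus_act: "linear (torus_act s)"
  by (rule linearI) (simp_all add: vec_eq_iff torus_act_nth algebra_simps)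

lemma bounded_linear_torus_act: "bounded_linear (torus_act s)"
  using linear_torus_act linear_conv_bounded_linear by blast

lemma inner_mult_unit_complex: "norm c = 1 \<Longrightarrow> (c * a) \<bullet> (c * b) = a \<bullet> (b :: complex)"
proof -
  assume "norm c = 1"
  then have "(Re c)\<^sup>2 + (Im c)\<^sup>2 = 1" by (simp add: cmod_def)
  then show ?thesis by (simp add: inner_complex_def) algebra
qed

lemma torus_act_inner: "torus_act s x \<bullet> torus_act s y = x \<bullet> y"
  by (simp add: inner_vec_def torus_act_nth inner_mult_unit_complex)

lemma torus_act_smooth: "smooth_on UNIV (\<lambda>s. torus_act s x)"
proof (rule smooth_on_cong)
  show "(\<Sum>i\<in>UNIV. axis i (torus_char (coord_degree i) s * x $ i)) = torus_act s x" for s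
    by (simp add: vec_eq_iff torus_act_nth axis_def if_distrib sum.delta cong: if_cong)
  have "bounded_linear (axis i :: complex \<Rightarrow> complex^4)" for i
    by (rule linear_conv_bounded_linear[THEN iffD1], rule linearI) (simp_all add: axis_def vec_eq_iff)
  then show "smooth_on UNIV (\<lambda>s. \<Sum>i\<in>UNIV. axis i (torus_char (coord_degree i) s * x $ i))"
    by (intro smooth_on_sum smooth_on_bounded_linear[where h = "axis _"] smooth_on_mult torus_char_smooth smooth_on_const) auto
qed auto

lemma torus_act_periodic: "torus_act (s + (1, 0)) = torus_act s" "torus_act (s + (0, 1)) = torus_act s"
  by (simp_all add: fun_eq_iff vec_eq_iff torus_act_nth torus_char_periodic)

lemma inner_preserving_sphere_tangent:
  assumes "\<And>x y. R x \<bullet> R y = x \<bullet> y"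
  shows "sphere_tangent (R x) (map R vs) \<longleftrightarrow> sphere_tangent x vs"
  using assms by (auto simp: sphere_tangent_def norm_eq_sqrt_inner)

lemmas torus_act_sphere_tangent = inner_preserving_sphere_tangent[OF torus_act_inner]

lemma sphere_pullback_torus_act:
  "sphere_pullback (torus_act s) \<eta> = on_sphere (\<lambda>x vs. \<eta> (torus_act s x) (map (torus_act s) vs))"
  by (rule sphere_pullback_linear[OF bounded_linear_torus_act])

lemma homog_comp_fourier_coeff:
  "homog_comp r \<eta> x vs = fourier_coeff (\<lambda>s. sphere_pullback (torus_act s) \<eta> x vs) r"
  by (simp add: homog_comp_def fourier_coeff_def)

text \<open>For nonzero r a component r_j is nonzero, and differentiating the constant in direction
  j gives 0 = 2 pi i r_j times the coefficient.\<close>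

lemma fourier_coeff_const: "fourier_coeff (\<lambda>s. c) r = (if r = 0 then c else 0)"
proof (cases "r = 0")
  case True
  have "Henstock_Kurzweil_Integration.content (cbox (0, 0) (1, 1) :: (real \<times> real) set) = 1"
    unfolding content_Pair by simp
  then show ?thesis using True by (simp add: fourier_coeff_def del: cbox_Pair_eq)
next
  case False
  have z: "fourier_coeff (\<lambda>s. 0) r = 0" by (simp add: fourier_coeff_def)
  have "fourier_coeff (\<lambda>s. c) r = 0"
    using fourier_coeff_deriv_fst[OF smooth_on_const, of c r] fourier_coeff_deriv_snd[OF smooth_on_const, of c r] False
    by (auto simp: frechet_derivative_const z zero_prod_def prod_eq_iff)
  then show ?thesis using False by simp
qed

lemma fourier_coeff_torus_char: "fourier_coeff (\<lambda>s. torus_char r s * c) q = (if q = r then c else 0)"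
proof -
  have "cis (- 2 * pi * (of_int (fst q) * fst s + of_int (snd q) * snd s)) * (torus_char r s * c)
     = cis (- 2 * pi * (of_int (fst (q - r)) * fst s + of_int (snd (q - r)) * snd s)) * c" for s
  proof -
    have "cis (- 2 * pi * (of_int (fst q) * fst s + of_int (snd q) * snd s)) * torus_char r s
       = cis (- 2 * pi * (of_int (fst (q - r)) * fst s + of_int (snd (q - r)) * snd s))"
      unfolding torus_char_def cis_mult
      by (rule arg_cong[of _ _ cis]) (simp add: distrib_left left_diff_distrib right_diff_distrib mult.assoc)
    then show ?thesis by (simp add: mult.assoc[symmetric])
  qed
  then have "fourier_coeff (\<lambda>s. torus_char r s * c) q = fourier_coeff (\<lambda>s. c) (q - r)"
    by (simp only: fourier_coeff_def)
  then show ?thesis by (simp add: fourier_coeff_const)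
qed

subsection \<open>Homogeneous forms\<close>

definition homogeneous :: "int \<times> int \<Rightarrow> s7_form \<Rightarrow> bool" where
  "homogeneous r \<eta> \<longleftrightarrow> on_sphere \<eta> = \<eta> \<and> (\<forall>s x vs. sphere_tangent x vs \<longrightarrow>
     \<eta> (torus_act s x) (map (torus_act s) vs) = torus_char r s * \<eta> x vs)"

lemma homogeneous_not_tangent: "homogeneous r \<eta> \<Longrightarrow> \<not> sphere_tangent x vs \<Longrightarrow> \<eta> x vs = 0"
proof -
  assume h: "homogeneous r \<eta>" and nt: "\<not> sphere_tangent x vs"
  have "on_sphere \<eta> x vs = 0" using nt by (simp add: on_sphere_def)
  then show ?thesis using h by (simp only: homogeneous_def)
qed

lemma homogeneousD:
  "homogeneous r \<eta> \<Longrightarrow> sphere_tangent x vs \<Longrightarrow>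
    \<eta> (torus_act s x) (map (torus_act s) vs) = torus_char r s * \<eta> x vs"
  by (simp only: homogeneous_def)

lemma homog_comp_homogeneous:
  assumes "homogeneous r \<eta>" shows "homog_comp q \<eta> = (if q = r then \<eta> else 0)"
proof (intro ext)
  fix x vs
  have "sphere_pullback (torus_act s) \<eta> x vs = torus_char r s * \<eta> x vs" for s
    using homogeneousD[OF assms, of x vs s] homogeneous_not_tangent[OF assms, of x vs]
    by (cases "sphere_tangent x vs") (simp_all add: sphere_pullback_torus_act on_sphere_def)
  then show "homog_comp q \<eta> x vs = (if q = r then \<eta> else 0) x vs"
    by (simp add: homog_comp_fourier_coeff fourier_coeff_torus_char)
qed

definition phase :: "real \<Rightarrow> int \<times> int \<Rightarrow> int \<times> int \<Rightarrow> complex" where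
  "phase \<theta> r q = cis (pi * \<theta> / 2 * of_int (fst r * snd q - snd r * fst q))"

text \<open>Each factor has a single nonzero component, so the double series has a single term.
  Every computation of curvature goes through this lemma.\<close>

lemma dprod_homogeneous:
  assumes "homogeneous r \<eta>" "homogeneous q \<zeta>"
  shows "dprod \<theta> \<eta> \<zeta> = cscale (phase \<theta> r q) (wedge \<eta> \<zeta>)"
proof (intro ext)
  fix x vs
  let ?f = "\<lambda>(r', q'). cis (pi * \<theta> / 2 * of_int (fst r' * snd q' - snd r' * fst q'))
       * wedge (homog_comp r' \<eta>) (homog_comp q' \<zeta>) x vs"
  have "?f p = 0" if "p \<noteq> (r, q)" for p
    using that by (cases p) (auto simp: homog_comp_homogeneous[OF assms(1)] homog_comp_homogeneous[OF assms(2)])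
  then have "infsum ?f UNIV = infsum ?f {(r, q)}"
    by (intro infsum_cong_neutral) auto
  also have "\<dots> = cscale (phase \<theta> r q) (wedge \<eta> \<zeta>) x vs"
    by (simp add: homog_comp_homogeneous[OF assms(1)] homog_comp_homogeneous[OF assms(2)] cscale_def phase_def)
  finally show "dprod \<theta> \<eta> \<zeta> x vs = cscale (phase \<theta> r q) (wedge \<eta> \<zeta>) x vs"
    by (simp add: dprod_def)
qed

lemma torus_act_unit: "norm x = 1 \<Longrightarrow> norm (torus_act s x) = 1"
  by (simp add: norm_eq_sqrt_inner torus_act_inner)

lemma homogeneous_fn_form:
  assumes "\<And>s x. norm x = 1 \<Longrightarrow> f (torus_act s x) = torus_char r s * f x"
  shows "homogeneous r (fn_form f)"
  unfolding homogeneous_def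
proof (intro conjI allI impI)
  fix s x and vs :: "(complex^4) list" assume t: "sphere_tangent x vs"
  show "fn_form f (torus_act s x) (map (torus_act s) vs) = torus_char r s * fn_form f x vs"
    using t assms[of x s] by (auto simp: fn_form_def on_sphere_def torus_act_sphere_tangent sphere_tangent_simps torus_act_unit)
qed simp

lemma homogeneous_form1:
  assumes "\<And>s x v. norm x = 1 \<Longrightarrow> x \<bullet> v = 0 \<Longrightarrow> \<alpha> (torus_act s x) (torus_act s v) = torus_char r s * \<alpha> x v"
  shows "homogeneous r (form1 \<alpha>)"
  unfolding homogeneous_def
proof (intro conjI allI impI)
  fix s x and vs :: "(complex^4) list" assume t: "sphere_tangent x vs"
  show "form1 \<alpha> (torus_act s x) (map (torus_act s) vs) = torus_char r s * form1 \<alpha> x vs"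
    using t assms[of _ _ s] by (auto simp: form1_def on_sphere_def torus_act_sphere_tangent sphere_tangent_simps
      torus_act_unit torus_act_inner split: list.splits)
qed simp

lemma homogeneous_form2:
  assumes "\<And>s x v w. norm x = 1 \<Longrightarrow> x \<bullet> v = 0 \<Longrightarrow> x \<bullet> w = 0 \<Longrightarrow>
    \<beta> (torus_act s x) (torus_act s v) (torus_act s w) = torus_char r s * \<beta> x v w"
  shows "homogeneous r (form2 \<beta>)"
  unfolding homogeneous_def
proof (intro conjI allI impI)
  fix s x and vs :: "(complex^4) list" assume t: "sphere_tangent x vs"
  show "form2 \<beta> (torus_act s x) (map (torus_act s) vs) = torus_char r s * form2 \<beta> x vs"
    using t assms[of _ _ _ s] by (auto simp: form2_def on_sphere_def torus_act_sphere_tangent sphere_tangent_simps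
      torus_act_unit torus_act_inner split: list.splits)
qed simp

subsection \<open>Smoothness along orbits\<close>

text \<open>Forms are linear only on tangent vectors; composing a slot with a linear map into the
  tangent space gives a function linear on the whole space.\<close>

lemma sphere_forms_linear_slot:
  assumes \<eta>: "\<eta> \<in> sphere_forms" and t: "sphere_tangent x (us @ ws)"
    and f: "linear f" "\<And>v. x \<bullet> f v = 0"
  shows "linear (\<lambda>v. \<eta> x (us @ f v # ws))"
proof -
  have lin: "\<eta> x (us @ (a *\<^sub>R v + b *\<^sub>R w) # ws) = of_real a * \<eta> x (us @ v # ws) + of_real b * \<eta> x (us @ w # ws)"
    if "x \<bullet> v = 0" "x \<bullet> w = 0" for a b v w
  proof -
    have "sphere_tangent x (us @ v # w # ws)"
      using t that by (auto simp: sphere_tangent_def)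
    then show ?thesis using \<eta> by (simp add: sphere_forms_def)
  qed
  show ?thesis
    using lin[OF f(2) f(2), of 1 _ 1] lin[OF f(2) f(2), of _ _ 0]
    by (intro linearI) (simp_all add: linear_add[OF f(1)] linear_cmul[OF f(1)] scaleR_conv_of_real)
qed

lemma linear_sgn_deriv: "x \<noteq> 0 \<Longrightarrow> linear (sgn_deriv x)"
  using has_derivative_linear[OF has_derivative_sgn] .

lemma linear_pullback_sgn:
  assumes \<eta>: "\<eta> \<in> sphere_forms" and x: "x \<noteq> 0"
  shows "linear (\<lambda>v. pullback sgn \<eta> x (us @ v # ws))"
  using sphere_forms_linear_slot[OF \<eta> _ linear_sgn_deriv[OF x] sgn_deriv_tangent[OF x], of "map (sgn_deriv x) us" "map (sgn_deriv x) ws"]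
    sphere_tangent_sgn[OF x, of "us @ ws"]
  by (simp add: pullback_sgn[OF x])

lemma euclidean_linear_expand:
  fixes f :: "'a::euclidean_space \<Rightarrow> 'b::real_vector"
  assumes "linear f" shows "f u = (\<Sum>b\<in>Basis. (u \<bullet> b) *\<^sub>R f b)"
  using linear_sum[OF assms, of "\<lambda>b. (u \<bullet> b) *\<^sub>R b" Basis]
  by (simp add: euclidean_representation linear_cmul[OF assms])

text \<open>Provides the smoothness in the torus parameter needed for
  \<open>fourier_coeff_abs_summable\<close>. It is stated for a general family of isometries because
  it serves both the torus action on the 7-sphere and the induced rotations of the 4-sphere.\<close>

lemma smooth_on_orbit:
  fixes R :: "real \<times> real \<Rightarrow> 'a::euclidean_space \<Rightarrow> 'a"
  assumes \<eta>: "\<eta> \<in> sphere_forms" and inner: "\<And>s x y. R s x \<bullet> R s y = x \<bullet> y"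
    and smooth: "\<And>x. smooth_on UNIV (\<lambda>s. R s x)" and t: "sphere_tangent p us"
  shows "smooth_on UNIV (\<lambda>s. \<eta> (R s p) (map (R s) us))"
proof -
  have p: "norm (R s p) = 1" "R s p \<noteq> 0" for s
    using t inner[of s p p] by (auto simp: sphere_tangent_def norm_eq_sqrt_inner)
  \<comment> \<open>Induction on the number of moving arguments: each is expanded in the basis and
    thereby joins the fixed arguments \<open>ws\<close>.\<close>
  have "smooth_on UNIV (\<lambda>s. pullback sgn \<eta> (R s p) (ws @ map (R s) us))" for ws us
  proof (induction us arbitrary: ws)
    case Nil
    have "smooth_on (- {0}) (\<lambda>x. pullback sgn \<eta> x ws)" using \<eta> by (simp add: sphere_forms_def)
    from smooth_on_compose[OF open_UNIV open_Compl[OF closed_singleton] _ smooth this, of p] p(2) show ?case by simp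
  next
    case (Cons u us)
    have "smooth_on UNIV (\<lambda>s. \<Sum>b\<in>Basis. (R s u \<bullet> b) *\<^sub>R pullback sgn \<eta> (R s p) ((ws @ [b]) @ map (R s) us))"
      by (intro smooth_on_sum smooth_on_scaleR smooth_on_inner smooth smooth_on_const Cons.IH) auto
    then show ?case
      by (rule smooth_on_cong[rotated -1])
         (simp_all add: euclidean_linear_expand[OF linear_pullback_sgn[OF \<eta> p(2)], of _ ws "R _ u" "map (R _) us", symmetric])
  qed
  from this[of "[]" us] show ?thesis
  proof (rule smooth_on_cong[rotated -1])
    fix s
    have t': "sphere_tangent (R s p) (map (R s) us)"
      using inner_preserving_sphere_tangent[of "R s", OF inner] t by blast
    then have m: "map (sgn_deriv (R s p)) (map (R s) us) = map (R s) us"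
      by (intro map_idI) (auto simp: sphere_tangent_def sgn_deriv_unit)
    then show "pullback sgn \<eta> (R s p) ([] @ map (R s) us) = \<eta> (R s p) (map (R s) us)"
      by (simp only: append_Nil pullback_sgn[OF p(2)] sgn_unit[OF p(1)] m)
  qed auto
qed

section \<open>Rotations of the 4-sphere and invariance of its Hodge operator\<close>

subsection \<open>The rotations of the 4-sphere induced by the torus\<close>

text \<open>The action on R^5 that \<open>hopf\<close> intertwines with \<open>torus_act\<close>:
  the degrees (1, 1) and (-1, 1) are those of z_1 and z_2, while z_0 is invariant.\<close>

definition rot5 :: "real \<times> real \<Rightarrow> real^5 \<Rightarrow> real^5" where
  "rot5 s p = (let w = torus_char (1, 1) s * Complex (p $ 2) (p $ 3); y = torus_char (- 1, 1) s * Complex (p $ 4) (p $ 5)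
     in vector [p $ 1, Re w, Im w, Re y, Im y])"

lemma rot5_nth:
  "rot5 s p $ 1 = p $ 1"
  "rot5 s p $ 2 = Re (torus_char (1, 1) s) * p $ 2 - Im (torus_char (1, 1) s) * p $ 3"
  "rot5 s p $ 3 = Re (torus_char (1, 1) s) * p $ 3 + Im (torus_char (1, 1) s) * p $ 2"
  "rot5 s p $ 4 = Re (torus_char (- 1, 1) s) * p $ 4 - Im (torus_char (- 1, 1) s) * p $ 5"
  "rot5 s p $ 5 = Re (torus_char (- 1, 1) s) * p $ 5 + Im (torus_char (- 1, 1) s) * p $ 4"
  by (simp_all add: rot5_def Let_def)

lemma linear_rot5: "linear (rot5 s)"
  by (rule linearI) (simp_all add: vec_eq_iff forall_5 rot5_nth algebra_simps)

lemma torus_char_Re_Im: "(Re (torus_char r s))\<^sup>2 + (Im (torus_char r s))\<^sup>2 = 1"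
  using norm_torus_char[of r s] by (simp add: cmod_def)

lemma rot5_inner: "rot5 s x \<bullet> rot5 s y = x \<bullet> y"
proof -
  have 1: "(c * a - d * b) * (c * a' - d * b') + (c * b + d * a) * (c * b' + d * a') = a * a' + b * b'"
    if "c\<^sup>2 + d\<^sup>2 = 1" for a b a' b' c d :: real
    using that by algebra
  show ?thesis
    using 1[OF torus_char_Re_Im, of "(1, 1)" s "x $ 2" "x $ 3" "y $ 2" "y $ 3"]
      1[OF torus_char_Re_Im, of "(- 1, 1)" s "x $ 4" "x $ 5" "y $ 4" "y $ 5"]
    by (simp add: inner_vec_def sum_5 rot5_nth)
qed

lemma rot5_periodic: "rot5 (s + (1, 0)) = rot5 s" "rot5 (s + (0, 1)) = rot5 s"
  by (simp_all add: fun_eq_iff rot5_def torus_char_periodic)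

lemma rot5_smooth: "smooth_on UNIV (\<lambda>s. rot5 s p)"
proof (rule smooth_on_cong)
  show "(\<Sum>i\<in>UNIV. axis i (rot5 s p $ i)) = rot5 s p" for s
    by (simp add: vec_eq_iff axis_def if_distrib sum.delta cong: if_cong)
  have ax: "bounded_linear (axis i :: real \<Rightarrow> real^5)" for i
    by (rule linear_conv_bounded_linear[THEN iffD1], rule linearI) (simp_all add: axis_def vec_eq_iff)
  have c: "smooth_on UNIV (\<lambda>s. Re (torus_char r s))" "smooth_on UNIV (\<lambda>s. Im (torus_char r s))" for r
    by (intro smooth_on_bounded_linear[OF bounded_linear_Re] smooth_on_bounded_linear[OF bounded_linear_Im]
      torus_char_smooth open_UNIV)+
  have "\<forall>i. smooth_on UNIV (\<lambda>s. rot5 s p $ i)"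
    unfolding forall_5 rot5_nth
    by (intro conjI smooth_on_add smooth_on_diff smooth_on_mult c smooth_on_const open_UNIV)
  then show "smooth_on UNIV (\<lambda>s. \<Sum>i\<in>UNIV. axis i (rot5 s p $ i))"
    by (intro smooth_on_sum smooth_on_bounded_linear[OF ax] open_UNIV) blast
qed auto

text \<open>A rotation that is a square has determinant (+1 or -1)^2 = 1, so no determinant of size
  five has to be expanded in \<open>det_rot5\<close>.\<close>

lemma rot5_half: "rot5 s = rot5 ((1 / 2) *\<^sub>R s) \<circ> rot5 ((1 / 2) *\<^sub>R s)"
proof -
  have "torus_char r s = torus_char r ((1 / 2) *\<^sub>R s) * torus_char r ((1 / 2) *\<^sub>R s)" for r
    by (simp add: torus_char_def cis_mult distrib_left[symmetric] add_divide_distrib[symmetric])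
       (simp add: field_simps)
  then have c: "Re (torus_char r s) = Re (torus_char r ((1 / 2) *\<^sub>R s)) * Re (torus_char r ((1 / 2) *\<^sub>R s))
      - Im (torus_char r ((1 / 2) *\<^sub>R s)) * Im (torus_char r ((1 / 2) *\<^sub>R s))"
    "Im (torus_char r s) = 2 * Re (torus_char r ((1 / 2) *\<^sub>R s)) * Im (torus_char r ((1 / 2) *\<^sub>R s))" for r
    by (simp_all add: complex_eq_iff)
  then show ?thesis
    by (simp add: fun_eq_iff vec_eq_iff forall_5 rot5_nth c) (simp add: algebra_simps)
qed

lemma orthogonal_transformation_rot5: "orthogonal_transformation (rot5 s)"
  by (simp add: orthogonal_transformation_def linear_rot5 rot5_inner)

lemma det_rot5: "det (matrix (rot5 s)) = 1"
proof -
  let ?h = "rot5 ((1 / 2) *\<^sub>R s)"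
  have "det (matrix ?h) = 1 \<or> det (matrix ?h) = - 1"
    using orthogonal_transformation_rot5[of "(1 / 2) *\<^sub>R s"] orthogonal_transformation_matrix det_orthogonal_matrix by blast
  moreover have "det (matrix (rot5 s)) = det (matrix ?h) * det (matrix ?h)"
    by (subst rot5_half) (simp only: matrix_compose[OF linear_rot5 linear_rot5] det_mul)
  ultimately show ?thesis by auto
qed

lemma vol4_rotate:
  assumes R: "linear R" "det (matrix R) = 1" and len: "length vs = 4"
  shows "vol4 (R p) (map R vs) = vol4 p vs"
proof -
  obtain a b c d where vs: "vs = [a, b, c, d]"
    using len by (auto simp: numeral_eq_Suc length_Suc_conv)
  have R': "R v $ i = (\<Sum>j\<in>UNIV. matrix R $ i $ j * v $ j)" for v i
    using fun_cong[OF matrix_vector_mul(2)[OF R(1)], of v] by (simp add: matrix_vector_mult_def vec_eq_iff)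
  have "(vector (R p # map R vs) :: real^5^5) = vector (p # vs) ** transpose (matrix R)"
    unfolding vec_eq_iff forall_5 vs
    by (simp add: matrix_matrix_mult_def transpose_def R' mult.commute)
  then show ?thesis by (simp add: vol4_def det_mul det_transpose R(2))
qed

subsection \<open>The Hodge operator and rotations\<close>

definition basis_lists :: "nat \<Rightarrow> 'a::euclidean_space list set" where
  "basis_lists n = {bs. set bs \<subseteq> Basis \<and> length bs = n}"

lemma finite_basis_lists: "finite (basis_lists n)"
  unfolding basis_lists_def by (rule finite_lists_length_eq) simp

lemma sum_basis_lists_0: "(\<Sum>bs\<in>basis_lists 0. g (bs :: 'a::euclidean_space list)) = g []"
proof -
  have "basis_lists 0 = {[] :: 'a list}" by (auto simp: basis_lists_def)
  then show ?thesis by simp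
qed

lemma sum_basis_lists_Suc:
  fixes g :: "'a::euclidean_space list \<Rightarrow> complex"
  shows "(\<Sum>bs\<in>basis_lists (Suc n). g bs) = (\<Sum>b\<in>Basis. \<Sum>bs\<in>basis_lists n. g (b # bs))"
proof -
  have "basis_lists (Suc n) = (\<lambda>(b, bs). b # bs) ` (Basis \<times> basis_lists n :: ('a \<times> 'a list) set)"
    by (auto simp: basis_lists_def length_Suc_conv image_iff)
  moreover have "inj_on (\<lambda>(b, bs). b # bs) (Basis \<times> basis_lists n :: ('a \<times> 'a list) set)"
    by (auto simp: inj_on_def)
  ultimately have "(\<Sum>bs\<in>basis_lists (Suc n). g bs) = (\<Sum>(b, bs)\<in>Basis \<times> basis_lists n. g (b # bs))"
    by (simp add: sum.reindex case_prod_unfold)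
  then show ?thesis by (simp add: sum.cartesian_product)
qed

text \<open>The tensor sum of b (x) b over an orthonormal basis is invariant under orthogonal
  maps.\<close>

lemma sum_bilinear_orthogonal:
  fixes \<beta> :: "'a::euclidean_space \<Rightarrow> 'a \<Rightarrow> complex" and R :: "'a \<Rightarrow> 'a"
  assumes R: "orthogonal_transformation R" and lin: "\<And>v. linear (\<beta> v)" "\<And>w. linear (\<lambda>v. \<beta> v w)"
  shows "(\<Sum>b\<in>Basis. \<beta> (R b) (R b)) = (\<Sum>b\<in>Basis. \<beta> b b)"
proof -
  have delta: "(\<Sum>b\<in>Basis. (R b \<bullet> c) * (R b \<bullet> d)) = c \<bullet> d" for c d
  proof -
    obtain c' d' where cd: "c = R c'" "d = R d'"
      using orthogonal_transformation_surj[OF R] by (metis surjD)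
    have RR: "R x \<bullet> R y = x \<bullet> y" for x y using R by (simp add: orthogonal_transformation_def)
    show ?thesis unfolding cd RR using euclidean_inner[of c' d'] by (simp add: inner_commute)
  qed
  have "\<beta> (R b) (R b) = (\<Sum>c\<in>Basis. \<Sum>d\<in>Basis. ((R b \<bullet> c) * (R b \<bullet> d)) *\<^sub>R \<beta> c d)" for b
    unfolding euclidean_linear_expand[OF lin(2), of "R b" "R b"]
    by (rule sum.cong[OF refl])
       (subst euclidean_linear_expand[OF lin(1)], simp add: scaleR_sum_right)
  then have "(\<Sum>b\<in>Basis. \<beta> (R b) (R b)) = (\<Sum>b\<in>Basis. \<Sum>c\<in>Basis. \<Sum>d\<in>Basis. ((R b \<bullet> c) * (R b \<bullet> d)) *\<^sub>R \<beta> c d)"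
    by simp
  also have "\<dots> = (\<Sum>c\<in>Basis. \<Sum>d\<in>Basis. \<Sum>b\<in>Basis. ((R b \<bullet> c) * (R b \<bullet> d)) *\<^sub>R \<beta> c d)"
    by (subst sum.swap) (intro sum.cong refl sum.swap)
  also have "\<dots> = (\<Sum>c\<in>Basis. \<Sum>d\<in>Basis. (c \<bullet> d) *\<^sub>R \<beta> c d)"
    by (simp add: scaleR_sum_left[symmetric] delta)
  also have "\<dots> = (\<Sum>c\<in>Basis. \<beta> c c)"
    by (intro sum.cong refl) (simp add: inner_Basis if_distrib[of "\<lambda>t. t *\<^sub>R _"] cong: if_cong)
  finally show ?thesis .
qed

text \<open>The bilinear case applied slot by slot: the induction hypothesis treats the tails with
  the first entries fixed, then the first entries are summed.\<close>

lemma sum_multilinear_orthogonal: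
  fixes f :: "'a::euclidean_space list \<Rightarrow> 'a list \<Rightarrow> complex" and R :: "'a \<Rightarrow> 'a"
  assumes R: "orthogonal_transformation R"
    and lin1: "\<And>us vs ws. length us + length vs + 1 = n \<Longrightarrow> length ws = n \<Longrightarrow> linear (\<lambda>v. f (us @ v # vs) ws)"
    and lin2: "\<And>us vs ws. length us + length vs + 1 = n \<Longrightarrow> length ws = n \<Longrightarrow> linear (\<lambda>v. f ws (us @ v # vs))"
  shows "(\<Sum>bs\<in>basis_lists n. f (map R bs) (map R bs)) = (\<Sum>bs\<in>basis_lists n. f bs bs)"
  using lin1 lin2
proof (induction n arbitrary: f)
  case 0
  then show ?case by (simp add: sum_basis_lists_0)
next
  case (Suc n)
  have IH: "(\<Sum>bs\<in>basis_lists n. f (c # map R bs) (d # map R bs)) = (\<Sum>bs\<in>basis_lists n. f (c # bs) (d # bs))" for c d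
  proof (rule Suc.IH[of "\<lambda>bs cs. f (c # bs) (d # cs)"])
    fix us vs ws :: "'a list" assume "length us + length vs + 1 = n" "length ws = n"
    then show "linear (\<lambda>v. f (c # us @ v # vs) (d # ws))" "linear (\<lambda>v. f (c # ws) (d # us @ v # vs))"
      using Suc.prems(1)[of "c # us" vs "d # ws"] Suc.prems(2)[of "d # us" vs "c # ws"] by simp_all
  qed
  have "(\<Sum>bs\<in>basis_lists (Suc n). f (map R bs) (map R bs))
      = (\<Sum>bs\<in>basis_lists n. \<Sum>b\<in>Basis. f (R b # bs) (R b # bs))"
    by (simp add: sum_basis_lists_Suc IH sum.swap[of _ Basis])
  also have "\<dots> = (\<Sum>bs\<in>basis_lists n. \<Sum>b\<in>Basis. f (b # bs) (b # bs))"
  proof (rule sum.cong[OF refl])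
    fix bs :: "'a list" assume "bs \<in> basis_lists n"
    then have "length bs = n" by (simp add: basis_lists_def)
    then show "(\<Sum>b\<in>Basis. f (R b # bs) (R b # bs)) = (\<Sum>b\<in>Basis. f (b # bs) (b # bs))"
      using Suc.prems(1)[of "[]" bs] Suc.prems(2)[of "[]" bs]
      by (intro sum_bilinear_orthogonal[OF R, of "\<lambda>v w. f (v # bs) (w # bs)"]) simp_all
  qed
  finally show ?case by (simp add: sum_basis_lists_Suc sum.swap[of _ Basis])
qed

lemma linear_det_row: "linear (\<lambda>v. det (\<chi> i. if i = k then v else M $ i :: real^'n^'n))"
proof (rule linearI)
  fix v w :: "real^'n" and r :: real
  show "det (\<chi> i. if i = k then v + w else M $ i) = det (\<chi> i. if i = k then v else M $ i) + det (\<chi> i. if i = k then w else M $ i)"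
    by (rule det_row_add)
  show "det (\<chi> i. if i = k then r *\<^sub>R v else M $ i) = r *\<^sub>R det (\<chi> i. if i = k then v else M $ i)"
    using det_row_mul[of k r "\<lambda>_. v" "\<lambda>i. M $ i"]
    by (simp only: vector_scalar_mult_def scaleR_vec_def real_scaleR_def)
qed

lemma linear_vol4:
  assumes "length us + length vs = 3" shows "linear (\<lambda>v. vol4 p (us @ v # vs))"
proof -
  have *: "linear (\<lambda>v. - det (\<chi> i. if i = k then v else M $ i :: real^5^5))" for k M
    using linear_compose_neg[OF linear_det_row] .
  consider a b c where "us = []" "vs = [a, b, c]" | a b c where "us = [a]" "vs = [b, c]"
    | a b c where "us = [a, b]" "vs = [c]" | a b c where "us = [a, b, c]" "vs = []"
    using assms by (cases us; cases "tl us"; cases "tl (tl us)") (auto simp: numeral_eq_Suc length_Suc_conv)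
  then show ?thesis
  proof cases
    case 1
    have "(vector [p, v, a, b, c] :: real^5^5) = (\<chi> i. if i = 2 then v else vector [p, 0, a, b, c] $ i)" for v
      by (simp add: vec_eq_iff[of "vector _ :: real^5^5"] forall_5)
    then show ?thesis using * by (simp add: 1 vol4_def)
  next
    case 2
    have "(vector [p, a, v, b, c] :: real^5^5) = (\<chi> i. if i = 3 then v else vector [p, a, 0, b, c] $ i)" for v
      by (simp add: vec_eq_iff[of "vector _ :: real^5^5"] forall_5)
    then show ?thesis using * by (simp add: 2 vol4_def)
  next
    case 3
    have "(vector [p, a, b, v, c] :: real^5^5) = (\<chi> i. if i = 4 then v else vector [p, a, b, 0, c] $ i)" for v
      by (simp add: vec_eq_iff[of "vector _ :: real^5^5"] forall_5)
    then show ?thesis using * by (simp add: 3 vol4_def)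
  next
    case 4
    have "(vector [p, a, b, c, v] :: real^5^5) = (\<chi> i. if i = 5 then v else vector [p, a, b, c, 0] $ i)" for v
      by (simp add: vec_eq_iff[of "vector _ :: real^5^5"] forall_5)
    then show ?thesis using * by (simp add: 4 vol4_def)
  qed
qed

lemma linear_tangent_proj: "linear (tangent_proj p)"
  by (rule linearI) (simp_all add: tangent_proj_def algebra_simps inner_add_right)

lemma tangent_proj_tangent: "norm p = 1 \<Longrightarrow> p \<bullet> tangent_proj p b = 0"
  by (simp add: tangent_proj_def inner_diff_right norm_eq_1)

lemma sphere_tangent_tangent_proj: "norm p = 1 \<Longrightarrow> sphere_tangent p (map (tangent_proj p) bs)"
  by (auto simp: sphere_tangent_def tangent_proj_tangent)

lemma hodge4_tangent:
  assumes "sphere_tangent p us" "length us \<le> 4"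
  shows "hodge4 \<zeta> p us = (\<Sum>bs\<in>basis_lists (4 - length us). \<zeta> p (map (tangent_proj p) bs)
      * of_real (vol4 p (map (tangent_proj p) bs @ us))) / fact (4 - length us)"
  using assms by (simp add: hodge4_def on_sphere_def basis_lists_def)

text \<open>Invariance of the Hodge operator, in a form made for averaging over R: the rotation
  enters only through the values of \<zeta>, while the volume factors are those at the unrotated
  point.\<close>

lemma hodge4_rotate:
  assumes \<zeta>: "\<zeta> \<in> sphere_forms" and R: "orthogonal_transformation R" "det (matrix R) = 1"
    and t: "sphere_tangent p us" and len: "length us \<le> 4"
  shows "hodge4 \<zeta> (R p) (map R us) = (\<Sum>bs\<in>basis_lists (4 - length us). \<zeta> (R p) (map R (map (tangent_proj p) bs))
      * of_real (vol4 p (map (tangent_proj p) bs @ us))) / fact (4 - length us)"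
proof -
  have RR: "R x \<bullet> R y = x \<bullet> y" for x y using R by (simp add: orthogonal_transformation_def)
  have linR: "linear R" using R by (simp add: orthogonal_transformation_def)
  have t': "sphere_tangent (R p) (map R us)"
    using inner_preserving_sphere_tangent[of R, OF RR] t by blast
  have p: "norm p = 1" "norm (R p) = 1" using t t' by (auto simp: sphere_tangent_def)
  let ?n = "4 - length us"
  let ?f = "\<lambda>bs cs. \<zeta> (R p) (map (tangent_proj (R p)) bs) * of_real (vol4 (R p) (map (tangent_proj (R p)) cs @ map R us))"
  have proj: "tangent_proj (R p) (R b) = R (tangent_proj p b)" for b
    by (simp add: tangent_proj_def RR linear_diff[OF linR] linear_cmul[OF linR])
  have "hodge4 \<zeta> (R p) (map R us) = (\<Sum>bs\<in>basis_lists ?n. ?f bs bs) / fact ?n"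
    using hodge4_tangent[OF t'] len by simp
  also have "(\<Sum>bs\<in>basis_lists ?n. ?f bs bs) = (\<Sum>bs\<in>basis_lists ?n. ?f (map R bs) (map R bs))"
  proof (rule sum_multilinear_orthogonal[where f = ?f, OF R(1), symmetric])
    fix xs ys zs :: "(real^5) list" assume l: "length xs + length ys + 1 = ?n" "length zs = ?n"
    have "linear (\<lambda>v. \<zeta> (R p) (map (tangent_proj (R p)) xs @ tangent_proj (R p) v # map (tangent_proj (R p)) ys))"
      using sphere_tangent_tangent_proj[OF p(2), of "xs @ ys"]
      by (intro sphere_forms_linear_slot[OF \<zeta>] linear_tangent_proj tangent_proj_tangent p) simp
    then show "linear (\<lambda>v. ?f (xs @ v # ys) zs)"
      by (auto simp: linear_iff scaleR_conv_of_real algebra_simps)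
    have "linear (\<lambda>v. vol4 (R p) (map (tangent_proj (R p)) xs @ tangent_proj (R p) v # (map (tangent_proj (R p)) ys @ map R us)))"
      using linear_compose[OF linear_tangent_proj linear_vol4, of "map (tangent_proj (R p)) xs" "map (tangent_proj (R p)) ys @ map R us" "R p" "R p"]
        l(1) len by (simp add: o_def)
    then show "linear (\<lambda>v. ?f zs (xs @ v # ys))"
      by (auto simp: linear_iff scaleR_conv_of_real algebra_simps)
  qed
  also have "\<dots> = (\<Sum>bs\<in>basis_lists ?n. \<zeta> (R p) (map R (map (tangent_proj p) bs))
      * of_real (vol4 p (map (tangent_proj p) bs @ us)))"
  proof (rule sum.cong[OF refl])
    fix bs :: "(real^5) list" assume "bs \<in> basis_lists ?n"
    then have l: "length (map (tangent_proj p) bs @ us) = 4" using len by (simp add: basis_lists_def)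
    have m: "map (tangent_proj (R p)) (map R bs) = map R (map (tangent_proj p) bs)" by (simp add: proj)
    show "?f (map R bs) (map R bs) = \<zeta> (R p) (map R (map (tangent_proj p) bs)) * of_real (vol4 p (map (tangent_proj p) bs @ us))"
      using vol4_rotate[OF linR R(2) l, of p] unfolding m by simp
  qed
  finally show ?thesis .
qed

section \<open>The Hopf map, its derivative and lifts of tangent vectors\<close>

subsection \<open>The Hopf map\<close>

definition hopf_deriv :: "complex^4 \<Rightarrow> complex^4 \<Rightarrow> real^5" where
  "hopf_deriv x v = (let
     w = 2 * (v $ 1 * cnj (x $ 3) + x $ 1 * cnj (v $ 3) + cnj (v $ 2) * x $ 4 + cnj (x $ 2) * v $ 4);
     y = 2 * (- cnj (v $ 1) * x $ 4 - cnj (x $ 1) * v $ 4 + v $ 2 * cnj (x $ 3) + x $ 2 * cnj (v $ 3))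
   in vector [4 * Re (cnj (x $ 1) * v $ 1 + cnj (x $ 2) * v $ 2), Re w, Im w, Re y, Im y])"

lemma hopf_nth:
  "hopf x $ 1 = 2 * ((cmod (x $ 1))\<^sup>2 + (cmod (x $ 2))\<^sup>2) - 1"
  "Complex (hopf x $ 2) (hopf x $ 3) = 2 * (x $ 1 * cnj (x $ 3) + cnj (x $ 2) * x $ 4)"
  "Complex (hopf x $ 4) (hopf x $ 5) = 2 * (- cnj (x $ 1) * x $ 4 + x $ 2 * cnj (x $ 3))"
  by (simp_all add: hopf_def Let_def complex_eq_iff)

lemma has_derivative_vec:
  fixes f :: "'a::real_normed_vector \<Rightarrow> real^'n"
  assumes "\<And>i. ((\<lambda>x. f x $ i) has_derivative (\<lambda>v. f' v $ i)) (at x)"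
  shows "(f has_derivative f') (at x)"
  using assms by (subst has_derivative_componentwise_within) (auto simp: Basis_vec_def inner_axis)

lemma has_derivative_component:
  "((\<lambda>x::'b::real_normed_vector^'n. x $ i) has_derivative (\<lambda>v. v $ i)) (at x)"
  using bounded_linear_imp_has_derivative[OF bounded_linear_vec_nth] .

lemma has_derivative_hopf: "(hopf has_derivative hopf_deriv x) (at x)"
proof (rule has_derivative_vec)
  note c = has_derivative_component
  note cc = bounded_linear.has_derivative[OF bounded_linear_cnj c]
  have 1: "((\<lambda>x::complex^4. 2 * (x $ 1 * cnj (x $ 3) + cnj (x $ 2) * x $ 4)) has_derivative
      (\<lambda>v. 2 * (v $ 1 * cnj (x $ 3) + x $ 1 * cnj (v $ 3) + cnj (v $ 2) * x $ 4 + cnj (x $ 2) * v $ 4))) (at x)"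
    by (auto intro!: derivative_eq_intros c cc simp: algebra_simps)
  have 2: "((\<lambda>x::complex^4. 2 * (- cnj (x $ 1) * x $ 4 + x $ 2 * cnj (x $ 3))) has_derivative
      (\<lambda>v. 2 * (- cnj (v $ 1) * x $ 4 - cnj (x $ 1) * v $ 4 + v $ 2 * cnj (x $ 3) + x $ 2 * cnj (v $ 3)))) (at x)"
    by (auto intro!: derivative_eq_intros c cc simp: algebra_simps)
  have 0: "((\<lambda>x::complex^4. 2 * Re (cnj (x $ 1) * x $ 1 + cnj (x $ 2) * x $ 2) - 1) has_derivative
      (\<lambda>v. 4 * Re (cnj (x $ 1) * v $ 1 + cnj (x $ 2) * v $ 2))) (at x)"
  proof -
    have q: "((\<lambda>x::complex^4. cnj (x $ 1) * x $ 1 + cnj (x $ 2) * x $ 2) has_derivative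
        (\<lambda>v. cnj (v $ 1) * x $ 1 + cnj (x $ 1) * v $ 1 + (cnj (v $ 2) * x $ 2 + cnj (x $ 2) * v $ 2))) (at x)"
      by (auto intro!: derivative_eq_intros c cc simp: algebra_simps)
    show ?thesis
      by (rule has_derivative_eq_rhs[OF has_derivative_diff[OF has_derivative_mult_right[OF
              bounded_linear.has_derivative[OF bounded_linear_Re q]] has_derivative_const]])
         (auto simp: fun_eq_iff)
  qed
  have h1: "2 * ((cmod (x $ 1))\<^sup>2 + (cmod (x $ 2))\<^sup>2) - 1 = 2 * Re (cnj (x $ 1) * x $ 1 + cnj (x $ 2) * x $ 2) - 1"
    for x :: "complex^4" unfolding cmod_power2 by (simp add: power2_eq_square)
  have "\<forall>i. ((\<lambda>x. hopf x $ i) has_derivative (\<lambda>v. hopf_deriv x v $ i)) (at x)"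
    unfolding forall_5 hopf_def hopf_deriv_def Let_def vector_5 h1
    by (intro conjI 0 bounded_linear.has_derivative[OF bounded_linear_Re] bounded_linear.has_derivative[OF bounded_linear_Im] 1 2)
  then show "((\<lambda>x. hopf x $ i) has_derivative (\<lambda>v. hopf_deriv x v $ i)) (at x)" for i by blast
qed

lemma hopf_torus_act: "hopf (torus_act s x) = rot5 s (hopf x)"
proof -
  have c: "torus_char (coord_degree 1) s * cnj (torus_char (coord_degree 3) s) = torus_char (1, 1) s"
    "cnj (torus_char (coord_degree 2) s) * torus_char (coord_degree 4) s = torus_char (1, 1) s"
    "cnj (torus_char (coord_degree 1) s) * torus_char (coord_degree 4) s = torus_char (- 1, 1) s"
    "torus_char (coord_degree 2) s * cnj (torus_char (coord_degree 3) s) = torus_char (- 1, 1) s"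
    by (simp_all add: torus_char_uminus[symmetric] torus_char_add[symmetric] del: torus_char_uminus)
  let ?y = "torus_act s x"
  have w1: "2 * (?y $ 1 * cnj (?y $ 3) + cnj (?y $ 2) * ?y $ 4)
      = torus_char (1, 1) s * (2 * (x $ 1 * cnj (x $ 3) + cnj (x $ 2) * x $ 4))"
  proof -
    have "2 * (?y $ 1 * cnj (?y $ 3) + cnj (?y $ 2) * ?y $ 4)
      = 2 * ((torus_char (coord_degree 1) s * cnj (torus_char (coord_degree 3) s)) * (x $ 1 * cnj (x $ 3))
         + (cnj (torus_char (coord_degree 2) s) * torus_char (coord_degree 4) s) * (cnj (x $ 2) * x $ 4))"
      unfolding torus_act_nth complex_cnj_mult by (simp only: mult_ac)
    then show ?thesis unfolding c by (simp add: algebra_simps)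
  qed
  have w2: "2 * (- cnj (?y $ 1) * ?y $ 4 + ?y $ 2 * cnj (?y $ 3))
      = torus_char (- 1, 1) s * (2 * (- cnj (x $ 1) * x $ 4 + x $ 2 * cnj (x $ 3)))"
  proof -
    have "2 * (- cnj (?y $ 1) * ?y $ 4 + ?y $ 2 * cnj (?y $ 3))
      = 2 * (- ((cnj (torus_char (coord_degree 1) s) * torus_char (coord_degree 4) s) * (cnj (x $ 1) * x $ 4))
         + (torus_char (coord_degree 2) s * cnj (torus_char (coord_degree 3) s)) * (x $ 2 * cnj (x $ 3)))"
      unfolding torus_act_nth complex_cnj_mult by (simp only: mult_ac mult_minus_left mult_minus_right)
    then show ?thesis unfolding c by (simp add: algebra_simps)
  qed
  have m: "cmod (?y $ i) = cmod (x $ i)" for i by (simp add: torus_act_nth norm_mult)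
  show ?thesis
    unfolding rot5_def Let_def hopf_nth w1[symmetric] w2[symmetric]
    by (simp add: hopf_def Let_def m)
qed

lemma hopf_deriv_torus_act: "hopf_deriv (torus_act s x) (torus_act s v) = rot5 s (hopf_deriv x v)"
proof -
  have "((\<lambda>x. hopf (torus_act s x)) has_derivative (\<lambda>v. hopf_deriv (torus_act s x) (torus_act s v))) (at x)"
    by (rule has_derivative_compose[OF bounded_linear_imp_has_derivative[OF bounded_linear_torus_act] has_derivative_hopf])
  moreover have "bounded_linear (rot5 s)" using linear_rot5 linear_conv_bounded_linear by blast
  then have "((\<lambda>x. rot5 s (hopf x)) has_derivative (\<lambda>v. rot5 s (hopf_deriv x v))) (at x)"
    by (rule bounded_linear.has_derivative[OF _ has_derivative_hopf])
  ultimately have "(\<lambda>v. hopf_deriv (torus_act s x) (torus_act s v)) = (\<lambda>v. rot5 s (hopf_deriv x v))"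
    unfolding hopf_torus_act by (rule has_derivative_unique)
  then show ?thesis by (rule fun_cong)
qed

text \<open>One half of the Clifford matrix \<open>Gam u\<close> (defined below) applied to x. It is
  a right inverse of \<open>hopf_deriv x\<close> on vectors tangent to the 4-sphere.\<close>

definition hopf_lift :: "complex^4 \<Rightarrow> real^5 \<Rightarrow> complex^4" where
  "hopf_lift x u = (let c = of_real (u $ 1); w = Complex (u $ 2) (u $ 3); y = Complex (u $ 4) (u $ 5) in
     (1 / 2 :: real) *\<^sub>R vector
       [c * x $ 1 + w * x $ 3 - cnj y * x $ 4, c * x $ 2 + y * x $ 3 + cnj w * x $ 4,
        cnj w * x $ 1 + cnj y * x $ 2 - c * x $ 3, - y * x $ 1 + w * x $ 2 - c * x $ 4])"

lemma hopf_lift_nth: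
  "hopf_lift x u $ 1 = (of_real (u $ 1) * x $ 1 + Complex (u $ 2) (u $ 3) * x $ 3 - Complex (u $ 4) (- u $ 5) * x $ 4) / 2"
  "hopf_lift x u $ 2 = (of_real (u $ 1) * x $ 2 + Complex (u $ 4) (u $ 5) * x $ 3 + Complex (u $ 2) (- u $ 3) * x $ 4) / 2"
  "hopf_lift x u $ 3 = (Complex (u $ 2) (- u $ 3) * x $ 1 + Complex (u $ 4) (- u $ 5) * x $ 2 - of_real (u $ 1) * x $ 3) / 2"
  "hopf_lift x u $ 4 = (- Complex (u $ 4) (u $ 5) * x $ 1 + Complex (u $ 2) (u $ 3) * x $ 2 - of_real (u $ 1) * x $ 4) / 2"
  by (simp_all add: hopf_lift_def Let_def complex_eq_iff)

lemma unit_complex4: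
  fixes x :: "complex^4"
  shows "norm x = 1 \<longleftrightarrow> (Re (x $ 1))\<^sup>2 + (Im (x $ 1))\<^sup>2 + (Re (x $ 2))\<^sup>2 + (Im (x $ 2))\<^sup>2
     + (Re (x $ 3))\<^sup>2 + (Im (x $ 3))\<^sup>2 + (Re (x $ 4))\<^sup>2 + (Im (x $ 4))\<^sup>2 = 1"
  by (simp add: norm_eq_1 inner_vec_def sum_4 inner_complex_def power2_eq_square add.assoc)

lemma inner_complex4:
  fixes x v :: "complex^4"
  shows "x \<bullet> v = Re (x $ 1) * Re (v $ 1) + Im (x $ 1) * Im (v $ 1) + Re (x $ 2) * Re (v $ 2) + Im (x $ 2) * Im (v $ 2)
     + Re (x $ 3) * Re (v $ 3) + Im (x $ 3) * Im (v $ 3) + Re (x $ 4) * Re (v $ 4) + Im (x $ 4) * Im (v $ 4)"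
  by (simp add: inner_vec_def sum_4 inner_complex_def)

lemma hopf_Re_Im:
  "hopf x $ 1 = 2 * ((Re (x $ 1))\<^sup>2 + (Im (x $ 1))\<^sup>2 + (Re (x $ 2))\<^sup>2 + (Im (x $ 2))\<^sup>2) - 1"
  "hopf x $ 2 = 2 * (Re (x $ 1) * Re (x $ 3) + Im (x $ 1) * Im (x $ 3) + Re (x $ 2) * Re (x $ 4) + Im (x $ 2) * Im (x $ 4))"
  "hopf x $ 3 = 2 * (Im (x $ 1) * Re (x $ 3) - Re (x $ 1) * Im (x $ 3) + Re (x $ 2) * Im (x $ 4) - Im (x $ 2) * Re (x $ 4))"
  "hopf x $ 4 = 2 * (- Re (x $ 1) * Re (x $ 4) - Im (x $ 1) * Im (x $ 4) + Re (x $ 2) * Re (x $ 3) + Im (x $ 2) * Im (x $ 3))"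
  "hopf x $ 5 = 2 * (- Re (x $ 1) * Im (x $ 4) + Im (x $ 1) * Re (x $ 4) + Im (x $ 2) * Re (x $ 3) - Re (x $ 2) * Im (x $ 3))"
  by (simp_all add: hopf_def Let_def cmod_power2 algebra_simps)

lemma hopf_unit: "norm x = 1 \<Longrightarrow> norm (hopf x) = 1"
  unfolding unit_complex4 norm_eq_1[of "hopf x"] inner_vec_def sum_5 hopf_Re_Im inner_real_def
  by algebra

lemma hopf_deriv_Re_Im:
  "hopf_deriv x v $ 1 = 4 * (Re (x $ 1) * Re (v $ 1) + Im (x $ 1) * Im (v $ 1) + Re (x $ 2) * Re (v $ 2) + Im (x $ 2) * Im (v $ 2))"
  "hopf_deriv x v $ 2 = 2 * (Re (v $ 1) * Re (x $ 3) + Im (v $ 1) * Im (x $ 3) + Re (v $ 2) * Re (x $ 4) + Im (v $ 2) * Im (x $ 4)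
    + Re (x $ 1) * Re (v $ 3) + Im (x $ 1) * Im (v $ 3) + Re (x $ 2) * Re (v $ 4) + Im (x $ 2) * Im (v $ 4))"
  "hopf_deriv x v $ 3 = 2 * (Im (v $ 1) * Re (x $ 3) - Re (v $ 1) * Im (x $ 3) + Re (v $ 2) * Im (x $ 4) - Im (v $ 2) * Re (x $ 4)
    + Im (x $ 1) * Re (v $ 3) - Re (x $ 1) * Im (v $ 3) + Re (x $ 2) * Im (v $ 4) - Im (x $ 2) * Re (v $ 4))"
  "hopf_deriv x v $ 4 = 2 * (- Re (v $ 1) * Re (x $ 4) - Im (v $ 1) * Im (x $ 4) + Re (v $ 2) * Re (x $ 3) + Im (v $ 2) * Im (x $ 3)
    - Re (x $ 1) * Re (v $ 4) - Im (x $ 1) * Im (v $ 4) + Re (x $ 2) * Re (v $ 3) + Im (x $ 2) * Im (v $ 3))"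
  "hopf_deriv x v $ 5 = 2 * (- Re (v $ 1) * Im (x $ 4) + Im (v $ 1) * Re (x $ 4) + Im (v $ 2) * Re (x $ 3) - Re (v $ 2) * Im (x $ 3)
    - Re (x $ 1) * Im (v $ 4) + Im (x $ 1) * Re (v $ 4) + Im (x $ 2) * Re (v $ 3) - Re (x $ 2) * Im (v $ 3))"
  by (simp_all add: hopf_deriv_def Let_def algebra_simps)

lemma hopf_deriv_tangent: "norm x = 1 \<Longrightarrow> x \<bullet> v = 0 \<Longrightarrow> hopf x \<bullet> hopf_deriv x v = 0"
  unfolding unit_complex4 inner_complex4 inner_vec_def[where 'a = real] sum_5 hopf_Re_Im hopf_deriv_Re_Im inner_real_def
  by algebra

lemma hopf_lift_Re_Im:
  "Re (hopf_lift x u $ 1) = (u $ 1 * Re (x $ 1) + u $ 2 * Re (x $ 3) - u $ 3 * Im (x $ 3) - u $ 4 * Re (x $ 4) - u $ 5 * Im (x $ 4)) / 2"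
  "Im (hopf_lift x u $ 1) = (u $ 1 * Im (x $ 1) + u $ 2 * Im (x $ 3) + u $ 3 * Re (x $ 3) - u $ 4 * Im (x $ 4) + u $ 5 * Re (x $ 4)) / 2"
  "Re (hopf_lift x u $ 2) = (u $ 1 * Re (x $ 2) + u $ 4 * Re (x $ 3) - u $ 5 * Im (x $ 3) + u $ 2 * Re (x $ 4) + u $ 3 * Im (x $ 4)) / 2"
  "Im (hopf_lift x u $ 2) = (u $ 1 * Im (x $ 2) + u $ 4 * Im (x $ 3) + u $ 5 * Re (x $ 3) + u $ 2 * Im (x $ 4) - u $ 3 * Re (x $ 4)) / 2"
  "Re (hopf_lift x u $ 3) = (u $ 2 * Re (x $ 1) + u $ 3 * Im (x $ 1) + u $ 4 * Re (x $ 2) + u $ 5 * Im (x $ 2) - u $ 1 * Re (x $ 3)) / 2"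
  "Im (hopf_lift x u $ 3) = (u $ 2 * Im (x $ 1) - u $ 3 * Re (x $ 1) + u $ 4 * Im (x $ 2) - u $ 5 * Re (x $ 2) - u $ 1 * Im (x $ 3)) / 2"
  "Re (hopf_lift x u $ 4) = (- u $ 4 * Re (x $ 1) + u $ 5 * Im (x $ 1) + u $ 2 * Re (x $ 2) - u $ 3 * Im (x $ 2) - u $ 1 * Re (x $ 4)) / 2"
  "Im (hopf_lift x u $ 4) = (- u $ 4 * Im (x $ 1) - u $ 5 * Re (x $ 1) + u $ 2 * Im (x $ 2) + u $ 3 * Re (x $ 2) - u $ 1 * Im (x $ 4)) / 2"
  by (simp_all add: hopf_lift_nth)

lemma hopf_lift_tangent:
  assumes "norm x = 1" "hopf x \<bullet> u = 0" shows "x \<bullet> hopf_lift x u = 0"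
proof -
  have "2 * (x \<bullet> hopf_lift x u) = hopf x \<bullet> u"
    using assms(1)
    unfolding unit_complex4 inner_complex4 inner_vec_def[where 'a = real] sum_5 hopf_Re_Im hopf_lift_Re_Im inner_real_def
    by algebra
  then show ?thesis using assms(2) by simp
qed

lemma hopf_deriv_lift:
  assumes "norm x = 1" "hopf x \<bullet> u = 0" shows "hopf_deriv x (hopf_lift x u) = u"
  using assms
  unfolding vec_eq_iff forall_5 unit_complex4 inner_vec_def[where 'a = real] sum_5 hopf_Re_Im hopf_deriv_Re_Im
    hopf_lift_Re_Im inner_real_def
  by (intro conjI; algebra)

lemma sphere_tangent_hopf:
  "sphere_tangent x vs \<Longrightarrow> sphere_tangent (hopf x) (map (hopf_deriv x) vs)"
  by (auto simp: sphere_tangent_def hopf_unit hopf_deriv_tangent)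

lemma sphere_tangent_hopf_lift:
  "norm x = 1 \<Longrightarrow> sphere_tangent (hopf x) us \<Longrightarrow> sphere_tangent x (map (hopf_lift x) us)"
  by (auto simp: sphere_tangent_def hopf_lift_tangent)

lemma map_hopf_deriv_lift:
  "norm x = 1 \<Longrightarrow> sphere_tangent (hopf x) us \<Longrightarrow> map (hopf_deriv x) (map (hopf_lift x) us) = us"
  by (auto simp: sphere_tangent_def hopf_deriv_lift intro!: map_idI)

lemma sphere_pullback_hopf:
  "sphere_pullback hopf \<eta> = on_sphere (\<lambda>x vs. \<eta> (hopf x) (map (hopf_deriv x) vs))"
  using frechet_derivative_at[OF has_derivative_hopf, symmetric]
  by (simp add: sphere_pullback_def pullback_def[abs_def])

lemma torus_sphere_pullback_hopf:
  assumes "sphere_tangent x vs"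
  shows "sphere_pullback (torus_act s) (sphere_pullback hopf \<eta>) x vs
    = \<eta> (rot5 s (hopf x)) (map (rot5 s) (map (hopf_deriv x) vs))"
  using assms
  by (simp add: sphere_pullback_torus_act sphere_pullback_hopf on_sphere_def torus_act_sphere_tangent
      hopf_torus_act hopf_deriv_torus_act o_def)

section \<open>Independence of the Hodge operator from the presentation\<close>

subsection \<open>The Hodge operator on adjoint-valued forms is well defined\<close>

lemma sum_fun_apply: "(\<Sum>i\<in>I. f i) x = (\<Sum>i\<in>I. f i x :: 'b::comm_monoid_add)"
  by (induction I rule: infinite_finite_induct) simp_all

lemma infsum_sum_swap:
  fixes f :: "'i \<Rightarrow> 'a \<Rightarrow> complex"
  assumes "finite I" "\<And>i. i \<in> I \<Longrightarrow> f i summable_on A"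
  shows "infsum (\<lambda>x. \<Sum>i\<in>I. f i x) A = (\<Sum>i\<in>I. infsum (f i) A)"
proof -
  have "(\<lambda>x. \<Sum>i\<in>I. f i x) summable_on A \<and> infsum (\<lambda>x. \<Sum>i\<in>I. f i x) A = (\<Sum>i\<in>I. infsum (f i) A)"
    using assms
  proof (induction I)
    case (insert i I)
    then show ?case by (auto simp: infsum_add intro!: summable_on_add)
  qed simp
  then show ?thesis ..
qed

lemma fourier_coeff_sum:
  assumes "finite I" "\<And>i. i \<in> I \<Longrightarrow> smooth_on UNIV (f i)"
  shows "fourier_coeff (\<lambda>s. \<Sum>i\<in>I. f i s * c i) r = (\<Sum>i\<in>I. fourier_coeff (f i) r * c i)"
proof -
  let ?e = "\<lambda>s::real\<times>real. cis (- 2 * pi * (of_int (fst r) * fst s + of_int (snd r) * snd s))"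
  have "fourier_coeff (\<lambda>s. \<Sum>i\<in>I. f i s * c i) r = integral (cbox (0, 0) (1, 1)) (\<lambda>s. \<Sum>i\<in>I. (?e s * f i s) * c i)"
    by (simp only: fourier_coeff_def sum_distrib_left mult.assoc)
  also have "\<dots> = (\<Sum>i\<in>I. integral (cbox (0, 0) (1, 1)) (\<lambda>s. (?e s * f i s) * c i))"
    by (intro integral_sum assms(1) integrable_on_mult_left integrable_continuous fourier_coeff_integrand_continuous assms(2))
  finally show ?thesis
    by (simp only: fourier_coeff_def integral_mult_left)
qed

lemma homog_comp_hopf:
  assumes "sphere_tangent x vs"
  shows "homog_comp r (sphere_pullback hopf \<eta>) x vs
    = fourier_coeff (\<lambda>s. \<eta> (rot5 s (hopf x)) (map (rot5 s) (map (hopf_deriv x) vs))) r"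
  by (simp only: homog_comp_fourier_coeff torus_sphere_pullback_hopf[OF assms])

lemma homog_comp_hopf_summable:
  assumes "\<zeta> \<in> sphere_forms" "sphere_tangent x vs"
  shows "(\<lambda>r. norm (homog_comp r (sphere_pullback hopf \<zeta>) x vs)) summable_on UNIV"
  unfolding homog_comp_hopf[OF assms(2)]
  by (intro fourier_coeff_abs_summable smooth_on_orbit[OF assms(1) rot5_inner rot5_smooth] sphere_tangent_hopf assms(2))
     (simp_all add: rot5_periodic)

lemma homog_comp_summable:
  assumes "\<eta> \<in> sphere_forms" "sphere_tangent x vs"
  shows "(\<lambda>r. norm (homog_comp r \<eta> x vs)) summable_on UNIV"
proof -
  have "homog_comp r \<eta> x vs = fourier_coeff (\<lambda>s. \<eta> (torus_act s x) (map (torus_act s) vs)) r" for r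
    using assms(2) by (simp add: homog_comp_fourier_coeff sphere_pullback_torus_act on_sphere_def)
  then show ?thesis
    by (simp only:)
       (intro fourier_coeff_abs_summable smooth_on_orbit[OF assms(1) torus_act_inner torus_act_smooth] assms(2);
        simp only: torus_act_periodic)
qed

text \<open>The volume factor in the Hodge operator at the image of x. It depends on neither the
  form nor a Fourier index, so it passes through all the series below.\<close>

definition hodge_coeff :: "complex^4 \<Rightarrow> (complex^4) list \<Rightarrow> (real^5) list \<Rightarrow> complex" where
  "hodge_coeff x vs bs = of_real (vol4 (hopf x) (map (tangent_proj (hopf x)) bs @ map (hopf_deriv x) vs)) / fact (4 - length vs)"

definition lift_list :: "complex^4 \<Rightarrow> (real^5) list \<Rightarrow> (complex^4) list" where
  "lift_list x bs = map (hopf_lift x) (map (tangent_proj (hopf x)) bs)"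

lemma lift_list:
  assumes "norm x = 1"
  shows "sphere_tangent x (lift_list x bs)" "map (hopf_deriv x) (lift_list x bs) = map (tangent_proj (hopf x)) bs"
  unfolding lift_list_def
  by (intro sphere_tangent_hopf_lift map_hopf_deriv_lift assms sphere_tangent_tangent_proj hopf_unit)+

text \<open>A homogeneous component is an average over the torus orbit, and by
  \<open>hodge4_rotate\<close> the Hodge operator acts at each orbit point by the same finite
  combination. The values of the pulled-back form on lifted vectors are those of the form
  downstairs.\<close>

lemma homog_comp_hodge4:
  assumes \<zeta>: "\<zeta> \<in> sphere_forms" and t: "sphere_tangent x vs" and len: "length vs \<le> 4"
  shows "homog_comp r (sphere_pullback hopf (hodge4 \<zeta>)) x vs
    = (\<Sum>bs\<in>basis_lists (4 - length vs). homog_comp r (sphere_pullback hopf \<zeta>) x (lift_list x bs) * hodge_coeff x vs bs)"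
proof -
  have x: "norm x = 1" using t by (simp add: sphere_tangent_def)
  have p: "norm (hopf x) = 1" using hopf_unit[OF x] .
  let ?us = "map (hopf_deriv x) vs"
  have "hodge4 \<zeta> (rot5 s (hopf x)) (map (rot5 s) ?us)
      = (\<Sum>bs\<in>basis_lists (4 - length vs). \<zeta> (rot5 s (hopf x)) (map (rot5 s) (map (tangent_proj (hopf x)) bs)) * hodge_coeff x vs bs)" for s
    using hodge4_rotate[OF \<zeta> orthogonal_transformation_rot5 det_rot5 sphere_tangent_hopf[OF t]] len
    by (simp add: hodge_coeff_def sum_divide_distrib)
  then have "homog_comp r (sphere_pullback hopf (hodge4 \<zeta>)) x vs
    = (\<Sum>bs\<in>basis_lists (4 - length vs). fourier_coeff (\<lambda>s. \<zeta> (rot5 s (hopf x)) (map (rot5 s) (map (tangent_proj (hopf x)) bs))) r * hodge_coeff x vs bs)"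
    unfolding homog_comp_hopf[OF t]
    by (simp only:) (intro fourier_coeff_sum finite_basis_lists smooth_on_orbit[OF \<zeta> rot5_inner rot5_smooth]
        sphere_tangent_tangent_proj p)
  then show ?thesis
    by (simp only: homog_comp_hopf[OF lift_list(1)[OF x]] lift_list(2)[OF x])
qed

lemma sphere_functionsD:
  assumes "X \<in> sphere_functions"
  shows "X \<in> sphere_forms" "vs \<noteq> [] \<Longrightarrow> homog_comp q X x vs = 0"
proof -
  show "X \<in> sphere_forms" using assms by (simp add: sphere_functions_def)
  assume "vs \<noteq> []"
  then have "sphere_pullback (torus_act s) X x vs = 0" for s
    using assms by (simp add: sphere_pullback_torus_act on_sphere_def sphere_functions_def)
  then show "homog_comp q X x vs = 0" by (simp add: homog_comp_def)
qed

lemma dprod_function_right: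
  assumes "X \<in> sphere_functions"
  shows "dprod \<theta> \<eta> X x vs = infsum (\<lambda>p. phase \<theta> (fst p) (snd p) * (homog_comp (fst p) \<eta> x vs * homog_comp (snd p) X x [])) UNIV"
  unfolding dprod_def case_prod_unfold
  by (simp add: wedge_function_right sphere_functionsD(2)[OF assms] phase_def mult_ac)

text \<open>The right factor is a function, so all vectors go to the left factor and the preceding
  lemma applies termwise. The section need not be homogeneous: the series is genuinely infinite, and
  absolute summability justifies taking the finite sum outside.\<close>

lemma dprod_hodge4:
  assumes \<zeta>: "\<zeta> \<in> sphere_forms" and X: "X \<in> sphere_functions" and t: "sphere_tangent x vs" and len: "length vs \<le> 4"
  shows "dprod \<theta> (sphere_pullback hopf (hodge4 \<zeta>)) X x vs
    = (\<Sum>bs\<in>basis_lists (4 - length vs). dprod \<theta> (sphere_pullback hopf \<zeta>) X x (lift_list x bs) * hodge_coeff x vs bs)"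
proof -
  have x: "norm x = 1" using t by (simp add: sphere_tangent_def)
  let ?g = "\<lambda>bs p. phase \<theta> (fst p) (snd p) * (homog_comp (fst p) (sphere_pullback hopf \<zeta>) x (lift_list x bs) * homog_comp (snd p) X x [])"
  have summable: "?g bs summable_on UNIV" for bs
  proof (rule abs_summable_summable)
    have "sphere_tangent x []" using x by (simp add: sphere_tangent_Nil)
    from abs_summable_on_product[OF homog_comp_hopf_summable[OF \<zeta> lift_list(1)[OF x]] homog_comp_summable[OF sphere_functionsD(1)[OF X] this]]
    show "(\<lambda>p. norm (?g bs p)) summable_on UNIV"
      by (simp add: norm_mult phase_def)
  qed
  have "dprod \<theta> (sphere_pullback hopf (hodge4 \<zeta>)) X x vs
    = infsum (\<lambda>p. \<Sum>bs\<in>basis_lists (4 - length vs). ?g bs p * hodge_coeff x vs bs) UNIV"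
    unfolding dprod_function_right[OF X] homog_comp_hodge4[OF \<zeta> t len]
    by (simp only: sum_distrib_left sum_distrib_right mult_ac)
  also have "\<dots> = (\<Sum>bs\<in>basis_lists (4 - length vs). infsum (\<lambda>p. ?g bs p * hodge_coeff x vs bs) UNIV)"
    by (intro infsum_sum_swap finite_basis_lists summable_on_cmult_left summable)
  also have "\<dots> = (\<Sum>bs\<in>basis_lists (4 - length vs). dprod \<theta> (sphere_pullback hopf \<zeta>) X x (lift_list x bs) * hodge_coeff x vs bs)"
    by (simp only: infsum_cmult_left' dprod_function_right[OF X])
  finally show ?thesis .
qed

lemma dprod_hodge4_zero:
  assumes X: "X \<in> sphere_functions" and n: "\<not> (sphere_tangent x vs \<and> length vs \<le> 4)"
  shows "dprod \<theta> (sphere_pullback hopf (hodge4 \<zeta>)) X x vs = 0"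
proof -
  have "sphere_pullback (torus_act s) (sphere_pullback hopf (hodge4 \<zeta>)) x vs = 0" for s
    using n by (auto simp: sphere_pullback_torus_act sphere_pullback_hopf on_sphere_def hodge4_def)
  then have "homog_comp r (sphere_pullback hopf (hodge4 \<zeta>)) x vs = 0" for r
    by (simp add: homog_comp_def)
  then show ?thesis by (simp add: dprod_function_right[OF X])
qed

text \<open>The Hodge operator expressed on the product itself, without reference to its factors;
  this is what makes \<open>ad_hodge\<close> single-valued.\<close>

definition hodge7 :: "s7_form \<Rightarrow> s7_form" where
  "hodge7 F = (\<lambda>x vs. if sphere_tangent x vs \<and> length vs \<le> 4
     then \<Sum>bs\<in>basis_lists (4 - length vs). F x (lift_list x bs) * hodge_coeff x vs bs else 0)"

lemma ad_hodge_graph_hodge7: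
  assumes "(F, G) \<in> ad_hodge_graph \<theta>"
  shows "G = map_matrix hodge7 F"
proof -
  obtain n :: nat and \<zeta> X where \<zeta>: "\<And>k. k < n \<Longrightarrow> \<zeta> k \<in> sphere_forms" and X: "\<And>k. k < n \<Longrightarrow> X k \<in> Gamma_ad"
    and F: "F = (\<Sum>k<n. left_mult \<theta> (sphere_pullback hopf (\<zeta> k)) (X k))"
    and G: "G = (\<Sum>k<n. left_mult \<theta> (sphere_pullback hopf (hodge4 (\<zeta> k))) (X k))"
    using assms unfolding ad_hodge_graph_def by blast
  have "G $ i $ j = hodge7 (F $ i $ j)" for i j
  proof (intro ext)
    fix x vs
    have X': "X k $ i $ j \<in> sphere_functions" if "k < n" for k
      using X[OF that] by (simp add: Gamma_ad_def)
    have Fij: "(F $ i $ j) y us = (\<Sum>k<n. dprod \<theta> (sphere_pullback hopf (\<zeta> k)) (X k $ i $ j) y us)" for y us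
      by (simp add: F left_mult_def sum_fun_apply)
    have Gij: "(G $ i $ j) x vs = (\<Sum>k<n. dprod \<theta> (sphere_pullback hopf (hodge4 (\<zeta> k))) (X k $ i $ j) x vs)"
      by (simp add: G left_mult_def sum_fun_apply)
    show "(G $ i $ j) x vs = hodge7 (F $ i $ j) x vs"
    proof (cases "sphere_tangent x vs \<and> length vs \<le> 4")
      case True
      then have "(G $ i $ j) x vs = (\<Sum>k<n. \<Sum>bs\<in>basis_lists (4 - length vs).
          dprod \<theta> (sphere_pullback hopf (\<zeta> k)) (X k $ i $ j) x (lift_list x bs) * hodge_coeff x vs bs)"
        unfolding Gij by (intro sum.cong refl dprod_hodge4 \<zeta> X') auto
      also have "\<dots> = hodge7 (F $ i $ j) x vs"
        using True by (subst sum.swap) (simp add: hodge7_def Fij sum_distrib_right)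
      finally show ?thesis .
    next
      case False
      then show ?thesis
        unfolding Gij using dprod_hodge4_zero[OF X' False] by (auto simp: hodge7_def intro!: sum.neutral)
    qed
  qed
  then show ?thesis by (simp add: vec_eq_iff)
qed

lemma ad_hodge_eqI:
  assumes "(F, G) \<in> ad_hodge_graph \<theta>"
  shows "F \<in> ad_forms \<theta>" "ad_hodge \<theta> F = G"
proof -
  show "F \<in> ad_forms \<theta>" using assms by (auto simp: ad_forms_def)
  show "ad_hodge \<theta> F = G"
    unfolding ad_hodge_def
    by (rule the_equality[of _ G]) (use assms ad_hodge_graph_hodge7 in blast)+
qed

section \<open>Matrix-valued forms built from the coordinate matrix Psi\<close>

subsection \<open>Matrices of functions and 1-forms\<close>

definition form1_mat :: "(complex^4 \<Rightarrow> complex^4 \<Rightarrow> complex^'n^'m) \<Rightarrow> s7_form^'n^'m" where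
  "form1_mat A = (\<chi> i j. form1 (\<lambda>x v. A x v $ i $ j))"

definition form2_mat :: "(complex^4 \<Rightarrow> complex^4 \<Rightarrow> complex^4 \<Rightarrow> complex^'n^'m) \<Rightarrow> s7_form^'n^'m" where
  "form2_mat B = (\<chi> i j. form2 (\<lambda>x v w. B x v w $ i $ j))"

definition mscale :: "complex \<Rightarrow> complex^'n^'m \<Rightarrow> complex^'n^'m" where
  "mscale c M = (\<chi> i j. c * M $ i $ j)"

lemma mscale_nth [simp]: "mscale c M $ i $ j = c * M $ i $ j"
  by (simp add: mscale_def)

lemma mscale_one [simp]: "mscale 1 M = M"
  by (simp add: mscale_def)

lemma mscale_mult: "mscale c A ** B = mscale c (A ** B)" "A ** mscale c B = mscale c (A ** B)"
  by (simp_all add: vec_eq_iff matrix_matrix_mult_def sum_distrib_left mult_ac)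

lemma mat_nth: "mat c $ i $ j = (if i = j then c else 0)"
  by (simp add: mat_def)

lemma mat_mult_mscale: "mat c ** A = mscale c A"
  by (simp add: vec_eq_iff matrix_matrix_mult_def mat_def if_distrib if_distribR sum.delta cong: if_cong)

lemma phase_simps [simp]: "phase \<theta> 0 r = 1" "phase \<theta> r 0 = 1" "phase \<theta> (- r) r = 1"
  by (simp_all add: phase_def)

lemma form2_mat_sum: "form2_mat A + form2_mat B = form2_mat (\<lambda>x v w. A x v w + B x v w)"
  by (simp add: form2_mat_def vec_eq_iff form_arith)

lemma form2_mat_cong:
  "(\<And>x v w. norm x = 1 \<Longrightarrow> x \<bullet> v = 0 \<Longrightarrow> x \<bullet> w = 0 \<Longrightarrow> A x v w = B x v w) \<Longrightarrow> form2_mat A = form2_mat B"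
  unfolding form2_mat_def by (simp add: vec_eq_iff cong: form2_cong)

lemma homogeneous_form1_mat:
  assumes "\<And>s x v. A (torus_act s x) (torus_act s v) = mscale (torus_char r s) (A x v)"
  shows "homogeneous r (form1 (\<lambda>x v. A x v $ i $ j))"
  by (rule homogeneous_form1) (simp add: assms)

lemma mat_prod_form1_mat:
  fixes A :: "complex^4 \<Rightarrow> complex^4 \<Rightarrow> complex^'k^'m" and B :: "complex^4 \<Rightarrow> complex^4 \<Rightarrow> complex^'n^'k"
  assumes A: "\<And>s x v. A (torus_act s x) (torus_act s v) = mscale (torus_char r s) (A x v)"
    and B: "\<And>s x v. B (torus_act s x) (torus_act s v) = mscale (torus_char q s) (B x v)"
  shows "mat_prod \<theta> (form1_mat A) (form1_mat B)
    = form2_mat (\<lambda>x v w. mscale (phase \<theta> r q) (A x v ** B x w - A x w ** B x v))"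
proof -
  have "(\<Sum>k\<in>UNIV. dprod \<theta> (form1 (\<lambda>x v. A x v $ i $ k)) (form1 (\<lambda>x v. B x v $ k $ j)))
      = form2 (\<lambda>x v w. phase \<theta> r q * (\<Sum>k\<in>UNIV. A x v $ i $ k * B x w $ k $ j - A x w $ i $ k * B x v $ k $ j))" for i j
    unfolding dprod_homogeneous[OF homogeneous_form1_mat[of A r, OF A] homogeneous_form1_mat[of B q, OF B]] wedge_form1_form1
    by (simp only: form_arith sum_form sum_distrib_left)
  then show ?thesis
    by (simp add: mat_prod_def form1_mat_def form2_mat_def vec_eq_iff matrix_matrix_mult_def sum_subtractf)
qed

lemma mat_deriv_form1_mat:
  fixes A :: "complex^4 \<Rightarrow> complex^4 \<Rightarrow> complex^'n^'m"
  assumes "\<And>x i j. linear (\<lambda>v. A x v $ i $ j)"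
    and "\<And>x w i j. norm x = 1 \<Longrightarrow> ((\<lambda>y. A y w $ i $ j) has_derivative (\<lambda>v. D x v w $ i $ j)) (at x)"
  shows "mat_deriv (form1_mat A) = form2_mat (\<lambda>x v w. D x v w - D x w v)"
  using ext_deriv_form1[OF assms]
  by (simp add: mat_deriv_def form1_mat_def form2_mat_def vec_eq_iff)

subsection \<open>The matrix of coordinate functions\<close>

lemma Psi_at_nth:
  "Psi_at x $ 1 $ 1 = x $ 1" "Psi_at x $ 1 $ 2 = - cnj (x $ 2)"
  "Psi_at x $ 2 $ 1 = x $ 2" "Psi_at x $ 2 $ 2 = cnj (x $ 1)"
  "Psi_at x $ 3 $ 1 = x $ 3" "Psi_at x $ 3 $ 2 = - cnj (x $ 4)"
  "Psi_at x $ 4 $ 1 = x $ 4" "Psi_at x $ 4 $ 2 = cnj (x $ 3)"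
  by (simp_all add: Psi_at_def)

lemma Psi_at_torus_act: "Psi_at (torus_act s x) $ k $ i = torus_char (coord_degree k) s * Psi_at x $ k $ i"
proof -
  have "\<forall>k i. Psi_at (torus_act s x) $ k $ i = torus_char (coord_degree k) s * Psi_at x $ k $ i"
    unfolding forall_4 forall_2 Psi_at_nth torus_act_nth
    by (simp add: torus_char_uminus[symmetric])
  then show ?thesis by blast
qed

lemma linear_Psi_at: "linear (\<lambda>x. Psi_at x $ k $ i)"
proof -
  have "\<forall>k i. linear (\<lambda>x. Psi_at x $ k $ i)"
    unfolding forall_4 forall_2 Psi_at_nth
    by (auto intro!: linearI simp: algebra_simps)
  then show ?thesis by blast
qed

text \<open>The entries of \<open>\<Psi>(x)\<^sup>\<dagger> g \<Psi>(y)\<close>.\<close>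

definition sandwich :: "complex^4^4 \<Rightarrow> complex^4 \<Rightarrow> complex^4 \<Rightarrow> complex^2^2" where
  "sandwich g x y = conj_transpose (Psi_at x) ** (g ** Psi_at y)"

lemma sandwich_nth: "sandwich g x y $ i $ j = (\<Sum>k\<in>UNIV. \<Sum>l\<in>UNIV. cnj (Psi_at x $ k $ i) * (g $ k $ l * Psi_at y $ l $ j))"
  by (simp add: sandwich_def matrix_matrix_mult_def conj_transpose_def sum_distrib_left)

lemma sandwich_one: "sandwich (mat 1) x y = conj_transpose (Psi_at x) ** Psi_at y"
  by (simp add: sandwich_def)

lemma bilinear_sandwich: "bilinear (\<lambda>x y. sandwich g x y $ i $ j)"
proof -
  note l = linear_Psi_at
  show ?thesis
    unfolding bilinear_def sandwich_nth
    by (auto intro!: linearI simp: linear_add[OF l] linear_cmul[OF l] sum.distrib scaleR_sum_right algebra_simps)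
qed

lemma bounded_bilinear_sandwich: "bounded_bilinear (\<lambda>x y. sandwich g x y $ i $ j)"
  using bilinear_sandwich bilinear_conv_bounded_bilinear by blast

lemma sandwich_linear:
  "linear (\<lambda>x. sandwich g x y $ i $ j)" "linear (\<lambda>y. sandwich g x y $ i $ j)"
  using bilinear_sandwich[of g i j] by (simp_all add: bilinear_def)

lemma sandwich_add:
  "sandwich g (x + y) z = sandwich g x z + sandwich g y z" "sandwich g z (x + y) = sandwich g z x + sandwich g z y"
  by (simp_all add: vec_eq_iff linear_add[OF sandwich_linear(1)] linear_add[OF sandwich_linear(2)])

lemma has_derivative_sandwich:
  "((\<lambda>y. sandwich g y w $ i $ j) has_derivative (\<lambda>v. sandwich g v w $ i $ j)) (at x)"
  "((\<lambda>y. sandwich g w y $ i $ j) has_derivative (\<lambda>v. sandwich g w v $ i $ j)) (at x)"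
  using sandwich_linear by (auto intro!: bounded_linear_imp_has_derivative simp: linear_conv_bounded_linear[symmetric])

lemma has_derivative_sandwich_diag:
  "((\<lambda>y. sandwich g y y $ i $ j) has_derivative (\<lambda>v. sandwich g x v $ i $ j + sandwich g v x $ i $ j)) (at x)"
  using bounded_bilinear.FDERIV[OF bounded_bilinear_sandwich has_derivative_ident has_derivative_ident] .

text \<open>Row k of Psi has degree \<open>coord_degree k\<close>, so a matrix that raises the
  degree by e from row to column yields a sandwich of degree e.\<close>

lemma sandwich_torus_act:
  assumes "\<And>k l. g $ k $ l \<noteq> 0 \<Longrightarrow> coord_degree l = coord_degree k + e"
  shows "sandwich g (torus_act s x) (torus_act s y) = mscale (torus_char e s) (sandwich g x y)"
proof -
  have "cnj (torus_char (coord_degree k) s * a) * (g $ k $ l * (torus_char (coord_degree l) s * b))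
      = torus_char e s * (cnj a * (g $ k $ l * b))" for k l a b
  proof (cases "g $ k $ l = 0")
    case False
    have "cnj (torus_char (coord_degree k) s * a) * (g $ k $ l * (torus_char (coord_degree l) s * b))
      = (cnj (torus_char (coord_degree k) s) * torus_char (coord_degree k) s) * (torus_char e s * (cnj a * (g $ k $ l * b)))"
      unfolding assms[OF False] torus_char_add complex_cnj_mult by (simp only: mult_ac)
    then show ?thesis by simp
  qed simp
  then show ?thesis
    by (simp only: vec_eq_iff sandwich_nth mscale_nth Psi_at_torus_act sum_distrib_left) simp
qed

lemma sandwich_one_torus_act: "sandwich (mat 1) (torus_act s x) (torus_act s y) = mscale (torus_char 0 s) (sandwich (mat 1) x y)"
  by (rule sandwich_torus_act) (simp add: mat_def split: if_splits)

text \<open>The two columns of Psi are orthogonal and of the same norm. Polarization then makes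
  Psi^H dPsi anti-Hermitian on tangent vectors, as a connection form should be.\<close>

lemma sandwich_one_diag: "sandwich (mat 1) x x = mat (of_real (x \<bullet> x))"
proof -
  have "\<forall>i j. sandwich (mat 1) x x $ i $ j = mat (of_real (x \<bullet> x)) $ i $ j"
    unfolding forall_2 sandwich_one mat_nth
    by (simp add: matrix_matrix_mult_def conj_transpose_def sum_4 Psi_at_nth inner_vec_def
        inner_complex_def complex_eq_iff)
  then show ?thesis by (simp add: vec_eq_iff)
qed

lemma sandwich_one_polar: "sandwich (mat 1) x v + sandwich (mat 1) v x = mat (of_real (2 * (x \<bullet> v)))"
proof -
  have "sandwich (mat 1) (x + v) (x + v) = mat (of_real ((x + v) \<bullet> (x + v)))" by (rule sandwich_one_diag)
  then have "(sandwich (mat 1) x v + sandwich (mat 1) v x) $ i $ j = mat (of_real (2 * (x \<bullet> v))) $ i $ j" for i j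
    unfolding sandwich_add sandwich_one_diag inner_add_left inner_add_right
    by (drule_tac arg_cong[of _ _ "\<lambda>M. M $ i $ j"])
       (cases "i = j"; simp add: mat_nth inner_commute add_ac)
  then show ?thesis by (simp add: vec_eq_iff)
qed

lemma Psi_dagger_nth: "mat_dagger Psi $ i $ k = fn_form (\<lambda>x. cnj (Psi_at x $ k $ i))"
  by (simp add: mat_dagger_def Psi_def form_arith)

lemma dPsi_nth: "mat_deriv Psi $ k $ j = form1 (\<lambda>x v. Psi_at v $ k $ j)"
proof -
  have "((\<lambda>x. Psi_at x $ k $ j) has_derivative (\<lambda>v. Psi_at v $ k $ j)) (at x)" for x
    using linear_Psi_at linear_conv_bounded_linear by (auto intro!: bounded_linear_imp_has_derivative)
  from ext_deriv_fn[OF this] show ?thesis by (simp add: mat_deriv_def Psi_def)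
qed

lemma homogeneous_cnj_Psi_at: "homogeneous (- coord_degree k) (fn_form (\<lambda>x. cnj (Psi_at x $ k $ i)))"
  by (rule homogeneous_fn_form) (simp add: Psi_at_torus_act torus_char_uminus)

text \<open>Row k of Psi^H has degree minus \<open>coord_degree k\<close> and row k of C dPsi has
  degree \<open>coord_degree k + e\<close>, so the k-th term of the matrix product acquires one
  phase. By assumption that phase turns row k of C into c times row k of g, with c independent of
  k.\<close>

lemma Psi_gamma_dPsi:
  assumes deg: "\<And>k l. C $ k $ l \<noteq> 0 \<Longrightarrow> coord_degree l = coord_degree k + e"
    and C: "\<And>k l. phase \<theta> (- coord_degree k) (coord_degree k + e) * C $ k $ l = c * g $ k $ l"
  shows "Psi_gamma_dPsi \<theta> C = form1_mat (\<lambda>x v. mscale c (sandwich g x v))"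
proof -
  have row: "const_mult_left C (mat_deriv Psi) $ k $ j = form1 (\<lambda>x v. \<Sum>l\<in>UNIV. C $ k $ l * Psi_at v $ l $ j)" for k j
    by (simp add: const_mult_left_def dPsi_nth form_arith sum_form)
  have hom: "homogeneous (coord_degree k + e) (form1 (\<lambda>x v. \<Sum>l\<in>UNIV. C $ k $ l * Psi_at v $ l $ j))" for k j
  proof (rule homogeneous_form1)
    fix s and x v :: "complex^4"
    have "C $ k $ l * Psi_at (torus_act s v) $ l $ j = torus_char (coord_degree k + e) s * (C $ k $ l * Psi_at v $ l $ j)" for l
      using deg[of k l] by (cases "C $ k $ l = 0") (simp_all add: Psi_at_torus_act)
    then show "(\<Sum>l\<in>UNIV. C $ k $ l * Psi_at (torus_act s v) $ l $ j)
        = torus_char (coord_degree k + e) s * (\<Sum>l\<in>UNIV. C $ k $ l * Psi_at v $ l $ j)"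
      by (simp only: sum_distrib_left)
  qed
  have "Psi_gamma_dPsi \<theta> C $ i $ j = form1 (\<lambda>x v. c * sandwich g x v $ i $ j)" for i j
  proof -
    have "Psi_gamma_dPsi \<theta> C $ i $ j = (\<Sum>k\<in>UNIV. form1 (\<lambda>x v. phase \<theta> (- coord_degree k) (coord_degree k + e) *
        (cnj (Psi_at x $ k $ i) * (\<Sum>l\<in>UNIV. C $ k $ l * Psi_at v $ l $ j))))"
      by (simp add: Psi_gamma_dPsi_def mat_prod_def row Psi_dagger_nth
          dprod_homogeneous[OF homogeneous_cnj_Psi_at hom] wedge_low form_arith)
    also have "\<dots> = (\<Sum>k\<in>UNIV. form1 (\<lambda>x v. c * (\<Sum>l\<in>UNIV. cnj (Psi_at x $ k $ i) * (g $ k $ l * Psi_at v $ l $ j))))"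
    proof (intro sum.cong refl arg_cong[of _ _ form1] ext)
      fix k x v
      have "phase \<theta> (- coord_degree k) (coord_degree k + e) * (cnj (Psi_at x $ k $ i) * (\<Sum>l\<in>UNIV. C $ k $ l * Psi_at v $ l $ j))
        = (\<Sum>l\<in>UNIV. (phase \<theta> (- coord_degree k) (coord_degree k + e) * C $ k $ l) * (cnj (Psi_at x $ k $ i) * Psi_at v $ l $ j))"
        by (simp only: sum_distrib_left mult_ac)
      also have "\<dots> = c * (\<Sum>l\<in>UNIV. cnj (Psi_at x $ k $ i) * (g $ k $ l * Psi_at v $ l $ j))"
        unfolding C by (simp only: sum_distrib_left mult_ac)
      finally show "phase \<theta> (- coord_degree k) (coord_degree k + e) * (cnj (Psi_at x $ k $ i) * (\<Sum>l\<in>UNIV. C $ k $ l * Psi_at v $ l $ j))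
        = c * (\<Sum>l\<in>UNIV. cnj (Psi_at x $ k $ i) * (g $ k $ l * Psi_at v $ l $ j))" .
    qed
    finally show ?thesis by (simp add: sum_form sandwich_nth sum_distrib_left)
  qed
  then show ?thesis by (simp add: form1_mat_def vec_eq_iff)
qed

text \<open>The case C = 1, e = 0 of the previous lemma, where opposite degrees meet and every phase
  is 1.\<close>

lemma omega_eq: "omega \<theta> = form1_mat (\<lambda>x v. sandwich (mat 1) x v)"
proof -
  have "const_mult_left (mat 1) M = M" for M :: "s7_form^2^4"
  proof -
    have "cscale (if i = k then 1 else 0) (M $ k $ j) = (if k = i then M $ i $ j else 0)" for i j k
      by (simp add: cscale_def fun_eq_iff)
    then show ?thesis by (simp add: const_mult_left_def vec_eq_iff mat_def sum.delta)
  qed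
  then have "omega \<theta> = Psi_gamma_dPsi \<theta> (mat 1)" by (simp add: omega_def Psi_gamma_dPsi_def)
  also have "\<dots> = form1_mat (\<lambda>x v. mscale 1 (sandwich (mat 1) x v))"
    by (rule Psi_gamma_dPsi[where e = 0]) (simp_all add: mat_def split: if_splits)
  finally show ?thesis by (simp add: mscale_def)
qed

section \<open>First-order variation of the curvature\<close>

subsection \<open>Curvature\<close>

definition Psi_proj :: "complex^4 \<Rightarrow> complex^4^4" where
  "Psi_proj x = Psi_at x ** conj_transpose (Psi_at x)"

text \<open>The value of F_0 = d omega + omega^2 on the pair v, w.\<close>

definition basic_curv :: "complex^4 \<Rightarrow> complex^4 \<Rightarrow> complex^4 \<Rightarrow> complex^2^2" where
  "basic_curv x v w =
     sandwich (mat 1) v w - sandwich (mat 1) w v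
     + (sandwich (mat 1) x v ** sandwich (mat 1) x w - sandwich (mat 1) x w ** sandwich (mat 1) x v)"

lemma matrix_add_rdistrib: "(A + B) ** M = A ** M + B ** (M :: 'a::semiring_1^'n^'m)"
  by (simp add: vec_eq_iff matrix_matrix_mult_def distrib_right sum.distrib)

lemma mat_deriv_omega: "mat_deriv (omega \<theta>) = form2_mat (\<lambda>x v w. sandwich (mat 1) v w - sandwich (mat 1) w v)"
  unfolding omega_eq by (rule mat_deriv_form1_mat) (simp_all add: sandwich_linear has_derivative_sandwich)

lemma curvature_coeff_0:
  assumes "A 0 = omega \<theta>"
  shows "curvature_coeff \<theta> A 0 = form2_mat basic_curv"
proof -
  have "mscale 1 M = M" for M :: "complex^2^2" by (simp add: mscale_def)
  then show ?thesis
    using mat_prod_form1_mat[of "sandwich (mat 1)" 0 "sandwich (mat 1)" 0, OF sandwich_one_torus_act sandwich_one_torus_act, of \<theta>]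
    by (simp add: curvature_coeff_def assms mat_deriv_omega[unfolded omega_eq] omega_eq form2_mat_sum basic_curv_def[abs_def])
qed

text \<open>Here g is the untwisted Dirac matrix, C the twisted one, e its degree and c the common
  phase. \<open>diag\<close> says that Psi^H g Psi is a scalar function, and \<open>anticomm\<close>
  is the Clifford relation between g and 2 P - 1, rewritten for the projection P.\<close>

locale conformal_direction =
  fixes \<theta> :: real and g C :: "complex^4^4" and e :: "int \<times> int" and c :: complex
  assumes diag: "sandwich g x x = mat (sandwich g x x $ 1 $ 1)"
    and anticomm: "norm x = 1 \<Longrightarrow> Psi_proj x ** g + g ** Psi_proj x = g + mat (sandwich g x x $ 1 $ 1)"
    and deg: "g $ k $ l \<noteq> 0 \<Longrightarrow> coord_degree l = coord_degree k + e"
    and phase: "phase \<theta> (- coord_degree k) (coord_degree k + e) * C $ k $ l = c * g $ k $ l"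
    and c: "c \<noteq> 0"
begin

definition height :: "complex^4 \<Rightarrow> complex" where
  "height x = sandwich g x x $ 1 $ 1"

definition dheight :: "complex^4 \<Rightarrow> complex^4 \<Rightarrow> complex" where
  "dheight x v = sandwich g x v $ 1 $ 1 + sandwich g v x $ 1 $ 1"

text \<open>The classical infinitesimal deformation with the constant c pulled out.\<close>

definition delta :: "complex^4 \<Rightarrow> complex^4 \<Rightarrow> complex^2^2" where
  "delta x v = mscale c (sandwich g x v - mscale (height x) (sandwich (mat 1) x v) - mat (dheight x v / 2))"

lemma sandwich_polar: "sandwich g x v + sandwich g v x = mat (dheight x v)"
proof -
  have d: "sandwich g y y $ i $ i = sandwich g y y $ 1 $ 1" "i \<noteq> j \<Longrightarrow> sandwich g y y $ i $ j = 0" for y i j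
    using arg_cong[OF diag[of y], of "\<lambda>M. M $ i $ i"] arg_cong[OF diag[of y], of "\<lambda>M. M $ i $ j"]
    by (simp_all add: mat_nth)
  have "(sandwich g x v + sandwich g v x) $ i $ j = mat (dheight x v) $ i $ j" for i j
  proof (cases "i = j")
    case True
    show ?thesis
      using d(1)[of "x + v" i] d(1)[of x i] d(1)[of v i]
      unfolding True sandwich_add vector_add_component mat_nth dheight_def
      by (simp only: refl if_True) algebra
  next
    case False
    show ?thesis
      using d(2)[OF False, of "x + v"] d(2)[OF False, of x] d(2)[OF False, of v] False
      by (simp add: sandwich_add mat_nth add.commute)
  qed
  then show ?thesis by (simp add: vec_eq_iff)
qed

lemma C_degree: "C $ k $ l \<noteq> 0 \<Longrightarrow> coord_degree l = coord_degree k + e"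
proof -
  assume "C $ k $ l \<noteq> 0"
  moreover have "phase \<theta> (- coord_degree k) (coord_degree k + e) \<noteq> 0" by (simp add: phase_def)
  ultimately have "g $ k $ l \<noteq> 0" using phase[of k l] by auto
  then show ?thesis by (rule deg)
qed

lemma g_torus_act: "sandwich g (torus_act s x) (torus_act s y) = mscale (torus_char e s) (sandwich g x y)"
  by (rule sandwich_torus_act) (rule deg)

lemma height_torus_act: "height (torus_act s x) = torus_char e s * height x"
  by (simp add: height_def g_torus_act)

lemma delta_torus_act: "delta (torus_act s x) (torus_act s v) = mscale (torus_char e s) (delta x v)"
  unfolding delta_def height_torus_act dheight_def g_torus_act sandwich_one_torus_act torus_char_zero
  by (simp add: vec_eq_iff mat_nth algebra_simps add_divide_distrib)

lemma has_derivative_height: "((\<lambda>y. c * height y) has_derivative (\<lambda>v. c * dheight x v)) (at x)"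
  unfolding height_def dheight_def by (intro has_derivative_mult_right has_derivative_sandwich_diag)

text \<open>The potential has degree 0, so neither order of the product with z carries a phase and
  both deformations have the same underlying form.\<close>

lemma delta_forms:
  shows "delta_left \<theta> (fn_form (\<lambda>x. c * height x)) C = form1_mat delta"
    and "delta_right \<theta> (fn_form (\<lambda>x. c * height x)) C = form1_mat delta"
proof -
  let ?z = "fn_form (\<lambda>x. c * height x)"
  have z: "homogeneous e ?z" by (rule homogeneous_fn_form) (simp add: height_torus_act)
  note om = homogeneous_form1_mat[of "sandwich (mat 1)" 0, OF sandwich_one_torus_act]
  have P: "Psi_gamma_dPsi \<theta> C = form1_mat (\<lambda>x v. mscale c (sandwich g x v))"
    by (rule Psi_gamma_dPsi[OF C_degree phase])
  have s: "scalar_mat (cscale (1 / 2) (ext_deriv ?z)) $ i $ j = form1 (\<lambda>x v. c * mat (dheight x v / 2) $ i $ j)" for i j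
    by (cases "i = j") (simp_all add: scalar_mat_def ext_deriv_fn[OF has_derivative_height] form_arith mat_nth zero_form(2)[symmetric])
  show "delta_left \<theta> ?z C = form1_mat delta"
    by (simp add: delta_left_def P vec_eq_iff s left_mult_def form1_mat_def omega_eq dprod_homogeneous[OF z om]
        wedge_low form_arith delta_def algebra_simps)
  show "delta_right \<theta> ?z C = form1_mat delta"
    by (simp add: delta_right_def P vec_eq_iff s right_mult_def form1_mat_def omega_eq dprod_homogeneous[OF om z]
        wedge_low form_arith delta_def algebra_simps)
qed

text \<open>The derivative of \<open>delta y w\<close> in y at x along v, by the product rule; the
  exterior derivative antisymmetrizes it in v and w.\<close>

definition ddelta :: "complex^4 \<Rightarrow> complex^4 \<Rightarrow> complex^4 \<Rightarrow> complex^2^2" where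
  "ddelta x v w = mscale c (sandwich g v w
     - (mscale (height x) (sandwich (mat 1) v w) + mscale (dheight x v) (sandwich (mat 1) x w)) - mat (dheight v w / 2))"

lemma dheight_commute: "dheight v w = dheight w v"
  by (simp add: dheight_def)

lemma mat_deriv_delta: "mat_deriv (form1_mat delta) = form2_mat (\<lambda>x v w. ddelta x v w - ddelta x w v)"
proof (rule mat_deriv_form1_mat)
  note l = sandwich_linear(2)
  show "linear (\<lambda>v. delta x v $ i $ j)" for x i j
    by (rule linearI)
       (simp_all add: delta_def dheight_def mat_nth linear_add[OF l] linear_cmul[OF l] linear_add[OF sandwich_linear(1)]
         linear_cmul[OF sandwich_linear(1)] scaleR_conv_of_real[where 'a = complex] algebra_simps add_divide_distrib)
  have h: "(height has_derivative (\<lambda>v. dheight x v)) (at x)" for x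
    unfolding height_def[abs_def] dheight_def by (rule has_derivative_sandwich_diag)
  have dh: "((\<lambda>y. mat (dheight y w / 2) $ i $ j) has_derivative (\<lambda>v. mat (dheight v w / 2) $ i $ j)) (at x)"
    for x w and i j :: 2
    unfolding dheight_def mat_nth
    by (cases "i = j") (auto intro!: derivative_eq_intros has_derivative_sandwich)
  show "((\<lambda>y. delta y w $ i $ j) has_derivative (\<lambda>v. ddelta x v w $ i $ j)) (at x)" for x w i j
    unfolding delta_def ddelta_def mscale_nth vector_minus_component vector_add_component
    by (intro has_derivative_mult_right has_derivative_diff has_derivative_sandwich has_derivative_mult h dh)
qed

text \<open>The covariant derivative of \<open>\<delta>\<close>, before antisymmetrization in \<open>v\<close> and \<open>w\<close>. The
  anticommutation relation removes \<open>g\<close> from it.\<close>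

lemma covariant_delta:
  assumes "norm x = 1" "x \<bullet> v = 0"
  shows "sandwich (mat 1) x v ** sandwich g x w + sandwich g x v ** sandwich (mat 1) x w
    = mscale (dheight x v) (sandwich (mat 1) x w) - sandwich g v w - mscale (height x) (sandwich (mat 1) v w)"
proof -
  let ?X = "Psi_at x" and ?V = "Psi_at v" and ?W = "Psi_at w"
  let ?Xd = "conj_transpose (Psi_at x)" and ?Vd = "conj_transpose (Psi_at v)"
  \<comment> \<open>Exchanges Psi(x)^H Psi(v) for -Psi(v)^H Psi(x), which holds for tangent v, so
    that P appears in the middle in \<open>3\<close>. The claim is then \<open>1\<close> plus
    \<open>2\<close> minus \<open>3\<close>.\<close>
  have 1: "sandwich (mat 1) x v ** sandwich g x w + sandwich (mat 1) v x ** sandwich g x w = 0"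
  proof -
    have "sandwich (mat 1) x v + sandwich (mat 1) v x = mat 0"
      using sandwich_one_polar[of x v] assms(2) by simp
    then show ?thesis
      by (simp add: matrix_add_rdistrib[symmetric] mat_mult_mscale)
  qed
  have 2: "sandwich g x v ** sandwich (mat 1) x w + sandwich g v x ** sandwich (mat 1) x w
      = mscale (dheight x v) (sandwich (mat 1) x w)"
    by (simp add: matrix_add_rdistrib[symmetric] sandwich_polar mat_mult_mscale)
  have 3: "sandwich (mat 1) v x ** sandwich g x w + sandwich g v x ** sandwich (mat 1) x w
      = sandwich g v w + mscale (height x) (sandwich (mat 1) v w)"
  proof -
    have "sandwich (mat 1) v x ** sandwich g x w + sandwich g v x ** sandwich (mat 1) x w
      = ?Vd ** ((Psi_proj x ** g + g ** Psi_proj x) ** ?W)"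
      by (simp add: sandwich_def Psi_proj_def matrix_mul_assoc matrix_add_ldistrib matrix_add_rdistrib)
    also have "\<dots> = sandwich g v w + mscale (height x) (sandwich (mat 1) v w)"
      unfolding anticomm[OF assms(1)] height_def[symmetric]
      by (simp add: sandwich_def matrix_add_ldistrib matrix_add_rdistrib mat_mult_mscale mscale_mult)
    finally show ?thesis .
  qed
  show ?thesis
    unfolding vec_eq_iff
  proof (intro allI)
    fix i j
    note u = vec_eq_iff vector_add_component zero_index
    show "(sandwich (mat 1) x v ** sandwich g x w + sandwich g x v ** sandwich (mat 1) x w) $ i $ j
      = (mscale (dheight x v) (sandwich (mat 1) x w) - sandwich g v w - mscale (height x) (sandwich (mat 1) v w)) $ i $ j"
      using 1[unfolded u, rule_format, of i j] 2[unfolded u, rule_format, of i j] 3[unfolded u, rule_format, of i j]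
      unfolding vector_add_component vector_minus_component by algebra
  qed
qed

text \<open>The g-terms of the derivative cancel against those of the commutator with omega, by
  \<open>covariant_delta\<close>. What survives antisymmetrization is -2 c h times d omega +
  omega^2.\<close>

lemma curvature_coeff_1:
  assumes "A 0 = omega \<theta>" "A 1 = form1_mat delta"
  shows "curvature_coeff \<theta> A 1 = form2_mat (\<lambda>x v w. mscale (- 2 * c * height x) (basic_curv x v w))"
proof -
  let ?o = "sandwich (mat 1)"
  have m1: "mscale 1 M = M" for M :: "complex^2^2" by (simp add: mscale_def)
  have "curvature_coeff \<theta> A 1 = mat_deriv (form1_mat delta)
      + (mat_prod \<theta> (form1_mat ?o) (form1_mat delta) + mat_prod \<theta> (form1_mat delta) (form1_mat ?o))"
    using assms by (simp add: curvature_coeff_def omega_eq)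
  also have "\<dots> = form2_mat (\<lambda>x v w. ddelta x v w - ddelta x w v
      + ((?o x v ** delta x w - ?o x w ** delta x v) + (delta x v ** ?o x w - delta x w ** ?o x v)))"
    unfolding mat_deriv_delta mat_prod_form1_mat[of ?o 0 delta e, OF sandwich_one_torus_act delta_torus_act]
      mat_prod_form1_mat[of delta e ?o 0, OF delta_torus_act sandwich_one_torus_act] phase_simps m1 form2_mat_sum ..
  also have "\<dots> = form2_mat (\<lambda>x v w. mscale (- 2 * c * height x) (basic_curv x v w))"
  proof (rule form2_mat_cong)
    fix x v w :: "complex^4" assume x: "norm x = 1" and vw: "x \<bullet> v = 0" "x \<bullet> w = 0"
    have expand: "?o x a ** delta x b + delta x a ** ?o x b
      = mscale c (?o x a ** sandwich g x b + sandwich g x a ** ?o x b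
          - mscale (2 * height x) (?o x a ** ?o x b) - mscale (dheight x b / 2) (?o x a) - mscale (dheight x a / 2) (?o x b))" for a b
    proof -
      have dl: "M ** (A - B - D) = M ** A - M ** B - M ** D" "(A - B - D) ** M = A ** M - B ** M - D ** M"
        for M A B D :: "complex^2^2"
        by (simp_all add: vec_eq_iff matrix_matrix_mult_def algebra_simps sum_subtractf sum.distrib)
      have "M ** mat k = mscale k M" for M :: "complex^2^2" and k
        by (simp add: vec_eq_iff matrix_matrix_mult_def mat_def if_distrib if_distribR sum.delta cong: if_cong)
      then show ?thesis
        unfolding delta_def mscale_mult dl mat_mult_mscale
        by (simp add: vec_eq_iff algebra_simps)
    qed
    \<comment> \<open>Besides the multiple of the curvature terms, everything on the right is
      symmetric in a and b.\<close>
    have half: "ddelta x a b + (?o x a ** delta x b + delta x a ** ?o x b)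
      = mscale c (mscale (- 2 * height x) (?o a b + ?o x a ** ?o x b)
          - (mscale (dheight x b / 2) (?o x a) + mscale (dheight x a / 2) (?o x b)) - mat (dheight a b / 2))"
      if "x \<bullet> a = 0" for a b
      unfolding expand covariant_delta[OF x that] ddelta_def
      by (simp add: vec_eq_iff algebra_simps)
    have "ddelta x v w - ddelta x w v + ((?o x v ** delta x w - ?o x w ** delta x v) + (delta x v ** ?o x w - delta x w ** ?o x v))
      = (ddelta x v w + (?o x v ** delta x w + delta x v ** ?o x w)) - (ddelta x w v + (?o x w ** delta x v + delta x w ** ?o x v))"
      by (simp add: algebra_simps)
    also have "\<dots> = mscale (- 2 * c * height x) (basic_curv x v w)"
      unfolding half[OF vw(1)] half[OF vw(2)] dheight_commute[of w v] basic_curv_def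
      by (simp add: vec_eq_iff algebra_simps)
    finally show "ddelta x v w - ddelta x w v + ((?o x v ** delta x w - ?o x w ** delta x v) + (delta x v ** ?o x w - delta x w ** ?o x v))
      = mscale (- 2 * c * height x) (basic_curv x v w)" .
  qed
  finally show ?thesis .
qed

end

section \<open>Clifford algebra of R^5 and the curvature of the basic instanton\<close>

subsection \<open>Spinor projections on the 4-sphere\<close>

text \<open>The Clifford map on four-component spinors: linear in p, with square |p|^2.\<close>

definition Gam :: "real^5 \<Rightarrow> complex^4^4" where
  "Gam p = (let w = Complex (p $ 2) (p $ 3); y = Complex (p $ 4) (p $ 5) in
     vector [vector [of_real (p $ 1), 0, w, - cnj y], vector [0, of_real (p $ 1), y, cnj w],
             vector [cnj w, cnj y, - of_real (p $ 1), 0], vector [- y, w, 0, - of_real (p $ 1)]])"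

lemma Gam_nth:
  "Gam p $ 1 $ 1 = Complex (p $ 1) 0" "Gam p $ 1 $ 2 = 0" "Gam p $ 1 $ 3 = Complex (p $ 2) (p $ 3)" "Gam p $ 1 $ 4 = Complex (- p $ 4) (p $ 5)"
  "Gam p $ 2 $ 1 = 0" "Gam p $ 2 $ 2 = Complex (p $ 1) 0" "Gam p $ 2 $ 3 = Complex (p $ 4) (p $ 5)" "Gam p $ 2 $ 4 = Complex (p $ 2) (- p $ 3)"
  "Gam p $ 3 $ 1 = Complex (p $ 2) (- p $ 3)" "Gam p $ 3 $ 2 = Complex (p $ 4) (- p $ 5)" "Gam p $ 3 $ 3 = Complex (- p $ 1) 0" "Gam p $ 3 $ 4 = 0"
  "Gam p $ 4 $ 1 = Complex (- p $ 4) (- p $ 5)" "Gam p $ 4 $ 2 = Complex (p $ 2) (p $ 3)" "Gam p $ 4 $ 3 = 0" "Gam p $ 4 $ 4 = Complex (- p $ 1) 0"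
  by (simp_all add: Gam_def Let_def complex_eq_iff)

definition Gam_proj :: "real^5 \<Rightarrow> complex^4^4" where
  "Gam_proj p = mscale (1 / 2) (mat 1 + Gam p)"

text \<open>Identifies the range of Psi(x) with the +1 eigenspace of \<open>Gam (hopf x)\<close>;
  the projection depends only on the image point in the 4-sphere.\<close>

lemma Psi_proj_hopf:
  assumes "norm x = 1" shows "Psi_proj x = Gam_proj (hopf x)"
proof -
  have "\<forall>a b. Psi_proj x $ a $ b = Gam_proj (hopf x) $ a $ b"
    using assms
    unfolding forall_4 Psi_proj_def Gam_proj_def unit_complex4
    by (simp add: matrix_matrix_mult_def conj_transpose_def sum_2 Psi_at_nth mat_nth Gam_nth hopf_Re_Im complex_eq_iff)
       (intro conjI; unfold power2_eq_square; linarith)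
  then show ?thesis by (simp add: vec_eq_iff)
qed

text \<open>This is the derivative of the previous identity along a tangent vector: dP = Gam(dp) /
  2.\<close>

lemma Gam_hopf_deriv:
  assumes "norm x = 1" "x \<bullet> v = 0"
  shows "mscale (1 / 2) (Gam (hopf_deriv x v))
    = Psi_at v ** conj_transpose (Psi_at x) + Psi_at x ** conj_transpose (Psi_at v)"
proof -
  have "\<forall>a b. mscale (1 / 2) (Gam (hopf_deriv x v)) $ a $ b
    = (Psi_at v ** conj_transpose (Psi_at x) + Psi_at x ** conj_transpose (Psi_at v)) $ a $ b"
    using assms
    unfolding forall_4 unit_complex4 inner_complex4
    by (simp add: matrix_matrix_mult_def conj_transpose_def sum_2 Psi_at_nth mat_nth Gam_nth hopf_deriv_Re_Im complex_eq_iff)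
       (intro conjI; algebra)
  then show ?thesis by (simp add: vec_eq_iff)
qed

lemma Gam_square: "Gam p ** Gam p = mat (of_real (p \<bullet> p))"
proof -
  have "\<forall>a b. (Gam p ** Gam p) $ a $ b = mat (of_real (p \<bullet> p)) $ a $ b"
    unfolding forall_4
    by (simp add: matrix_matrix_mult_def sum_4 mat_nth Gam_nth complex_eq_iff inner_vec_def[where 'a = real] sum_5)
  then show ?thesis by (simp add: vec_eq_iff)
qed

lemma Gam_proj_Gam:
  assumes "norm p = 1" shows "Gam_proj p ** Gam p = Gam_proj p"
proof -
  have "p \<bullet> p = 1" using assms by (simp add: norm_eq_1)
  then show ?thesis
    by (simp add: Gam_proj_def mscale_mult matrix_add_rdistrib Gam_square add.commute)
qed

lemma linear_Gam: "linear (\<lambda>p. Gam p $ a $ b)"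
proof -
  have "\<forall>a b. linear (\<lambda>p. Gam p $ a $ b)"
    unfolding forall_4 Gam_nth
    by (auto intro!: linearI simp: complex_eq_iff algebra_simps)
  then show ?thesis by blast
qed

definition Gam_comm :: "real^5 \<Rightarrow> real^5 \<Rightarrow> complex^4^4" where
  "Gam_comm u v = Gam u ** Gam v - Gam v ** Gam u"

text \<open>The curvature P [dP, dP] of the projection P, with dP = Gam / 2 accounting for the
  factor 1/4.\<close>

definition spin_curv :: "real^5 \<Rightarrow> real^5 \<Rightarrow> real^5 \<Rightarrow> complex^4^4" where
  "spin_curv p u v = mscale (1 / 4) (Gam_proj p ** Gam_comm u v)"

lemma Psi_dagger_Psi:
  assumes "norm x = 1" shows "conj_transpose (Psi_at x) ** Psi_at x = mat 1"
  using sandwich_one_diag[of x] assms by (simp add: sandwich_one norm_eq_1)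

text \<open>The curvature of the connection Psi^H dPsi is that of the projection P compressed by
  Psi. The proof expands dP = dPsi Psi^H + Psi dPsi^H and uses Psi^H Psi = 1.\<close>

lemma basic_curv_spin_curv:
  assumes x: "norm x = 1" and vw: "x \<bullet> v = 0" "x \<bullet> w = 0"
  shows "basic_curv x v w = sandwich (spin_curv (hopf x) (hopf_deriv x v) (hopf_deriv x w)) x x"
proof -
  let ?X = "Psi_at x" and ?V = "Psi_at v" and ?W = "Psi_at w"
  let ?Xd = "conj_transpose (Psi_at x)" and ?Vd = "conj_transpose (Psi_at v)" and ?Wd = "conj_transpose (Psi_at w)"
  let ?o = "sandwich (mat 1)"
  note one = Psi_dagger_Psi[OF x]
  define A B where "A = ?V ** ?Xd + ?X ** ?Vd" and "B = ?W ** ?Xd + ?X ** ?Wd"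
  have half: "Gam_comm (hopf_deriv x v) (hopf_deriv x w) = mscale 4 (A ** B - B ** A)"
  proof -
    have AB: "Gam (hopf_deriv x v) = mscale 2 A" "Gam (hopf_deriv x w) = mscale 2 B"
      using Gam_hopf_deriv[OF x vw(1)] Gam_hopf_deriv[OF x vw(2)]
      by (auto simp: A_def B_def vec_eq_iff field_simps)
    show ?thesis unfolding Gam_comm_def AB mscale_mult by (simp add: vec_eq_iff)
  qed
  have left: "?Xd ** Gam_proj (hopf x) = ?Xd"
    by (simp only: Psi_proj_hopf[OF x, symmetric] Psi_proj_def matrix_mul_assoc one matrix_mul_lid)
  have XA: "?Xd ** A = ?o x v ** ?Xd + ?Vd" "?Xd ** B = ?o x w ** ?Xd + ?Wd"
    unfolding A_def B_def matrix_add_ldistrib matrix_mul_assoc one by (simp_all add: sandwich_one)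
  have AX: "A ** ?X = ?V + ?X ** ?o v x" "B ** ?X = ?W + ?X ** ?o w x"
    unfolding A_def B_def matrix_add_rdistrib matrix_mul_assoc[symmetric] one by (simp_all add: sandwich_one)
  \<comment> \<open>The two terms ending in Psi(b)^H Psi(x) cancel, because Psi(x)^H Psi(a) is minus
    Psi(a)^H Psi(x) for tangent a.\<close>
  have prod: "?Xd ** (A' ** B') ** ?X = ?o x a ** ?o x b + ?o a b"
    if A': "?Xd ** A' = ?o x a ** ?Xd + conj_transpose (Psi_at a)" and B': "B' ** ?X = Psi_at b + ?X ** ?o b x"
      and a: "x \<bullet> a = 0" for A' B' a b
  proof -
    have "?Xd ** (A' ** B') ** ?X = (?Xd ** A') ** (B' ** ?X)" by (simp add: matrix_mul_assoc)
    also have "\<dots> = ?o x a ** (?Xd ** Psi_at b) + ?o x a ** (?Xd ** ?X) ** ?o b x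
        + conj_transpose (Psi_at a) ** Psi_at b + (conj_transpose (Psi_at a) ** ?X) ** ?o b x"
      unfolding A' B' by (simp add: matrix_add_ldistrib matrix_add_rdistrib matrix_mul_assoc add_ac)
    also have "\<dots> = ?o x a ** ?o x b + ?o a b + (?o x a + ?o a x) ** ?o b x"
      unfolding one matrix_mul_rid by (simp add: sandwich_one[symmetric] matrix_add_rdistrib add_ac)
    also have "?o x a + ?o a x = mat 0"
      using sandwich_one_polar[of x a] a by simp
    finally show ?thesis by (simp add: mat_mult_mscale vec_eq_iff)
  qed
  have sub: "M ** (D - E) ** N = M ** D ** N - M ** E ** N" for M :: "complex^4^2" and D E :: "complex^4^4" and N :: "complex^2^4"
    by (simp add: vec_eq_iff matrix_matrix_mult_def sum_distrib_right algebra_simps sum_subtractf)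
  have "sandwich (spin_curv (hopf x) (hopf_deriv x v) (hopf_deriv x w)) x x
      = mscale (1 / 4) ((?Xd ** Gam_proj (hopf x)) ** Gam_comm (hopf_deriv x v) (hopf_deriv x w) ** ?X)"
    by (simp add: sandwich_def spin_curv_def mscale_mult matrix_mul_assoc)
  also have "\<dots> = ?Xd ** (A ** B - B ** A) ** ?X"
    unfolding left half mscale_mult by (simp add: vec_eq_iff)
  also have "\<dots> = (?o x v ** ?o x w + ?o v w) - (?o x w ** ?o x v + ?o w v)"
    unfolding sub prod[OF XA(1) AX(2) vw(1)] prod[OF XA(2) AX(1) vw(2)] ..
  finally show ?thesis unfolding basic_curv_def by (simp add: algebra_simps)
qed

text \<open>The trace of Psi(v)^H Psi(w) is symmetric in v and w, and commutators have trace
  zero.\<close>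

lemma basic_curv_trace:
  shows "(\<Sum>i\<in>UNIV. basic_curv x v w $ i $ i) = 0"
proof -
  have "sandwich (mat 1) v w $ 1 $ 1 + sandwich (mat 1) v w $ 2 $ 2 = sandwich (mat 1) w v $ 1 $ 1 + sandwich (mat 1) w v $ 2 $ 2"
    by (simp add: sandwich_one matrix_matrix_mult_def conj_transpose_def sum_4 Psi_at_nth algebra_simps)
  then show ?thesis
    by (simp add: basic_curv_def sum_2 matrix_matrix_mult_def algebra_simps)
qed

section \<open>Self-dual 2-forms on the 4-sphere\<close>

subsection \<open>Self-duality\<close>

text \<open>Laplace expansion of the determinant: q are the 2x2 minors of a, b and m the 3x3 minors
  of p, v, w.\<close>

lemma vol4_expand:
  fixes p v w a b :: "real^5"
  defines "m \<equiv> \<lambda>k l n. p $ k * (v $ l * w $ n - v $ n * w $ l) - p $ l * (v $ k * w $ n - v $ n * w $ k)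
    + p $ n * (v $ k * w $ l - v $ l * w $ k)" and "q \<equiv> \<lambda>i j. a $ i * b $ j - a $ j * b $ i"
  shows "vol4 p [a, b, v, w] = - q 1 2 * m 3 4 5 + q 1 3 * m 2 4 5 - q 1 4 * m 2 3 5 + q 1 5 * m 2 3 4
    - q 2 3 * m 1 4 5 + q 2 4 * m 1 3 5 - q 2 5 * m 1 3 4 - q 3 4 * m 1 2 5 + q 3 5 * m 1 2 4 - q 4 5 * m 1 2 3"
proof -
  have f: "finite {2::5, 3, 4, 5}" "1 \<notin> {2::5, 3, 4, 5}" "finite {3::5, 4, 5}" "2 \<notin> {3::5, 4, 5}"
    "finite {4::5, 5}" "3 \<notin> {4::5, 5}" "finite {5::5}" "4 \<notin> {5::5}"
    by auto
  note u = sum_over_permutations_insert[OF f(1,2)] sum_over_permutations_insert[OF f(3,4)]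
      sum_over_permutations_insert[OF f(5,6)] sum_over_permutations_insert[OF f(7,8)] permutes_sing
  note s = sign_swap_id permutation_swap_id permutation_compose sign_compose swap_id_eq
  show ?thesis
    unfolding vol4_def det_def UNIV_5 u by (simp add: s m_def q_def algebra_simps del: One_nat_def)
qed

lemma vol4_axis:
  fixes p v w :: "real^5"
  defines "m \<equiv> \<lambda>k l n. p $ k * (v $ l * w $ n - v $ n * w $ l) - p $ l * (v $ k * w $ n - v $ n * w $ k)
    + p $ n * (v $ k * w $ l - v $ l * w $ k)"
  shows "vol4 p [axis 1 1, axis 2 1, v, w] = - m 3 4 5" "vol4 p [axis 1 1, axis 3 1, v, w] = m 2 4 5"
    "vol4 p [axis 1 1, axis 4 1, v, w] = - m 2 3 5" "vol4 p [axis 1 1, axis 5 1, v, w] = m 2 3 4"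
    "vol4 p [axis 2 1, axis 3 1, v, w] = - m 1 4 5" "vol4 p [axis 2 1, axis 4 1, v, w] = m 1 3 5"
    "vol4 p [axis 2 1, axis 5 1, v, w] = - m 1 3 4" "vol4 p [axis 3 1, axis 4 1, v, w] = - m 1 2 5"
    "vol4 p [axis 3 1, axis 5 1, v, w] = m 1 2 4" "vol4 p [axis 4 1, axis 5 1, v, w] = - m 1 2 3"
  by (simp_all add: vol4_expand m_def axis_def)

lemma vol4_alternating:
  "vol4 p [u, u, v, w] = 0" "vol4 p [p, u, v, w] = 0" "vol4 p [u, p, v, w] = 0"
  by (simp_all add: vol4_expand algebra_simps)

lemma linear_vol4_slots:
  "linear (\<lambda>u. vol4 p [u, u', v, w])" "linear (\<lambda>u'. vol4 p [u, u', v, w])"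
  using linear_vol4[of "[]" "[u', v, w]" p] linear_vol4[of "[u]" "[v, w]" p] by simp_all

lemma vol4_swap: "vol4 p [u', u, v, w] = - vol4 p [u, u', v, w]"
  by (simp add: vol4_expand algebra_simps)

lemma sum_Basis_real5: "(\<Sum>b\<in>Basis. f (b :: real^5)) = (\<Sum>i\<in>UNIV. f (axis i 1))"
proof -
  have B: "(Basis :: (real^5) set) = range (\<lambda>i. axis i 1)"
    by (auto simp: Basis_vec_def)
  have I: "inj (\<lambda>i. axis i 1 :: real^5)"
    by (auto simp: inj_def axis_eq_axis)
  show ?thesis by (simp only: B sum.reindex[OF I] o_def)
qed

lemma Gam_comm_swap: "Gam_comm v u = - Gam_comm u v"
  by (simp add: Gam_comm_def)

text \<open>The bracket on the right is twice the antisymmetrized product of \<open>Gam p\<close>,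
  \<open>Gam v\<close>, \<open>Gam w\<close>. In dimension five it is dual to a combination of
  commutators because the product of all five generators is a scalar; the sign of that scalar
  decides which orientation makes F_0 self-dual.\<close>

lemma sum_Gam_comm_vol4:
  "(\<Sum>b\<in>Basis. \<Sum>b'\<in>Basis. of_real (vol4 p [b, b', v, w]) * Gam_comm b b' $ a $ c)
    = 2 * ((Gam p ** Gam_comm v w) $ a $ c - 2 * of_real (p \<bullet> v) * Gam w $ a $ c + 2 * of_real (p \<bullet> w) * Gam v $ a $ c)"
proof -
  let ?t = "\<lambda>i j. of_real (vol4 p [axis i 1, axis j 1, v, w]) * Gam_comm (axis i 1) (axis j 1) $ a $ c"
  have sym: "?t j i = ?t i j" for i j
    by (simp add: vol4_swap[of p "axis j 1" "axis i 1"] Gam_comm_swap[of "axis j 1" "axis i 1"])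
  have dg: "?t i i = 0" for i by (simp add: vol4_alternating)
  have "(\<Sum>b\<in>Basis. \<Sum>b'\<in>Basis. of_real (vol4 p [b, b', v, w]) * Gam_comm b b' $ a $ c)
    = 2 * (?t 1 2 + ?t 1 3 + ?t 1 4 + ?t 1 5 + ?t 2 3 + ?t 2 4 + ?t 2 5 + ?t 3 4 + ?t 3 5 + ?t 4 5)"
    unfolding sum_Basis_real5 sum_5 dg
      sym[of 2 1] sym[of 3 1] sym[of 4 1] sym[of 5 1] sym[of 3 2] sym[of 4 2] sym[of 5 2] sym[of 4 3] sym[of 5 3] sym[of 5 4]
    by simp
  moreover have "\<forall>a c. of_real (vol4 p [axis 1 1, axis 2 1, v, w]) * Gam_comm (axis 1 1) (axis 2 1) $ a $ c
     + of_real (vol4 p [axis 1 1, axis 3 1, v, w]) * Gam_comm (axis 1 1) (axis 3 1) $ a $ c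
     + of_real (vol4 p [axis 1 1, axis 4 1, v, w]) * Gam_comm (axis 1 1) (axis 4 1) $ a $ c
     + of_real (vol4 p [axis 1 1, axis 5 1, v, w]) * Gam_comm (axis 1 1) (axis 5 1) $ a $ c
     + of_real (vol4 p [axis 2 1, axis 3 1, v, w]) * Gam_comm (axis 2 1) (axis 3 1) $ a $ c
     + of_real (vol4 p [axis 2 1, axis 4 1, v, w]) * Gam_comm (axis 2 1) (axis 4 1) $ a $ c
     + of_real (vol4 p [axis 2 1, axis 5 1, v, w]) * Gam_comm (axis 2 1) (axis 5 1) $ a $ c
     + of_real (vol4 p [axis 3 1, axis 4 1, v, w]) * Gam_comm (axis 3 1) (axis 4 1) $ a $ c
     + of_real (vol4 p [axis 3 1, axis 5 1, v, w]) * Gam_comm (axis 3 1) (axis 5 1) $ a $ c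
     + of_real (vol4 p [axis 4 1, axis 5 1, v, w]) * Gam_comm (axis 4 1) (axis 5 1) $ a $ c
    = (Gam p ** Gam_comm v w) $ a $ c - 2 * of_real (p \<bullet> v) * Gam w $ a $ c + 2 * of_real (p \<bullet> w) * Gam v $ a $ c"
    unfolding forall_4 vol4_axis
    by (intro conjI; simp add: Gam_comm_def matrix_matrix_mult_def sum_4 Gam_nth axis_def complex_eq_iff
        inner_vec_def[where 'a = real] sum_5; algebra)
  ultimately show ?thesis by simp
qed

text \<open>In \<open>hodge4\<close> the basis is projected to the tangent space. The volume form
  contains p already, so components along p contribute nothing and the sum can be taken over the
  unprojected basis.\<close>

lemma hodge4_form2:
  fixes \<beta> :: "real^5 \<Rightarrow> real^5 \<Rightarrow> real^5 \<Rightarrow> complex"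
  assumes lin: "\<And>p u'. linear (\<lambda>u. \<beta> p u u')" "\<And>p u. linear (\<beta> p u)"
    and key: "\<And>p v w. norm p = 1 \<Longrightarrow> p \<bullet> v = 0 \<Longrightarrow> p \<bullet> w = 0 \<Longrightarrow>
      (\<Sum>b\<in>Basis. \<Sum>b'\<in>Basis. of_real (vol4 p [b, b', v, w]) * \<beta> p b b') = 2 * \<beta> p v w"
  shows "hodge4 (form2 \<beta>) = form2 \<beta>"
proof (intro ext)
  fix p :: "real^5" and vs
  show "hodge4 (form2 \<beta>) p vs = form2 \<beta> p vs"
  proof (cases "sphere_tangent p vs \<and> length vs \<le> 4")
    case False
    then show ?thesis
      by (auto simp: hodge4_def on_sphere_def form_not_tangent form2_length)
  next
    case True
    then have p: "norm p = 1" by (simp add: sphere_tangent_def)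
    show ?thesis
    proof (cases "length vs = 2")
      case False
      then have "form2 \<beta> p (map (tangent_proj p) bs) = 0" if "bs \<in> basis_lists (4 - length vs)" for bs
        using that True by (intro form2_length) (auto simp: basis_lists_def)
      then show ?thesis using True False
        by (simp add: hodge4_tangent form2_length)
    next
      case 2: True
      then obtain v w where vs: "vs = [v, w]" by (auto simp: numeral_2_eq_2 length_Suc_conv)
      have vw: "p \<bullet> v = 0" "p \<bullet> w = 0" using True by (auto simp: vs sphere_tangent_simps)
      let ?V = "\<lambda>b b'. complex_of_real (vol4 p [b, b', v, w])"
      let ?P = "tangent_proj p"
      note l = linear_vol4_slots[of p]
      have vol: "vol4 p [?P b, ?P b', v, w] = vol4 p [b, b', v, w]" for b b'
        unfolding tangent_proj_def linear_diff[OF l(1)] linear_diff[OF l(2)] linear_cmul[OF l(1)] linear_cmul[OF l(2)]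
        by (simp add: vol4_alternating)
      have kill1: "(\<Sum>b\<in>Basis. of_real (p \<bullet> b) * ?V b b') = 0" for b'
      proof -
        have "(\<Sum>b\<in>Basis. (p \<bullet> b) *\<^sub>R vol4 p [b, b', v, w]) = 0"
          using euclidean_linear_expand[OF l(1), of p b' v w] by (simp add: vol4_alternating)
        then have "complex_of_real (\<Sum>b\<in>Basis. (p \<bullet> b) * vol4 p [b, b', v, w]) = 0" by simp
        then show ?thesis by simp
      qed
      have kill2: "(\<Sum>b'\<in>Basis. of_real (p \<bullet> b') * ?V b b') = 0" for b
        using kill1[of b] by (simp add: vol4_swap[of p b] sum_negf)
      have expand: "\<beta> p (?P b) u = \<beta> p b u - of_real (p \<bullet> b) * \<beta> p p u"
        "\<beta> p u (?P b) = \<beta> p u b - of_real (p \<bullet> b) * \<beta> p u p" for b u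
        by (simp_all add: tangent_proj_def linear_diff[OF lin(1)] linear_diff[OF lin(2)] linear_cmul[OF lin(1)]
            linear_cmul[OF lin(2)] scaleR_conv_of_real[where 'a = complex])
      have "hodge4 (form2 \<beta>) p vs = (\<Sum>b\<in>Basis. \<Sum>b'\<in>Basis. \<beta> p (?P b) (?P b') * ?V b b') / 2"
        using hodge4_tangent[of p vs "form2 \<beta>"] True
        by (simp add: vs sum_basis_lists_Suc sum_basis_lists_0 form2_pair p tangent_proj_tangent vol numeral_2_eq_2)
      also have "(\<Sum>b\<in>Basis. \<Sum>b'\<in>Basis. \<beta> p (?P b) (?P b') * ?V b b')
        = (\<Sum>b\<in>Basis. \<Sum>b'\<in>Basis. \<beta> p b (?P b') * ?V b b')
          - (\<Sum>b'\<in>Basis. \<beta> p p (?P b') * (\<Sum>b\<in>Basis. of_real (p \<bullet> b) * ?V b b'))"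
        unfolding expand(1)
        by (simp add: left_diff_distrib right_diff_distrib sum_subtractf sum_distrib_left mult_ac) (rule sum.swap)
      also have "\<dots> = (\<Sum>b\<in>Basis. \<Sum>b'\<in>Basis. \<beta> p b (?P b') * ?V b b')"
        unfolding kill1 by simp
      also have "\<dots> = (\<Sum>b\<in>Basis. \<Sum>b'\<in>Basis. \<beta> p b b' * ?V b b')
          - (\<Sum>b\<in>Basis. \<beta> p b p * (\<Sum>b'\<in>Basis. of_real (p \<bullet> b') * ?V b b'))"
        unfolding expand(2)
        by (simp add: left_diff_distrib right_diff_distrib sum_subtractf sum_distrib_left mult_ac)
      also have "\<dots> = 2 * \<beta> p v w"
        unfolding kill2 using key[OF p vw] by (simp add: mult.commute)
      finally show ?thesis by (simp add: vs form2_pair p vw)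
    qed
  qed
qed

lemma Gam_comm_linear: "linear (\<lambda>u. Gam_comm u w $ a $ b)" "linear (\<lambda>w. Gam_comm u w $ a $ b)"
  by (rule linearI; simp add: Gam_comm_def matrix_matrix_mult_def linear_add[OF linear_Gam] linear_cmul[OF linear_Gam]
      scaleR_conv_of_real[where 'a = complex] distrib_left distrib_right sum.distrib sum_distrib_left sum_subtractf right_diff_distrib mult_ac)+

lemma spin_curv_nth: "spin_curv p u w $ a $ b = 1 / 4 * (\<Sum>m\<in>UNIV. Gam_proj p $ a $ m * Gam_comm u w $ m $ b)"
  by (simp add: spin_curv_def matrix_matrix_mult_def)

lemma spin_curv_linear: "linear (\<lambda>u. spin_curv p u w $ a $ b)" "linear (\<lambda>w. spin_curv p u w $ a $ b)"
  by (rule linearI; simp add: spin_curv_nth linear_add[OF Gam_comm_linear(1)] linear_cmul[OF Gam_comm_linear(1)]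
      linear_add[OF Gam_comm_linear(2)] linear_cmul[OF Gam_comm_linear(2)]
      scaleR_conv_of_real[where 'a = complex] distrib_left sum.distrib sum_distrib_left mult_ac)+

lemma spin_curv_swap: "spin_curv p w u $ a $ b = - spin_curv p u w $ a $ b"
  by (simp add: spin_curv_nth Gam_comm_swap[of w u] sum_negf)

text \<open>On tangent vectors the dual of the commutator is \<open>Gam p\<close> times the
  commutator, and the spinor projection absorbs \<open>Gam p\<close>.\<close>

lemma spin_curv_self_dual:
  assumes p: "norm p = 1" and vw: "p \<bullet> v = 0" "p \<bullet> w = 0"
  shows "(\<Sum>b\<in>Basis. \<Sum>b'\<in>Basis. of_real (vol4 p [b, b', v, w]) * spin_curv p b b' $ a $ c) = 2 * spin_curv p v w $ a $ c"
proof -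
  have "(\<Sum>b\<in>Basis. \<Sum>b'\<in>Basis. of_real (vol4 p [b, b', v, w]) * spin_curv p b b' $ a $ c)
    = (\<Sum>b\<in>Basis. \<Sum>b'\<in>Basis. \<Sum>m\<in>UNIV. 1 / 4 * (Gam_proj p $ a $ m * (of_real (vol4 p [b, b', v, w]) * Gam_comm b b' $ m $ c)))"
    by (simp add: spin_curv_nth sum_distrib_left mult_ac)
  also have "\<dots> = 1 / 4 * (\<Sum>m\<in>UNIV. Gam_proj p $ a $ m * (\<Sum>b\<in>Basis. \<Sum>b'\<in>Basis. of_real (vol4 p [b, b', v, w]) * Gam_comm b b' $ m $ c))"
    by (simp only: sum_distrib_left sum.swap[of _ UNIV Basis])
  also have "\<dots> = 1 / 4 * (\<Sum>m\<in>UNIV. Gam_proj p $ a $ m * (2 * (Gam p ** Gam_comm v w) $ m $ c))"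
    unfolding sum_Gam_comm_vol4 vw by simp
  also have "\<dots> = 2 * (1 / 4 * (Gam_proj p ** (Gam p ** Gam_comm v w)) $ a $ c)"
    by (simp add: matrix_matrix_mult_def sum_distrib_left mult_ac)
  also have "Gam_proj p ** (Gam p ** Gam_comm v w) = Gam_proj p ** Gam_comm v w"
    by (simp only: matrix_mul_assoc Gam_proj_Gam[OF p])
  finally show ?thesis by (simp add: spin_curv_def)
qed

definition zeta :: "(real^5 \<Rightarrow> complex) \<Rightarrow> 4 \<Rightarrow> 4 \<Rightarrow> (real^5) form" where
  "zeta f a b = form2 (\<lambda>p u v. f p * spin_curv p u v $ a $ b)"

lemma zeta_self_dual: "hodge4 (zeta f a b) = zeta f a b"
  unfolding zeta_def
proof (rule hodge4_form2)
  show "linear (\<lambda>u. f p * spin_curv p u u' $ a $ b)" "linear (\<lambda>u. f p * spin_curv p u' u $ a $ b)" for p u'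
    by (rule linearI; simp add: linear_add[OF spin_curv_linear(1)] linear_cmul[OF spin_curv_linear(1)]
      linear_add[OF spin_curv_linear(2)] linear_cmul[OF spin_curv_linear(2)] algebra_simps)+
  fix p v w :: "real^5" assume "norm p = 1" "p \<bullet> v = 0" "p \<bullet> w = 0"
  from spin_curv_self_dual[OF this, of a b]
  show "(\<Sum>b'\<in>Basis. \<Sum>b''\<in>Basis. of_real (vol4 p [b', b'', v, w]) * (f p * spin_curv p b' b'' $ a $ b)) = 2 * (f p * spin_curv p v w $ a $ b)"
    by (simp add: mult.left_commute[of _ "f p"] sum_distrib_left[symmetric])
qed

lemma zeta_sphere_form:
  assumes "smooth_on UNIV f" shows "zeta f a b \<in> sphere_forms"
  unfolding zeta_def
proof (rule form2_sphere_form)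
  show "linear (\<lambda>u. f p * spin_curv p u u' $ a $ b)" for p u'
    by (rule linearI; simp add: linear_add[OF spin_curv_linear(1)] linear_cmul[OF spin_curv_linear(1)] algebra_simps)
  show "f p * spin_curv p v w $ a $ b = - (f p * spin_curv p w v $ a $ b)" for p v w
    by (simp add: spin_curv_swap[of p v w])
  have "smooth_on UNIV (\<lambda>p. Gam_proj p $ a $ m)" for a m
    unfolding Gam_proj_def mscale_nth vector_add_component
    by (intro smooth_on_mult smooth_on_add smooth_on_const smooth_on_linear open_UNIV
        linear_conv_bounded_linear[THEN iffD1] linear_Gam)
  then show "smooth_on UNIV (\<lambda>p. f p * spin_curv p u v $ a $ b)" for u v
    unfolding spin_curv_nth
    by (intro smooth_on_mult smooth_on_sum smooth_on_const open_UNIV assms)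
qed

lemma sphere_pullback_hopf_zeta:
  "sphere_pullback hopf (zeta f a b)
    = form2 (\<lambda>x v w. f (hopf x) * spin_curv (hopf x) (hopf_deriv x v) (hopf_deriv x w) $ a $ b)"
  unfolding sphere_pullback_hopf zeta_def
  by (auto simp: fun_eq_iff on_sphere_def form2_def sphere_tangent_hopf sphere_tangent_simps hopf_unit hopf_deriv_tangent
      split: list.splits)

text \<open>The torus acts on spinors by diagonal matrices, and conjugation by them covers the
  rotation of R^5. This yields the degrees of the entries of \<open>spin_curv\<close>.\<close>

lemma Gam_rot5: "Gam (rot5 s p) $ a $ b = torus_char (coord_degree a) s * Gam p $ a $ b * cnj (torus_char (coord_degree b) s)"
proof -
  have c: "torus_char (0, - 1) s = cnj (torus_char (0, 1) s)" "torus_char (- 1, 0) s = cnj (torus_char (1, 0) s)"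
    "torus_char (1, 1) s = torus_char (1, 0) s * torus_char (0, 1) s"
    "torus_char (- 1, 1) s = cnj (torus_char (1, 0) s) * torus_char (0, 1) s"
    by (simp_all add: torus_char_uminus[symmetric] torus_char_add[symmetric])
  have n: "Re (torus_char r s) * Re (torus_char r s) + Im (torus_char r s) * Im (torus_char r s) = 1" for r
    using torus_char_Re_Im[of r s] by (simp add: power2_eq_square)
  have "\<forall>a b. Gam (rot5 s p) $ a $ b = torus_char (coord_degree a) s * Gam p $ a $ b * cnj (torus_char (coord_degree b) s)"
    using n[of "(1, 0)"] n[of "(0, 1)"]
    unfolding forall_4 Gam_nth rot5_nth coord_degree_simps c
    by (simp add: complex_eq_iff) (intro conjI; (algebra | simp add: algebra_simps))
  then show ?thesis by blast
qed

lemma torus_conj_mult: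
  assumes "\<And>a b. M' $ a $ b = torus_char (coord_degree a) s * M $ a $ b * cnj (torus_char (coord_degree b) s)"
    and "\<And>a b. N' $ a $ b = torus_char (coord_degree a) s * N $ a $ b * cnj (torus_char (coord_degree b) s)"
  shows "(M' ** N') $ a $ b = torus_char (coord_degree a) s * (M ** N) $ a $ b * cnj (torus_char (coord_degree b) s)"
proof -
  have "M' $ a $ m * N' $ m $ b = torus_char (coord_degree a) s * (M $ a $ m * N $ m $ b) * cnj (torus_char (coord_degree b) s)" for m
  proof -
    have "M' $ a $ m * N' $ m $ b = (cnj (torus_char (coord_degree m) s) * torus_char (coord_degree m) s)
        * (torus_char (coord_degree a) s * (M $ a $ m * N $ m $ b) * cnj (torus_char (coord_degree b) s))"
      unfolding assms by (simp only: mult_ac)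
    then show ?thesis by simp
  qed
  then show ?thesis by (simp add: matrix_matrix_mult_def sum_distrib_left sum_distrib_right)
qed

lemma spin_curv_rot5:
  "spin_curv (rot5 s p) (rot5 s u) (rot5 s v) $ a $ b
    = torus_char (coord_degree a) s * spin_curv p u v $ a $ b * cnj (torus_char (coord_degree b) s)"
proof -
  have one: "torus_char r s * cnj (torus_char r s) = 1" for r
    using torus_char_cnj_mult[of r s] by (simp only: mult.commute)
  have "Gam_proj (rot5 s p) $ a $ b = torus_char (coord_degree a) s * Gam_proj p $ a $ b * cnj (torus_char (coord_degree b) s)" for a b
    unfolding Gam_proj_def mscale_nth vector_add_component Gam_rot5 mat_nth
    by (cases "a = b") (simp_all add: algebra_simps one)
  moreover have "Gam_comm (rot5 s u) (rot5 s v) $ a $ b = torus_char (coord_degree a) s * Gam_comm u v $ a $ b * cnj (torus_char (coord_degree b) s)" for a b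
    unfolding Gam_comm_def vector_minus_component torus_conj_mult[OF Gam_rot5 Gam_rot5] by (simp add: algebra_simps)
  ultimately have "(Gam_proj (rot5 s p) ** Gam_comm (rot5 s u) (rot5 s v)) $ a $ b
    = torus_char (coord_degree a) s * (Gam_proj p ** Gam_comm u v) $ a $ b * cnj (torus_char (coord_degree b) s)"
    by (rule torus_conj_mult)
  then show ?thesis by (simp add: spin_curv_def)
qed

lemma homogeneous_zeta:
  assumes "\<And>s x. norm x = 1 \<Longrightarrow> f (hopf (torus_act s x)) = torus_char e s * f (hopf x)"
  shows "homogeneous (coord_degree a - coord_degree b + e) (sphere_pullback hopf (zeta f a b))"
  unfolding sphere_pullback_hopf_zeta
proof (rule homogeneous_form2)
  fix s and x v w :: "complex^4" assume "norm x = 1"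
  then show "f (hopf (torus_act s x)) * spin_curv (hopf (torus_act s x)) (hopf_deriv (torus_act s x) (torus_act s v)) (hopf_deriv (torus_act s x) (torus_act s w)) $ a $ b
    = torus_char (coord_degree a - coord_degree b + e) s * (f (hopf x) * spin_curv (hopf x) (hopf_deriv x v) (hopf_deriv x w) $ a $ b)"
    using assms[of x s]
    by (simp only: hopf_deriv_torus_act hopf_torus_act spin_curv_rot5)
       (simp add: torus_char_add torus_char_uminus diff_conv_add_uminus mult_ac del: add_uminus_conv_diff)
qed

section \<open>Adjoint sections and a self-dual presentation of the curvature\<close>

subsection \<open>Sections of the adjoint bundle\<close>

lemma SU2_nth:
  assumes "w \<in> SU2"
  shows "w $ 1 $ 2 = - cnj (w $ 2 $ 1)" "w $ 2 $ 2 = cnj (w $ 1 $ 1)"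
    "cnj (w $ 1 $ 1) * w $ 1 $ 1 + cnj (w $ 2 $ 1) * w $ 2 $ 1 = 1"
proof -
  \<comment> \<open>The adjugate of w; as det w = 1 it is the inverse of w and so equals the
    conjugate transpose.\<close>
  let ?A = "vector [vector [w $ 2 $ 2, - w $ 1 $ 2], vector [- w $ 2 $ 1, w $ 1 $ 1]] :: complex^2^2"
  have w: "conj_transpose w ** w = mat 1" and d: "w $ 1 $ 1 * w $ 2 $ 2 - w $ 1 $ 2 * w $ 2 $ 1 = 1"
    using assms by (simp_all add: SU2_def det_2)
  have "?A ** w = mat 1"
    using d by (simp add: vec_eq_iff forall_2 matrix_matrix_mult_def sum_2 mat_nth algebra_simps)
  moreover have "w ** conj_transpose w = mat 1" using w matrix_left_right_inverse by blast
  moreover have "?A ** (w ** conj_transpose w) = (?A ** w) ** conj_transpose w" by (rule matrix_mul_assoc)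
  ultimately have "?A = conj_transpose w" by simp
  then have "?A $ i $ j = conj_transpose w $ i $ j" for i j by simp
  from this[of 1 1] this[of 1 2] show 1: "w $ 1 $ 2 = - cnj (w $ 2 $ 1)" "w $ 2 $ 2 = cnj (w $ 1 $ 1)"
    by (simp_all add: conj_transpose_def minus_equation_iff[of "w $ 1 $ 2"])
  show "cnj (w $ 1 $ 1) * w $ 1 $ 1 + cnj (w $ 2 $ 1) * w $ 2 $ 1 = 1"
    using d unfolding 1 by (simp add: mult.commute)
qed

lemma matrix_inv_SU2: "w \<in> SU2 \<Longrightarrow> matrix_inv w = conj_transpose w"
proof -
  assume "w \<in> SU2"
  then have 1: "conj_transpose w ** w = mat 1" by (simp add: SU2_def)
  then have 2: "w ** conj_transpose w = mat 1" using matrix_left_right_inverse by blast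
  have "w ** matrix_inv w = mat 1"
    unfolding matrix_inv_def by (rule someI2[of _ "conj_transpose w"]) (use 1 2 in auto)
  moreover have "conj_transpose w ** (w ** matrix_inv w) = (conj_transpose w ** w) ** matrix_inv w"
    by (rule matrix_mul_assoc)
  ultimately show ?thesis using 1 by simp
qed

lemma Psi_at_SU2_act:
  assumes "w \<in> SU2" shows "Psi_at (SU2_act w x) = Psi_at x ** w"
proof -
  have "\<forall>k j. Psi_at (SU2_act w x) $ k $ j = (Psi_at x ** w) $ k $ j"
    unfolding forall_4 forall_2
    by (simp add: Psi_at_nth SU2_act_def matrix_matrix_mult_def sum_2 SU2_nth[OF assms])
  then show ?thesis by (simp add: vec_eq_iff)
qed

lemma SU2_act_unit:
  assumes "w \<in> SU2" "norm x = 1" shows "norm (SU2_act w x) = 1"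
proof -
  have w: "conj_transpose w ** w = mat 1" using assms(1) by (simp add: SU2_def)
  have ct: "conj_transpose (A ** B) = conj_transpose B ** conj_transpose A" for A :: "complex^2^4" and B :: "complex^2^2"
    by (simp add: conj_transpose_def vec_eq_iff matrix_matrix_mult_def mult.commute)
  have "sandwich (mat 1) (SU2_act w x) (SU2_act w x)
      = conj_transpose w ** (conj_transpose (Psi_at x) ** Psi_at x) ** w"
    unfolding sandwich_one Psi_at_SU2_act[OF assms(1)] ct by (simp only: matrix_mul_assoc)
  also have "\<dots> = mat 1" unfolding Psi_dagger_Psi[OF assms(2)] matrix_mul_rid w ..
  finally have "mat (of_real (SU2_act w x \<bullet> SU2_act w x)) = (mat 1 :: complex^2^2)"
    unfolding sandwich_one_diag .
  from arg_cong[OF this, of "\<lambda>M. M $ 1 $ 1"] have "complex_of_real (SU2_act w x \<bullet> SU2_act w x) = 1"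
    unfolding mat_nth by simp
  then show ?thesis unfolding norm_eq_1 of_real_eq_1_iff .
qed

lemma bounded_linear_SU2_act: "bounded_linear (SU2_act w)"
proof -
  have "linear (SU2_act w)"
    by (rule linearI)
       (simp_all add: SU2_act_def vec_eq_iff matrix_matrix_mult_def linear_add[OF linear_Psi_at] linear_cmul[OF linear_Psi_at]
         scaleR_conv_of_real[where 'a = complex] algebra_simps sum.distrib sum_distrib_left)
  then show ?thesis using linear_conv_bounded_linear by blast
qed

text \<open>The trace-free part of Psi^H E_ab Psi for the matrix unit E_ab. Since w acts by Psi(x)
  -> Psi(x) w, such a matrix is adjoint-equivariant.\<close>

definition Psi_section :: "4 \<Rightarrow> 4 \<Rightarrow> complex^4 \<Rightarrow> complex^2^2" where
  "Psi_section a b x = (\<chi> i j. cnj (Psi_at x $ a $ i) * Psi_at x $ b $ j - (if i = j then Psi_proj x $ b $ a / 2 else 0))"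

lemma Psi_proj_nth: "Psi_proj x $ b $ a = Psi_at x $ b $ 1 * cnj (Psi_at x $ a $ 1) + Psi_at x $ b $ 2 * cnj (Psi_at x $ a $ 2)"
  by (simp add: Psi_proj_def matrix_matrix_mult_def conj_transpose_def sum_2)

lemma Psi_section_SU2_act:
  assumes "w \<in> SU2"
  shows "Psi_section a b (SU2_act w x) = conj_transpose w ** Psi_section a b x ** w"
proof -
  note n = SU2_nth[OF assms]
  have P: "Psi_proj (SU2_act w x) $ b $ a = Psi_proj x $ b $ a"
    using n(3) unfolding Psi_proj_nth Psi_at_SU2_act[OF assms]
    by (simp add: matrix_matrix_mult_def sum_2 n(1,2)) algebra
  define t where "t = Psi_proj x $ b $ a / 2"
  have "\<forall>i j. Psi_section a b (SU2_act w x) $ i $ j = (conj_transpose w ** Psi_section a b x ** w) $ i $ j"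
    using n(3) unfolding forall_2 Psi_section_def P t_def[symmetric] Psi_at_SU2_act[OF assms]
    by (simp add: matrix_matrix_mult_def sum_2 conj_transpose_def n(1,2)) (intro conjI; (algebra | simp add: algebra_simps))
  then show ?thesis by (simp add: vec_eq_iff)
qed

definition section_form :: "4 \<Rightarrow> 4 \<Rightarrow> s7_form^2^2" where
  "section_form a b = (\<chi> i j. fn_form (\<lambda>x. Psi_section a b x $ i $ j))"

lemma Psi_at_smooth: "smooth_on UNIV (\<lambda>x. Psi_at x $ k $ i)"
  by (intro smooth_on_linear linear_conv_bounded_linear[THEN iffD1] linear_Psi_at open_UNIV)

lemma section_form_Gamma_ad: "section_form a b \<in> Gamma_ad"
  unfolding Gamma_ad_def
proof (intro CollectI conjI allI ballI)
  fix i j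
  have c: "smooth_on UNIV (\<lambda>x. cnj (Psi_at x $ k $ i))" for k i
    by (rule smooth_on_bounded_linear[OF bounded_linear_cnj open_UNIV Psi_at_smooth])
  have m: "smooth_on UNIV (\<lambda>x. cnj (Psi_at x $ k $ i) * Psi_at x $ l $ j)"
    "smooth_on UNIV (\<lambda>x. Psi_at x $ l $ j * cnj (Psi_at x $ k $ i))" for k l i j
    by (rule smooth_on_mult[OF open_UNIV c Psi_at_smooth] smooth_on_mult[OF open_UNIV Psi_at_smooth c])+
  have "smooth_on UNIV (\<lambda>x. Psi_section a b x $ i $ j)"
  proof (cases "i = j")
    case True
    show ?thesis
      unfolding Psi_section_def Psi_proj_nth vec_lambda_beta True divide_inverse
      by (simp only: refl if_True) (rule smooth_on_diff[OF open_UNIV m(1)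
          smooth_on_mult[OF open_UNIV smooth_on_add[OF open_UNIV m(2) m(2)] smooth_on_const]])
  next
    case False
    then show ?thesis unfolding Psi_section_def by (simp add: m)
  qed
  then show "section_form a b $ i $ j \<in> sphere_functions"
    by (simp add: section_form_def fn_form_sphere_function)
next
  have "Psi_section a b x $ 1 $ 1 + Psi_section a b x $ 2 $ 2 = 0" for x
    by (simp add: Psi_section_def Psi_proj_nth field_simps)
  then show "section_form a b $ 1 $ 1 + section_form a b $ 2 $ 2 = 0"
    by (simp add: section_form_def form_arith zero_form(1)[symmetric])
next
  fix w assume w: "w \<in> SU2"
  have pull: "sphere_pullback (SU2_act w) (fn_form f) = fn_form (\<lambda>x. f (SU2_act w x))" for f
    unfolding sphere_pullback_linear[OF bounded_linear_SU2_act]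
    by (auto simp: fun_eq_iff fn_form_def on_sphere_def sphere_tangent_def SU2_act_unit[OF w])
  show "map_matrix (sphere_pullback (SU2_act w)) (section_form a b)
    = const_mult_left (matrix_inv w) (const_mult_right (section_form a b) w)"
    by (simp add: vec_eq_iff section_form_def pull matrix_inv_SU2[OF w] const_mult_left_def const_mult_right_def
        form_arith sum_form Psi_section_SU2_act[OF w] matrix_matrix_mult_def sum_2 algebra_simps)
qed

lemma homogeneous_section_form: "homogeneous (coord_degree b - coord_degree a) (section_form a b $ i $ j)"
proof -
  have "Psi_section a b (torus_act s x) $ i $ j = torus_char (coord_degree b - coord_degree a) s * Psi_section a b x $ i $ j" for s x
  proof -
    have "torus_char (coord_degree b - coord_degree a) s = torus_char (coord_degree b) s * cnj (torus_char (coord_degree a) s)"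
      using torus_char_add[of "coord_degree b" "- coord_degree a" s] by (simp add: torus_char_uminus)
    then show ?thesis
      by (cases "i = j") (simp_all add: Psi_section_def Psi_proj_nth Psi_at_torus_act field_simps)
  qed
  then show ?thesis by (simp add: section_form_def homogeneous_fn_form)
qed

subsection \<open>Self-dual adjoint-valued forms\<close>

lemma ad_hodge_graph_sum:
  assumes "finite I" "\<And>k. k \<in> I \<Longrightarrow> \<zeta> k \<in> sphere_forms" "\<And>k. k \<in> I \<Longrightarrow> X k \<in> Gamma_ad"
  shows "(\<Sum>k\<in>I. left_mult \<theta> (sphere_pullback hopf (\<zeta> k)) (X k),
    \<Sum>k\<in>I. left_mult \<theta> (sphere_pullback hopf (hodge4 (\<zeta> k))) (X k)) \<in> ad_hodge_graph \<theta>"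
proof -
  obtain h where h: "bij_betw h {0..<card I} I"
    using ex_bij_betw_nat_finite[OF assms(1)] by blast
  then have h': "bij_betw h {..<card I} I" by (simp add: atLeast0LessThan)
  have "h k \<in> I" if "k < card I" for k using h' that bij_betwE by fastforce
  then have "\<forall>k<card I. \<zeta> (h k) \<in> sphere_forms \<and> X (h k) \<in> Gamma_ad" using assms by blast
  moreover note sum.reindex_bij_betw[OF h', of "\<lambda>k. left_mult \<theta> (sphere_pullback hopf (\<zeta> k)) (X k)", symmetric]
    sum.reindex_bij_betw[OF h', of "\<lambda>k. left_mult \<theta> (sphere_pullback hopf (hodge4 (\<zeta> k))) (X k)", symmetric]
  ultimately show ?thesis
    unfolding ad_hodge_graph_def
    by (intro CollectI case_prodI exI[of _ "card I"] exI[of _ "\<lambda>k. \<zeta> (h k)"] exI[of _ "\<lambda>k. X (h k)"]) blast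
qed

lemma phase_cnj_mult: "phase \<theta> r q * cnj (phase \<theta> r q) = 1"
  by (simp add: phase_def cis_cnj cis_mult)

text \<open>Expanding \<open>spin_curv\<close> in matrix units writes F_0 through the sections Psi^H
  E_ab Psi. Replacing these by their trace-free parts changes the sum by a multiple of the trace of
  F_0, which is zero.\<close>

lemma basic_curv_sections:
  assumes x: "norm x = 1" and vw: "x \<bullet> v = 0" "x \<bullet> w = 0"
  shows "(\<Sum>(a, b)\<in>UNIV. Psi_section a b x $ i $ j * spin_curv (hopf x) (hopf_deriv x v) (hopf_deriv x w) $ a $ b)
    = basic_curv x v w $ i $ j"
proof -
  let ?s = "spin_curv (hopf x) (hopf_deriv x v) (hopf_deriv x w)"
  have sw: "sandwich ?s x x $ i $ j = (\<Sum>(a, b)\<in>UNIV. cnj (Psi_at x $ a $ i) * Psi_at x $ b $ j * ?s $ a $ b)" for i j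
    by (simp add: sandwich_nth UNIV_Times_UNIV[symmetric] sum.cartesian_product[symmetric] mult_ac del: UNIV_Times_UNIV)
  have "(\<Sum>(a, b)\<in>UNIV. Psi_proj x $ b $ a * ?s $ a $ b) = (\<Sum>i\<in>UNIV. sandwich ?s x x $ i $ i)"
    unfolding sw sum_2 by (simp add: Psi_proj_nth case_prod_unfold sum.distrib[symmetric] algebra_simps)
  also have "\<dots> = 0"
    unfolding basic_curv_spin_curv[OF assms, symmetric] by (rule basic_curv_trace)
  finally have tr: "(\<Sum>(a, b)\<in>UNIV. Psi_proj x $ b $ a / 2 * ?s $ a $ b) = 0"
    by (simp add: case_prod_unfold sum_divide_distrib[symmetric])
  have "(\<Sum>(a, b)\<in>UNIV. Psi_section a b x $ i $ j * ?s $ a $ b)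
    = sandwich ?s x x $ i $ j - (if i = j then (\<Sum>(a, b)\<in>UNIV. Psi_proj x $ b $ a / 2 * ?s $ a $ b) else 0)"
    unfolding sw by (simp add: Psi_section_def case_prod_unfold left_diff_distrib sum_subtractf)
  then show ?thesis unfolding tr basic_curv_spin_curv[OF assms] by simp
qed

text \<open>The deformed product of the (a, b) coefficient form and the (a, b) section creates the
  phase \<open>?k a b\<close>. Multiplying the coefficient by the conjugate phase cancels it, so the
  deformed sum has the classical value. Each coefficient is its own Hodge dual, so the same
  presentation serves for both members of the pair.\<close>

lemma basic_curv_self_dual:
  assumes smooth: "smooth_on UNIV f"
    and hom: "\<And>s x. norm x = 1 \<Longrightarrow> f (hopf (torus_act s x)) = torus_char e s * f (hopf x)"
  defines "F \<equiv> form2_mat (\<lambda>x v w. mscale (f (hopf x)) (basic_curv x v w))"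
  shows "(F, F) \<in> ad_hodge_graph \<theta>"
proof -
  let ?k = "\<lambda>a b. phase \<theta> (coord_degree a - coord_degree b + e) (coord_degree b - coord_degree a)"
  define \<zeta> where "\<zeta> = (\<lambda>(a, b). zeta (\<lambda>p. cnj (?k a b) * f p) a b)"
  define X where "X = (\<lambda>(a, b). section_form a b)"
  have z: "\<zeta> k \<in> sphere_forms" "X k \<in> Gamma_ad" "hodge4 (\<zeta> k) = \<zeta> k" for k
    by (auto simp: \<zeta>_def X_def section_form_Gamma_ad zeta_self_dual split: prod.split
        intro!: zeta_sphere_form smooth_on_mult smooth_on_const smooth)
  have summand: "left_mult \<theta> (sphere_pullback hopf (\<zeta> (a, b))) (X (a, b)) $ i $ j
    = form2 (\<lambda>x v w. f (hopf x) * (Psi_section a b x $ i $ j * spin_curv (hopf x) (hopf_deriv x v) (hopf_deriv x w) $ a $ b))"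
    for a b i j
  proof -
    have h: "homogeneous (coord_degree a - coord_degree b + e) (sphere_pullback hopf (zeta (\<lambda>p. cnj (?k a b) * f p) a b))"
      by (rule homogeneous_zeta) (simp add: hom)
    have cancel: "?k a b * (y * (cnj (?k a b) * f' * t)) = f' * (y * t)" for y f' t
    proof -
      have "?k a b * (y * (cnj (?k a b) * f' * t)) = (?k a b * cnj (?k a b)) * (f' * (y * t))" by (simp only: mult_ac)
      then show ?thesis by (simp add: phase_cnj_mult)
    qed
    show ?thesis
      by (simp add: left_mult_def \<zeta>_def X_def dprod_homogeneous[OF h homogeneous_section_form])
         (simp only: section_form_def sphere_pullback_hopf_zeta wedge_low form_arith vec_lambda_beta cancel)
  qed
  have "(\<Sum>k\<in>UNIV. left_mult \<theta> (sphere_pullback hopf (\<zeta> k)) (X k)) = F"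
  proof -
    have "(\<Sum>k\<in>UNIV. left_mult \<theta> (sphere_pullback hopf (\<zeta> k)) (X k)) $ i $ j = F $ i $ j" for i j
    proof -
      have "(\<Sum>k\<in>UNIV. left_mult \<theta> (sphere_pullback hopf (\<zeta> k)) (X k)) $ i $ j
        = (\<Sum>k\<in>UNIV. form2 (\<lambda>x v w. f (hopf x) * (Psi_section (fst k) (snd k) x $ i $ j
            * spin_curv (hopf x) (hopf_deriv x v) (hopf_deriv x w) $ fst k $ snd k)))"
        by (simp add: summand[symmetric])
      also have "\<dots> = F $ i $ j"
        unfolding sum_form F_def form2_mat_def vec_lambda_beta mscale_nth
        by (rule form2_cong) (simp add: basic_curv_sections[symmetric] case_prod_unfold sum_distrib_left)
      finally show ?thesis .
    qed
    then show ?thesis by (simp add: vec_eq_iff)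
  qed
  then show ?thesis
    using ad_hodge_graph_sum[of UNIV \<zeta> X \<theta>] z by simp
qed

section \<open>Periods around horizontal great circles\<close>

subsection \<open>Obstruction to gauge triviality\<close>

definition great_circle :: "'a::real_vector \<Rightarrow> 'a \<Rightarrow> real \<Rightarrow> 'a" where
  "great_circle x y t = cos t *\<^sub>R x + sin t *\<^sub>R y"

definition great_circle_velocity :: "'a::real_vector \<Rightarrow> 'a \<Rightarrow> real \<Rightarrow> 'a" where
  "great_circle_velocity x y t = - sin t *\<^sub>R x + cos t *\<^sub>R y"

lemma has_vector_derivative_great_circle:
  "(great_circle x y has_vector_derivative great_circle_velocity x y t) (at t)"
  for x y :: "'a::real_normed_vector"
  unfolding great_circle_def[abs_def] great_circle_velocity_def has_vector_derivative_def
  by (auto intro!: derivative_eq_intros simp: algebra_simps)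

lemma great_circle_unit:
  fixes x y :: "'a::real_inner"
  assumes "norm x = 1" "norm y = 1" "x \<bullet> y = 0"
  shows "norm (great_circle x y t) = 1" "great_circle x y t \<bullet> great_circle_velocity x y t = 0"
proof -
  have "x \<bullet> x = 1" "y \<bullet> y = 1" "y \<bullet> x = 0" using assms by (simp_all add: norm_eq_1 inner_commute)
  then show "norm (great_circle x y t) = 1" "great_circle x y t \<bullet> great_circle_velocity x y t = 0"
    using assms(3) sin_cos_squared_add[of t]
    by (simp_all add: norm_eq_1 great_circle_def great_circle_velocity_def inner_add_left inner_add_right inner_diff_left inner_diff_right algebra_simps power2_eq_square)
qed

lemma sandwich_great_circle:
  "sandwich g (great_circle x y t) (great_circle_velocity x y t) $ i $ j
    = (cos t)\<^sup>2 *\<^sub>R sandwich g x y $ i $ j - (sin t)\<^sup>2 *\<^sub>R sandwich g y x $ i $ j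
      + (cos t * sin t) *\<^sub>R (sandwich g y y $ i $ j - sandwich g x x $ i $ j)"
  "sandwich g (great_circle_velocity x y t) (great_circle x y t) $ i $ j
    = (cos t)\<^sup>2 *\<^sub>R sandwich g y x $ i $ j - (sin t)\<^sup>2 *\<^sub>R sandwich g x y $ i $ j
      + (cos t * sin t) *\<^sub>R (sandwich g y y $ i $ j - sandwich g x x $ i $ j)"
proof -
  note l = sandwich_linear(1)[of g _ i j] sandwich_linear(2)[of g _ i j]
  show "sandwich g (great_circle x y t) (great_circle_velocity x y t) $ i $ j
    = (cos t)\<^sup>2 *\<^sub>R sandwich g x y $ i $ j - (sin t)\<^sup>2 *\<^sub>R sandwich g y x $ i $ j
      + (cos t * sin t) *\<^sub>R (sandwich g y y $ i $ j - sandwich g x x $ i $ j)"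
    "sandwich g (great_circle_velocity x y t) (great_circle x y t) $ i $ j
    = (cos t)\<^sup>2 *\<^sub>R sandwich g y x $ i $ j - (sin t)\<^sup>2 *\<^sub>R sandwich g x y $ i $ j
      + (cos t * sin t) *\<^sub>R (sandwich g y y $ i $ j - sandwich g x x $ i $ j)"
    unfolding great_circle_def great_circle_velocity_def linear_add[OF l(1)] linear_add[OF l(2)] linear_cmul[OF l(1)] linear_cmul[OF l(2)]
    by (simp_all add: algebra_simps power2_eq_square)
qed

lemma ext_deriv_singleton:
  assumes "norm x = 1" "x \<bullet> v = 0"
  shows "ext_deriv \<eta> x [v] = frechet_derivative (\<lambda>y. pullback sgn \<eta> y []) (at x) v"
  using assms by (simp add: ext_deriv_def on_sphere_def sphere_tangent_simps ext_deriv_flat_def)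

text \<open>The integral of d eta around a closed curve vanishes, and here it is 2 pi K.\<close>

lemma integral_ext_deriv_closed_curve:
  fixes \<eta> :: "'a::euclidean_space form"
  assumes \<eta>: "\<eta> \<in> sphere_functions" and xy: "norm x = 1" "norm y = 1" "x \<bullet> y = 0"
    and const: "\<And>t. ext_deriv \<eta> (great_circle x y t) [great_circle_velocity x y t] = K"
  shows "K = 0"
proof -
  let ?h = "\<lambda>y. pullback sgn \<eta> y []" and ?\<gamma> = "great_circle x y" and ?v = "great_circle_velocity x y"
  have smooth: "smooth_on (- {0}) ?h"
    using \<eta> by (auto simp: sphere_functions_def sphere_forms_def)
  have deriv: "((\<lambda>t. ?h (?\<gamma> t)) has_vector_derivative K) (at t)" for t
  proof -
    have 0: "?\<gamma> t \<in> - {0}" using great_circle_unit(1)[OF xy, of t] by auto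
    have D: "(?\<gamma> has_derivative (\<lambda>s. s *\<^sub>R ?v t)) (at t)"
      using has_vector_derivative_great_circle[of x y t] by (simp only: has_vector_derivative_def)
    have "frechet_derivative ?h (at (?\<gamma> t)) (s *\<^sub>R ?v t) = s *\<^sub>R K" for s
      using linear_cmul[OF has_derivative_linear[OF smooth_on_has_derivative[OF smooth 0]], of s "?v t"]
        ext_deriv_singleton[OF great_circle_unit[OF xy], of \<eta> t] const[of t] by simp
    then show ?thesis
      using has_derivative_compose[OF D smooth_on_has_derivative[OF smooth 0]]
      by (simp only: has_vector_derivative_def)
  qed
  have "((\<lambda>t. K) has_integral ?h (?\<gamma> (2 * pi)) - ?h (?\<gamma> 0)) {0..2 * pi}"
    by (rule fundamental_theorem_of_calculus) (simp, rule has_vector_derivative_at_within[OF deriv])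
  moreover have "?\<gamma> (2 * pi) = ?\<gamma> 0" by (simp add: great_circle_def)
  ultimately have 0: "((\<lambda>t. K) has_integral 0) {0..2 * pi}" by simp
  have "((\<lambda>t. K) has_integral (2 * pi) *\<^sub>R K) {0..2 * pi}"
    using has_integral_const_real[of K 0 "2 * pi"] by simp
  from has_integral_unique[OF this 0] have "(2 * pi) *\<^sub>R K = 0" .
  then show ?thesis by simp
qed

text \<open>A deformed product is not local, so vanishing of one factor at a point does not suffice
  in general. A homogeneous factor is its own only component, so the series then vanishes term by
  term even for an inhomogeneous X.\<close>

lemma dprod_vanishing:
  assumes X: "X \<in> sphere_functions" and \<eta>: "homogeneous r \<eta>" "\<eta> x vs = 0"
  shows "dprod \<theta> \<eta> X x vs = 0" "dprod \<theta> X \<eta> x vs = 0"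
proof -
  have "homog_comp q \<eta> x vs = 0" for q using \<eta> by (simp add: homog_comp_homogeneous)
  then have "wedge (homog_comp q \<eta>) (homog_comp q' X) x vs = 0" "wedge (homog_comp q' X) (homog_comp q \<eta>) x vs = 0" for q q'
    by (simp_all add: wedge_function_left[of "homog_comp q' X" x, OF sphere_functionsD(2)[OF X]]
        wedge_function_right[of "homog_comp q' X" x, OF sphere_functionsD(2)[OF X]])
  then show "dprod \<theta> \<eta> X x vs = 0" "dprod \<theta> X \<eta> x vs = 0"
    by (simp_all only: dprod_def case_prod_unfold mult_zero_right infsum_0)
qed

context conformal_direction
begin

text \<open>Along a horizontal great circle on which the height function vanishes, \<open>\<delta>\<close> takes a
  constant value on the velocity, whereas \<open>[\<nabla>\<^sub>0, X]\<close> is the derivative of the periodic function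
  \<open>X\<close>.\<close>

lemma not_gauge:
  assumes xy: "norm x = 1" "norm y = 1" "x \<bullet> y = 0"
    and hor: "sandwich (mat 1) x y = 0" "sandwich (mat 1) y x = 0"
    and g: "sandwich g x x = 0" "sandwich g y y = 0" "sandwich g y x = - sandwich g x y" "sandwich g x y \<noteq> 0"
    and X: "X \<in> Gamma_ad"
  shows "form1_mat delta \<noteq> nabla0_bracket \<theta> X"
proof
  assume eq: "form1_mat delta = nabla0_bracket \<theta> X"
  let ?\<gamma> = "great_circle x y" and ?v = "great_circle_velocity x y"
  have X': "X $ i $ j \<in> sphere_functions" for i j using X by (simp add: Gamma_ad_def)
  note u = great_circle_unit[OF xy]
  have cs: "(cos t)\<^sup>2 *\<^sub>R z + (sin t)\<^sup>2 *\<^sub>R z = z" for t and z :: complex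
    by (simp add: scaleR_add_left[symmetric])
  have cs': "- ((cos t)\<^sup>2 *\<^sub>R z) - (sin t)\<^sup>2 *\<^sub>R z = - z" for t and z :: complex
    using cs[of t z] by (metis add.commute minus_add_distrib diff_conv_add_uminus)
  \<comment> \<open>The diagonal terms vanish, and the antisymmetry in x and y combines the cross
    terms into (cos t)^2 + (sin t)^2 = 1: the value does not depend on t, and \<open>dheight\<close>
    is zero along the velocity.\<close>
  have sg: "sandwich g (?\<gamma> t) (?v t) = sandwich g x y" "sandwich g (?v t) (?\<gamma> t) = - sandwich g x y" for t
    by (simp_all add: vec_eq_iff sandwich_great_circle g cs cs')
  \<comment> \<open>The whole circle is horizontal, so the two products with omega in the gauge
    variation drop out.\<close>
  have so: "sandwich (mat 1) (?\<gamma> t) (?v t) = 0" for t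
    using xy(1,2) by (simp add: vec_eq_iff sandwich_great_circle hor sandwich_one_diag norm_eq_1)
  have d: "delta (?\<gamma> t) (?v t) $ i $ j = c * sandwich g x y $ i $ j" for t i j
    by (simp add: delta_def dheight_def sg so mat_nth)
  have om: "omega \<theta> $ i $ j = form1 (\<lambda>x v. sandwich (mat 1) x v $ i $ j)" for i j
    by (simp add: omega_eq form1_mat_def)
  have hom: "homogeneous 0 (omega \<theta> $ i $ j)" for i j
    unfolding om by (rule homogeneous_form1_mat[of "sandwich (mat 1)" 0, OF sandwich_one_torus_act])
  have "c * sandwich g x y $ i $ j = 0" for i j
  proof (rule integral_ext_deriv_closed_curve[OF X' xy])
    fix t
    have z: "(omega \<theta> $ k $ l) (?\<gamma> t) [?v t] = 0" for k l
      unfolding om by (simp add: form1_singleton u so)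
    have "c * sandwich g x y $ i $ j = (nabla0_bracket \<theta> X $ i $ j) (?\<gamma> t) [?v t]"
      unfolding eq[symmetric] by (simp add: form1_mat_def form1_singleton u d)
    also have "\<dots> = ext_deriv (X $ i $ j) (?\<gamma> t) [?v t]"
      by (simp add: nabla0_bracket_def mat_deriv_def mat_prod_def sum_fun_apply dprod_vanishing[OF X' hom z])
    finally show "ext_deriv (X $ i $ j) (?\<gamma> t) [?v t] = c * sandwich g x y $ i $ j" ..
  qed
  then show False using g(4) c by (simp add: vec_eq_iff)
qed

text \<open>Orders 0 and 1 are the functions 1 and -2 c h times F_0, of degrees 0 and e. The height
  has to descend to a smooth function on the 4-sphere for \<open>basic_curv_self_dual\<close> to
  apply.\<close>

lemma instanton:
  assumes h: "smooth_on UNIV h" "\<And>x. norm x = 1 \<Longrightarrow> height x = h (hopf x)"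
    and A: "A 0 = omega \<theta>" "A 1 = form1_mat delta" and n: "n < 2"
  shows "curvature_coeff \<theta> A n \<in> ad_forms \<theta>" "ad_hodge \<theta> (curvature_coeff \<theta> A n) = curvature_coeff \<theta> A n"
proof -
  have "(curvature_coeff \<theta> A n, curvature_coeff \<theta> A n) \<in> ad_hodge_graph \<theta>"
  proof (cases "n = 0")
    case True
    show ?thesis
      using basic_curv_self_dual[of "\<lambda>p. 1" 0 \<theta>] unfolding True curvature_coeff_0[of A, OF A(1)]
      by (simp add: smooth_on_const)
  next
    case False
    then have n1: "n = 1" using n by simp
    have "curvature_coeff \<theta> A 1 = form2_mat (\<lambda>x v w. mscale (- 2 * c * h (hopf x)) (basic_curv x v w))"
      unfolding curvature_coeff_1[of A, OF A] by (rule form2_mat_cong) (simp add: h(2))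
    moreover have "- 2 * c * h (hopf (torus_act s x)) = torus_char e s * (- 2 * c * h (hopf x))" if "norm x = 1" for s x
      using height_torus_act[of s x] that by (simp add: h(2) torus_act_unit)
    ultimately show ?thesis
      using basic_curv_self_dual[of "\<lambda>p. - 2 * c * h p" e \<theta>] unfolding n1
      by (simp add: smooth_on_mult smooth_on_const smooth_on_minus h(1))
  qed
  from ad_hodge_eqI[OF this]
  show "curvature_coeff \<theta> A n \<in> ad_forms \<theta>" "ad_hodge \<theta> (curvature_coeff \<theta> A n) = curvature_coeff \<theta> A n" .
qed

end

section \<open>The five Dirac matrices and the test circles\<close>

subsection \<open>The five directions\<close>

lemma gamma_nth:
  "gamma0 $ k $ l = (if k = l then if k = 1 \<or> k = 2 then 1 else - 1 else 0)"
  "gamma1 \<theta> $ k $ l = (if k = 2 \<and> l = 4 then 2 else if k = 3 \<and> l = 1 then 2 * cis (pi * \<theta>) else 0)"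
  "gamma2 \<theta> $ k $ l = (if k = 1 \<and> l = 4 then - 2 else if k = 3 \<and> l = 2 then 2 * cnj (cis (pi * \<theta>)) else 0)"
proof -
  have "\<forall>k l. gamma0 $ k $ l = (if k = l then if k = 1 \<or> k = 2 then 1 else - 1 else 0)"
    unfolding forall_4 by (simp add: gamma0_def mat_unit_def)
  then show "gamma0 $ k $ l = (if k = l then if k = 1 \<or> k = 2 then 1 else - 1 else 0)" by blast
qed (auto simp: gamma1_def gamma2_def mat_unit_def)

lemma conj_transpose_nth: "conj_transpose M $ i $ j = cnj (M $ j $ i)"
  by (simp add: conj_transpose_def)

lemma cis_half: "cis (pi * \<theta>) = cis (pi * \<theta> / 2) * cis (pi * \<theta> / 2)"
  by (simp add: cis_mult)

lemma cis_cnj_cancel: "cnj (cis a) * cis a = 1" "cis a * cnj (cis a) = 1" "cnj (cis a) * (cis a * z) = z" "cis a * (cnj (cis a) * z) = z"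
  by (simp_all add: cis_cnj cis_mult mult.assoc[symmetric])

lemma cis_uminus: "cis (- a) = cnj (cis a)"
  by (simp add: cis_cnj)

lemma unit_complex4_cnj:
  fixes x :: "complex^4"
  assumes "norm x = 1"
  shows "x $ 1 * cnj (x $ 1) + x $ 2 * cnj (x $ 2) + x $ 3 * cnj (x $ 3) + x $ 4 * cnj (x $ 4) = 1"
  using assms by (simp add: unit_complex4 complex_eq_iff power2_eq_square algebra_simps)

lemmas direction_simps = sandwich_nth sum_4 Psi_at_nth gamma_nth conj_transpose_nth mat_nth forall_4 forall_2
  matrix_matrix_mult_def sum_2 Psi_proj_nth

lemma gamma_diag:
  "sandwich gamma0 x x = mat (sandwich gamma0 x x $ 1 $ 1)"
  "sandwich (gamma1 0) x x = mat (sandwich (gamma1 0) x x $ 1 $ 1)"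
  "sandwich (gamma2 0) x x = mat (sandwich (gamma2 0) x x $ 1 $ 1)"
  "sandwich (conj_transpose (gamma1 0)) x x = mat (sandwich (conj_transpose (gamma1 0)) x x $ 1 $ 1)"
  "sandwich (conj_transpose (gamma2 0)) x x = mat (sandwich (conj_transpose (gamma2 0)) x x $ 1 $ 1)"
  by (simp_all add: vec_eq_iff direction_simps algebra_simps)

text \<open>The only place where unit length enters these matrix identities; entrywise they follow
  from |x|^2 = 1.\<close>

lemma gamma_anticomm:
  assumes "norm x = 1"
  shows "Psi_proj x ** gamma0 + gamma0 ** Psi_proj x = gamma0 + mat (sandwich gamma0 x x $ 1 $ 1)"
    "Psi_proj x ** gamma1 0 + gamma1 0 ** Psi_proj x = gamma1 0 + mat (sandwich (gamma1 0) x x $ 1 $ 1)"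
    "Psi_proj x ** gamma2 0 + gamma2 0 ** Psi_proj x = gamma2 0 + mat (sandwich (gamma2 0) x x $ 1 $ 1)"
    "Psi_proj x ** conj_transpose (gamma1 0) + conj_transpose (gamma1 0) ** Psi_proj x
      = conj_transpose (gamma1 0) + mat (sandwich (conj_transpose (gamma1 0)) x x $ 1 $ 1)"
    "Psi_proj x ** conj_transpose (gamma2 0) + conj_transpose (gamma2 0) ** Psi_proj x
      = conj_transpose (gamma2 0) + mat (sandwich (conj_transpose (gamma2 0)) x x $ 1 $ 1)"
  using unit_complex4_cnj[OF assms]
  unfolding vec_eq_iff
  by (simp_all add: direction_simps, (intro conjI; algebra)+)

lemma gamma_degree:
  "gamma0 $ k $ l \<noteq> 0 \<Longrightarrow> coord_degree l = coord_degree k + 0"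
  "gamma1 0 $ k $ l \<noteq> 0 \<Longrightarrow> coord_degree l = coord_degree k + (1, 1)"
  "gamma2 0 $ k $ l \<noteq> 0 \<Longrightarrow> coord_degree l = coord_degree k + (- 1, 1)"
  "conj_transpose (gamma1 0) $ k $ l \<noteq> 0 \<Longrightarrow> coord_degree l = coord_degree k + (- 1, - 1)"
  "conj_transpose (gamma2 0) $ k $ l \<noteq> 0 \<Longrightarrow> coord_degree l = coord_degree k + (1, - 1)"
  by (auto simp: gamma_nth conj_transpose_nth split: if_splits)

text \<open>The two nonzero entries of a twisted matrix would acquire opposite phases exp(+-pi i
  \<theta> / 2); the factor \<mu> or its conjugate on one of them makes both phases equal.\<close>

lemma gamma_phase:
  "phase \<theta> (- coord_degree k) (coord_degree k + 0) * gamma0 $ k $ l = 1 * gamma0 $ k $ l"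
  "phase \<theta> (- coord_degree k) (coord_degree k + (1, 1)) * gamma1 \<theta> $ k $ l = cis (pi * \<theta> / 2) * gamma1 0 $ k $ l"
  "phase \<theta> (- coord_degree k) (coord_degree k + (- 1, 1)) * gamma2 \<theta> $ k $ l = cnj (cis (pi * \<theta> / 2)) * gamma2 0 $ k $ l"
  "phase \<theta> (- coord_degree k) (coord_degree k + (- 1, - 1)) * conj_transpose (gamma1 \<theta>) $ k $ l = cnj (cis (pi * \<theta> / 2)) * conj_transpose (gamma1 0) $ k $ l"
  "phase \<theta> (- coord_degree k) (coord_degree k + (1, - 1)) * conj_transpose (gamma2 \<theta>) $ k $ l = cis (pi * \<theta> / 2) * conj_transpose (gamma2 0) $ k $ l"
  by (auto simp: gamma_nth conj_transpose_nth phase_def cis_half cis_uminus cis_cnj_cancel)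

lemma conformal_directions:
  "conformal_direction \<theta> gamma0 gamma0 0 1"
  "conformal_direction \<theta> (gamma1 0) (gamma1 \<theta>) (1, 1) (cis (pi * \<theta> / 2))"
  "conformal_direction \<theta> (gamma2 0) (gamma2 \<theta>) (- 1, 1) (cnj (cis (pi * \<theta> / 2)))"
  "conformal_direction \<theta> (conj_transpose (gamma1 0)) (conj_transpose (gamma1 \<theta>)) (- 1, - 1) (cnj (cis (pi * \<theta> / 2)))"
  "conformal_direction \<theta> (conj_transpose (gamma2 0)) (conj_transpose (gamma2 \<theta>)) (1, - 1) (cis (pi * \<theta> / 2))"
proof -
  show "conformal_direction \<theta> gamma0 gamma0 0 1"
    by unfold_locales (rule gamma_diag gamma_anticomm gamma_degree gamma_phase; assumption | simp)+
  show "conformal_direction \<theta> (gamma1 0) (gamma1 \<theta>) (1, 1) (cis (pi * \<theta> / 2))"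
    by unfold_locales (rule gamma_diag gamma_anticomm gamma_degree gamma_phase; assumption | simp)+
  show "conformal_direction \<theta> (gamma2 0) (gamma2 \<theta>) (- 1, 1) (cnj (cis (pi * \<theta> / 2)))"
    by unfold_locales (rule gamma_diag gamma_anticomm gamma_degree gamma_phase; assumption | simp)+
  show "conformal_direction \<theta> (conj_transpose (gamma1 0)) (conj_transpose (gamma1 \<theta>)) (- 1, - 1) (cnj (cis (pi * \<theta> / 2)))"
    by unfold_locales (rule gamma_diag gamma_anticomm gamma_degree gamma_phase; assumption | simp)+
  show "conformal_direction \<theta> (conj_transpose (gamma2 0)) (conj_transpose (gamma2 \<theta>)) (1, - 1) (cis (pi * \<theta> / 2))"
    by unfold_locales (rule gamma_diag gamma_anticomm gamma_degree gamma_phase; assumption | simp)+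
qed

lemma homogeneous_psi: "homogeneous (coord_degree i) (psi i)" "homogeneous (- coord_degree i) (form_cnj (psi i))"
  by (simp_all add: psi_def form_arith homogeneous_fn_form torus_act_nth torus_char_uminus)

lemma dprod_psi:
  "dprod \<theta> (form_cnj (psi i)) (psi j) = fn_form (\<lambda>x. phase \<theta> (- coord_degree i) (coord_degree j) * (cnj (x $ i) * x $ j))"
  "dprod \<theta> (psi i) (form_cnj (psi j)) = fn_form (\<lambda>x. phase \<theta> (coord_degree i) (- coord_degree j) * (x $ i * cnj (x $ j)))"
  unfolding dprod_homogeneous[OF homogeneous_psi(2) homogeneous_psi(1)] dprod_homogeneous[OF homogeneous_psi(1) homogeneous_psi(2)]
  by (simp_all add: psi_def form_arith wedge_low)

text \<open>The constants agree with those in \<open>gamma_phase\<close>, so z and Psi^H C dPsi are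
  deformed by the same factor.\<close>

lemma z_eq:
  "z0 \<theta> = fn_form (\<lambda>x. 1 * sandwich gamma0 x x $ 1 $ 1)"
  "z1 \<theta> = fn_form (\<lambda>x. cis (pi * \<theta> / 2) * sandwich (gamma1 0) x x $ 1 $ 1)"
  "z2 \<theta> = fn_form (\<lambda>x. cnj (cis (pi * \<theta> / 2)) * sandwich (gamma2 0) x x $ 1 $ 1)"
  "form_cnj (z1 \<theta>) = fn_form (\<lambda>x. cnj (cis (pi * \<theta> / 2)) * sandwich (conj_transpose (gamma1 0)) x x $ 1 $ 1)"
  "form_cnj (z2 \<theta>) = fn_form (\<lambda>x. cis (pi * \<theta> / 2) * sandwich (conj_transpose (gamma2 0)) x x $ 1 $ 1)"
proof -
  show 0: "z0 \<theta> = fn_form (\<lambda>x. 1 * sandwich gamma0 x x $ 1 $ 1)"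
    unfolding z0_def dprod_psi form_arith
  proof (rule fn_form_cong)
    fix x :: "complex^4" assume "norm x = 1"
    from unit_complex4_cnj[OF this]
    show "2 * (phase \<theta> (- coord_degree 1) (coord_degree 1) * (cnj (x $ 1) * x $ 1) + phase \<theta> (- coord_degree 2) (coord_degree 2) * (cnj (x $ 2) * x $ 2)) - 1
      = 1 * sandwich gamma0 x x $ 1 $ 1"
      by (simp add: direction_simps del: coord_degree_simps) algebra
  qed
  show 1: "z1 \<theta> = fn_form (\<lambda>x. cis (pi * \<theta> / 2) * sandwich (gamma1 0) x x $ 1 $ 1)"
    unfolding z1_def dprod_psi form_arith
    by (rule fn_form_cong) (simp add: direction_simps phase_def cis_uminus algebra_simps)
  show 2: "z2 \<theta> = fn_form (\<lambda>x. cnj (cis (pi * \<theta> / 2)) * sandwich (gamma2 0) x x $ 1 $ 1)"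
    unfolding z2_def dprod_psi form_arith
    by (rule fn_form_cong) (simp add: direction_simps phase_def cis_uminus algebra_simps)
  show "form_cnj (z1 \<theta>) = fn_form (\<lambda>x. cnj (cis (pi * \<theta> / 2)) * sandwich (conj_transpose (gamma1 0)) x x $ 1 $ 1)"
    unfolding 1 form_arith
    by (rule fn_form_cong) (simp add: direction_simps mult_ac)
  show "form_cnj (z2 \<theta>) = fn_form (\<lambda>x. cis (pi * \<theta> / 2) * sandwich (conj_transpose (gamma2 0)) x x $ 1 $ 1)"
    unfolding 2 form_arith
    by (rule fn_form_cong) (simp add: direction_simps mult_ac)
qed

lemma height_hopf:
  assumes "norm x = 1"
  shows "sandwich gamma0 x x $ 1 $ 1 = Complex (hopf x $ 1) 0"
    "sandwich (gamma1 0) x x $ 1 $ 1 = Complex (hopf x $ 2) (hopf x $ 3)"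
    "sandwich (gamma2 0) x x $ 1 $ 1 = Complex (hopf x $ 4) (hopf x $ 5)"
    "sandwich (conj_transpose (gamma1 0)) x x $ 1 $ 1 = Complex (hopf x $ 2) (- hopf x $ 3)"
    "sandwich (conj_transpose (gamma2 0)) x x $ 1 $ 1 = Complex (hopf x $ 4) (- hopf x $ 5)"
  using assms unfolding unit_complex4
  by (simp_all add: direction_simps hopf_Re_Im complex_eq_iff power2_eq_square algebra_simps)

lemma Complex_components_smooth:
  "smooth_on UNIV (\<lambda>p::real^5. Complex (p $ 1) 0)" "smooth_on UNIV (\<lambda>p::real^5. Complex (p $ k) (p $ l))"
  "smooth_on UNIV (\<lambda>p::real^5. Complex (p $ k) (- p $ l))"
  by (intro smooth_on_linear linear_conv_bounded_linear[THEN iffD1] linearI open_UNIV; simp add: complex_eq_iff algebra_simps)+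

text \<open>Both halves of the theorem for one direction, given the height as a function on the
  4-sphere and a pair x, y spanning a suitable great circle; the indices i, j name an entry on which
  the deformation is visibly nonzero.\<close>

lemma (in conformal_direction) deformation:
  assumes h: "smooth_on UNIV h" "\<And>x. norm x = 1 \<Longrightarrow> sandwich g x x $ 1 $ 1 = h (hopf x)"
    and A: "A 0 = omega \<theta>" "A 1 = D" and D: "D = form1_mat delta"
    and xy: "norm x = 1" "norm y = 1" "x \<bullet> y = 0"
    and hor: "sandwich (mat 1) x y = 0" "sandwich (mat 1) y x = 0"
    and g: "sandwich g x x = 0" "sandwich g y y = 0" "sandwich g y x = - sandwich g x y" "sandwich g x y $ i $ j \<noteq> 0"
  shows "(\<forall>n<2. curvature_coeff \<theta> A n \<in> ad_forms \<theta> \<and> ad_hodge \<theta> (curvature_coeff \<theta> A n) = curvature_coeff \<theta> A n)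
    \<and> \<not> (\<exists>X\<in>Gamma_ad. D = nabla0_bracket \<theta> X)"
proof -
  have "sandwich g x y \<noteq> 0" using g(4) by auto
  then show ?thesis
    using instanton[of h A, OF h(1)] h(2) A not_gauge[OF xy hor g(1-3)] unfolding D height_def by auto
qed

lemma delta_omega_eq:
  "delta_omega \<theta> 0 = form1_mat (conformal_direction.delta gamma0 1)"
  "delta_omega \<theta> 1 = form1_mat (conformal_direction.delta (gamma1 0) (cis (pi * \<theta> / 2)))"
  "delta_omega \<theta> 2 = form1_mat (conformal_direction.delta (gamma2 0) (cnj (cis (pi * \<theta> / 2))))"
  "delta_omega \<theta> 3 = form1_mat (conformal_direction.delta (conj_transpose (gamma1 0)) (cnj (cis (pi * \<theta> / 2))))"
  "delta_omega \<theta> 4 = form1_mat (conformal_direction.delta (conj_transpose (gamma2 0)) (cis (pi * \<theta> / 2)))"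
  using conformal_directions(1)[THEN conformal_direction.delta_forms(1), of \<theta>]
    conformal_directions(2)[THEN conformal_direction.delta_forms(1), of \<theta>]
    conformal_directions(3)[THEN conformal_direction.delta_forms(1), of \<theta>]
    conformal_directions(4)[THEN conformal_direction.delta_forms(2), of \<theta>]
    conformal_directions(5)[THEN conformal_direction.delta_forms(2), of \<theta>]
  unfolding conformal_direction.height_def[OF conformal_directions(1)] conformal_direction.height_def[OF conformal_directions(2)]
    conformal_direction.height_def[OF conformal_directions(3)] conformal_direction.height_def[OF conformal_directions(4)]
    conformal_direction.height_def[OF conformal_directions(5)] z_eq(1)[of \<theta>, symmetric] z_eq(2-)[symmetric]
  by (simp_all add: delta_omega_def numeral_eq_Suc)

text \<open>Endpoints of the test circles. The circle through probes 0 and 1 lies over the equator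
  z_0 = 0. Those from the first basis vector to the fourth and to the third lie over z_1 = 0 and z_2
  = 0; each of these two also serves the conjugate direction.\<close>

definition probe :: "nat \<Rightarrow> complex^4" where
  "probe n = [vector [1 / 2, 1 / 2, 1 / 2, 1 / 2], vector [\<i> / 2, \<i> / 2, - \<i> / 2, - \<i> / 2],
     vector [1, 0, 0, 0], vector [0, 0, 0, 1], vector [0, 0, 1, 0]] ! n"

lemma probe_nth:
  "probe 0 = vector [1 / 2, 1 / 2, 1 / 2, 1 / 2]" "probe 1 = vector [\<i> / 2, \<i> / 2, - \<i> / 2, - \<i> / 2]"
  "probe 2 = vector [1, 0, 0, 0]" "probe 3 = vector [0, 0, 0, 1]" "probe 4 = vector [0, 0, 1, 0]"
  by (simp_all add: probe_def numeral_eq_Suc)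

lemma probe_orthonormal:
  "norm (probe 0) = 1" "norm (probe 1) = 1" "norm (probe 2) = 1" "norm (probe 3) = 1" "norm (probe 4) = 1"
  "probe 0 \<bullet> probe 1 = 0" "probe 2 \<bullet> probe 3 = 0" "probe 2 \<bullet> probe 4 = 0"
  by (simp_all only: probe_nth unit_complex4 inner_complex4 vector_4) (simp_all add: power2_eq_square)

lemma probe_horizontal_01: "sandwich (mat 1) (probe 0) (probe 1) = 0" "sandwich (mat 1) (probe 1) (probe 0) = 0"
  unfolding probe_nth by (simp_all add: vec_eq_iff direction_simps)

lemma probe_horizontal_23: "sandwich (mat 1) (probe 2) (probe 3) = 0" "sandwich (mat 1) (probe 3) (probe 2) = 0"
  unfolding probe_nth by (simp_all add: vec_eq_iff direction_simps)

lemma probe_horizontal_24: "sandwich (mat 1) (probe 2) (probe 4) = 0" "sandwich (mat 1) (probe 4) (probe 2) = 0"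
  unfolding probe_nth by (simp_all add: vec_eq_iff direction_simps)

lemma probe_direction_0:
  "sandwich gamma0 (probe 0) (probe 0) = 0" "sandwich gamma0 (probe 1) (probe 1) = 0"
  "sandwich gamma0 (probe 1) (probe 0) = - sandwich gamma0 (probe 0) (probe 1)" "sandwich gamma0 (probe 0) (probe 1) $ 1 $ 1 \<noteq> 0"
  unfolding probe_nth vec_eq_iff forall_2 vector_uminus_component sandwich_nth sum_4 conj_transpose_nth gamma_nth Psi_at_nth vector_4
  by simp_all

lemma probe_direction_1:
  "sandwich (gamma1 0) (probe 2) (probe 2) = 0" "sandwich (gamma1 0) (probe 3) (probe 3) = 0"
  "sandwich (gamma1 0) (probe 3) (probe 2) = - sandwich (gamma1 0) (probe 2) (probe 3)" "sandwich (gamma1 0) (probe 2) (probe 3) $ 2 $ 1 \<noteq> 0"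
  unfolding probe_nth vec_eq_iff forall_2 vector_uminus_component sandwich_nth sum_4 conj_transpose_nth gamma_nth Psi_at_nth vector_4
  by simp_all

lemma probe_direction_2:
  "sandwich (gamma2 0) (probe 2) (probe 2) = 0" "sandwich (gamma2 0) (probe 4) (probe 4) = 0"
  "sandwich (gamma2 0) (probe 4) (probe 2) = - sandwich (gamma2 0) (probe 2) (probe 4)" "sandwich (gamma2 0) (probe 2) (probe 4) $ 1 $ 2 \<noteq> 0"
  unfolding probe_nth vec_eq_iff forall_2 vector_uminus_component sandwich_nth sum_4 conj_transpose_nth gamma_nth Psi_at_nth vector_4
  by simp_all

lemma probe_direction_3:
  "sandwich (conj_transpose (gamma1 0)) (probe 2) (probe 2) = 0" "sandwich (conj_transpose (gamma1 0)) (probe 3) (probe 3) = 0"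
  "sandwich (conj_transpose (gamma1 0)) (probe 3) (probe 2) = - sandwich (conj_transpose (gamma1 0)) (probe 2) (probe 3)" "sandwich (conj_transpose (gamma1 0)) (probe 2) (probe 3) $ 1 $ 2 \<noteq> 0"
  unfolding probe_nth vec_eq_iff forall_2 vector_uminus_component sandwich_nth sum_4 conj_transpose_nth gamma_nth Psi_at_nth vector_4
  by simp_all

lemma probe_direction_4:
  "sandwich (conj_transpose (gamma2 0)) (probe 2) (probe 2) = 0" "sandwich (conj_transpose (gamma2 0)) (probe 4) (probe 4) = 0"
  "sandwich (conj_transpose (gamma2 0)) (probe 4) (probe 2) = - sandwich (conj_transpose (gamma2 0)) (probe 2) (probe 4)" "sandwich (conj_transpose (gamma2 0)) (probe 2) (probe 4) $ 2 $ 1 \<noteq> 0"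
  unfolding probe_nth vec_eq_iff forall_2 vector_uminus_component sandwich_nth sum_4 conj_transpose_nth gamma_nth Psi_at_nth vector_4
  by simp_all

theorem proposition30:
  fixes \<theta> :: real and i :: nat and A :: "nat \<Rightarrow> s7_form^2^2"
  assumes "i \<le> 4"
    and "A 0 = omega \<theta>"
    and "A 1 = delta_omega \<theta> i"
  shows "(\<forall>n<2. curvature_coeff \<theta> A n \<in> ad_forms \<theta> \<and>
                ad_hodge \<theta> (curvature_coeff \<theta> A n) = curvature_coeff \<theta> A n) \<and>
         \<not> (\<exists>X\<in>Gamma_ad. delta_omega \<theta> i = nabla0_bracket \<theta> X)"
proof -
  note gen = conformal_direction.deformation[where A = A, OF _ _ _ assms(2,3)]
  note p = probe_orthonormal
  consider "i = 0" | "i = 1" | "i = 2" | "i = 3" | "i = 4" using assms(1) by linarith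
  then show ?thesis
  proof cases
    case 1
    have D: "delta_omega \<theta> i = delta_omega \<theta> 0" using 1 by simp
    show ?thesis
      by (rule gen[OF conformal_directions(1) Complex_components_smooth(1) height_hopf(1) D[unfolded delta_omega_eq]
            p(1) p(2) p(6) probe_horizontal_01 probe_direction_0])
  next
    case 2
    have D: "delta_omega \<theta> i = delta_omega \<theta> 1" using 2 by simp
    show ?thesis
      by (rule gen[OF conformal_directions(2) Complex_components_smooth(2) height_hopf(2) D[unfolded delta_omega_eq]
            p(3) p(4) p(7) probe_horizontal_23 probe_direction_1])
  next
    case 3
    have D: "delta_omega \<theta> i = delta_omega \<theta> 2" using 3 by simp
    show ?thesis
      by (rule gen[OF conformal_directions(3) Complex_components_smooth(2) height_hopf(3) D[unfolded delta_omega_eq]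
            p(3) p(5) p(8) probe_horizontal_24 probe_direction_2])
  next
    case 4
    have D: "delta_omega \<theta> i = delta_omega \<theta> 3" using 4 by simp
    show ?thesis
      by (rule gen[OF conformal_directions(4) Complex_components_smooth(3) height_hopf(4) D[unfolded delta_omega_eq]
            p(3) p(4) p(7) probe_horizontal_23 probe_direction_3])
  next
    case 5
    have D: "delta_omega \<theta> i = delta_omega \<theta> 4" using 5 by simp
    show ?thesis
      by (rule gen[OF conformal_directions(5) Complex_components_smooth(3) height_hopf(5) D[unfolded delta_omega_eq]
            p(3) p(5) p(8) probe_horizontal_24 probe_direction_4])
  qed
qed

end
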